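(* Let $N\ge5$ be an integer, $2^{**}=\frac{2N}{N-4}$, $q\in(2,2^{**}]$, and put $\beta=N-q\,\frac{N-4}{2}$. There exists $\lambda_0<0$ (depending on $N$ and $q$) such that for every $\lambda<\lambda_0$ one has $S_q(\lambda)<S_q^{\rm rad}(\lambda)$, and hence no extremal for $S_q(\lambda)$ is radially symmetric.
   Context: $\mathcal D^{2,2}(\mathbb{R}^N)$ ($N\ge5$) is the completion of $C^\infty_c(\mathbb{R}^N)$ with respect to the norm $\|u\|=\left(\int_{\mathbb{R}^N}|\Delta u|^2dx\right)^{1/2}$. For nonzero $u\in\mathcal D^{2,2}(\mathbb{R}^N)$ let $$Q(u)=\frac{\int_{\mathbb{R}^N}|\Delta u|^2dx-\lambda\int_{\mathbb{R}^N}|x|^{-4}|u|^2dx}{\left(\int_{\mathbb{R}^N}|x|^{-\beta}|u|^qdx\right)^{2/q}}.$$ $S_q(\lambda)$ is the infimum of $Q$ over all nonzero $u\in\mathcal D^{2,2}(\mathbb{R}^N)$, and $S_q^{\rm rad}(\lambda)$ is the infimum of $Q$ over all nonzero radially symmetric $u\in\mathcal D^{2,2}(\mathbb{R}^N)$. An extremal for $S_q(\lambda)$ is a nonzero $u\in\mathcal D^{2,2}(\mathbb{R}^N)$ with $Q(u)=S_q(\lambda)$. *)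

theory Defs
  imports "HOL-Analysis.Analysis"
begin

text \<open>
  Functions on \<open>\<real>\<^sup>N\<close> are real-valued. Elements of Lebesgue and Sobolev spaces are represented by
  Borel functions, to be read up to equality almost everywhere.
\<close>

definition directional_deriv :: "'a::euclidean_space \<Rightarrow> ('a \<Rightarrow> real) \<Rightarrow> 'a \<Rightarrow> real" where
  "directional_deriv v f x = frechet_derivative f (at x) v"

fun times_cont_differentiable :: "nat \<Rightarrow> ('a::euclidean_space \<Rightarrow> real) \<Rightarrow> bool" where
  "times_cont_differentiable 0 f \<longleftrightarrow> continuous_on UNIV f"
| "times_cont_differentiable (Suc k) f \<longleftrightarrow>
     (\<forall>x. f differentiable (at x)) \<and>
     (\<forall>v. times_cont_differentiable k (directional_deriv v f))"

definition test_function :: "('a::euclidean_space \<Rightarrow> real) \<Rightarrow> bool" where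
  "test_function f \<longleftrightarrow>
     (\<forall>k. times_cont_differentiable k f) \<and> compact (closure {x. f x \<noteq> 0})"

definition laplacian :: "('a::euclidean_space \<Rightarrow> real) \<Rightarrow> 'a \<Rightarrow> real" where
  "laplacian f x = (\<Sum>b\<in>Basis. directional_deriv b (directional_deriv b f) x)"

definition Lp_tendsto :: "real \<Rightarrow> (nat \<Rightarrow> 'a::euclidean_space \<Rightarrow> real) \<Rightarrow> ('a \<Rightarrow> real) \<Rightarrow> bool" where
  "Lp_tendsto p f g \<longleftrightarrow>
     (\<lambda>n. \<integral>\<^sup>+x. ennreal (\<bar>f n x - g x\<bar> powr p) \<partial>lborel) \<longlonglongrightarrow> 0"

definition critical_exponent :: "nat \<Rightarrow> real" where
  "critical_exponent N = 2 * real N / (real N - 4)"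

text \<open>
  The completion of the test functions with respect to \<open>\<parallel>\<Delta>u\<parallel>\<close> in \<open>L\<^sup>2\<close>, for \<open>N \<ge> 5\<close>. By the Sobolev
  inequality, a sequence of test functions that is Cauchy for this norm converges in \<open>L\<^sup>p\<close> with \<open>p\<close>
  the critical exponent, and the limit vanishes only if the Laplacians tend to \<open>0\<close> in \<open>L\<^sup>2\<close>. So the
  completion is the space of the functions \<open>u\<close> arising as such limits. By completeness of \<open>L\<^sup>2\<close>, the
  Cauchy condition amounts to convergence of the Laplacians to some \<open>g\<close>, which is the Laplacian
  of \<open>u\<close> (extension by continuity) and is determined by \<open>u\<close> almost everywhere.
\<close>

definition has_D22_laplacian :: "('a::euclidean_space \<Rightarrow> real) \<Rightarrow> ('a \<Rightarrow> real) \<Rightarrow> bool" where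
  "has_D22_laplacian u g \<longleftrightarrow>
     u \<in> borel_measurable borel \<and> g \<in> borel_measurable borel \<and>
     (\<exists>\<phi>. (\<forall>n. test_function (\<phi> n)) \<and>
          Lp_tendsto 2 (\<lambda>n. laplacian (\<phi> n)) g \<and>
          Lp_tendsto (critical_exponent DIM('a)) \<phi> u)"

definition D22 :: "('a::euclidean_space \<Rightarrow> real) set" where
  "D22 = {u. \<exists>g. has_D22_laplacian u g}"

definition D22_laplacian :: "('a::euclidean_space \<Rightarrow> real) \<Rightarrow> 'a \<Rightarrow> real" where
  "D22_laplacian u = (SOME g. has_D22_laplacian u g)"

definition D22_nonzero :: "('a::euclidean_space \<Rightarrow> real) set" where
  "D22_nonzero = {u \<in> D22. \<not> (AE x in lborel. u x = 0)}"

definition radially_symmetric :: "('a::euclidean_space \<Rightarrow> real) \<Rightarrow> bool" where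
  "radially_symmetric u \<longleftrightarrow> (\<exists>h :: real \<Rightarrow> real. AE x in lborel. u x = h (norm x))"

text \<open>
  For nonzero \<open>u\<close> in \<open>D22\<close>, and \<open>q\<close>, \<open>\<beta>\<close> as in the theorem, the three integrals are finite by the
  Rellich and Rellich--Sobolev inequalities, and the last one is positive.
\<close>

definition quotient_Q ::
    "real \<Rightarrow> real \<Rightarrow> real \<Rightarrow> ('a::euclidean_space \<Rightarrow> real) \<Rightarrow> real" where
  "quotient_Q q \<beta> lam u =
     ((\<integral>x. \<bar>D22_laplacian u x\<bar>\<^sup>2 \<partial>lborel)
        - lam * (\<integral>x. norm x powr (-4) * \<bar>u x\<bar>\<^sup>2 \<partial>lborel))
     / (\<integral>x. norm x powr (-\<beta>) * \<bar>u x\<bar> powr q \<partial>lborel) powr (2 / q)"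

text \<open>
  The infima below are real infima of sets bounded below by \<open>0\<close> whenever \<open>lam \<le> 0\<close>, the only case
  used.
\<close>

definition S_inf :: "'a::euclidean_space itself \<Rightarrow> real \<Rightarrow> real \<Rightarrow> real \<Rightarrow> real" where
  "S_inf _ q \<beta> lam = (INF u \<in> (D22_nonzero :: ('a \<Rightarrow> real) set). quotient_Q q \<beta> lam u)"

definition S_rad :: "'a::euclidean_space itself \<Rightarrow> real \<Rightarrow> real \<Rightarrow> real \<Rightarrow> real" where
  "S_rad _ q \<beta> lam =
     (INF u \<in> {u \<in> (D22_nonzero :: ('a \<Rightarrow> real) set). radially_symmetric u}. quotient_Q q \<beta> lam u)"

definition is_extremal ::
    "real \<Rightarrow> real \<Rightarrow> real \<Rightarrow> ('a::euclidean_space \<Rightarrow> real) \<Rightarrow> bool" where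
  "is_extremal q \<beta> lam u \<longleftrightarrow>
     u \<in> D22_nonzero \<and> quotient_Q q \<beta> lam u = S_inf TYPE('a) q \<beta> lam"

end

theory Submission
  imports Defs
begin

text \<open>
  Write \<open>L = -\<lambda>\<close> and let \<open>L\<close> tend to infinity. Both infima are pinned between powers of \<open>L\<close>, and
  the powers differ.

  Nonradial functions may concentrate at a point away from the origin. A fixed bump, shrunk to
  radius \<open>\<epsilon>\<close> around a unit vector, sees the weights \<open>|x|\<^sup>-\<^sup>4\<close> and \<open>|x| powr -\<beta>\<close> as constants, so its
  quotient is at most a constant times \<open>(\<epsilon>\<^sup>N\<^sup>-\<^sup>4 + L \<epsilon>\<^sup>N) / \<epsilon> powr (2N/q)\<close>. The choice
  \<open>\<epsilon> = L powr (-1/4)\<close> balances the two terms and gives the power \<open>1 - (N/4)(1 - 2/q)\<close> of \<open>L\<close>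
  (lemma \<open>concentrated_quotient_upper_bound\<close>).

  A radial function cannot concentrate in this way: it satisfies
  \<open>|u(x)| \<le> K \<parallel>\<Delta>u\<parallel> |x| powr -((N-4)/2)\<close> (lemma \<open>radial_pointwise_bound\<close>). Inserting this bound into
  \<open>q - 2\<close> of the \<open>q\<close> factors of \<open>|x| powr -\<beta> |u|\<^sup>q\<close> leaves exactly \<open>|x|\<^sup>-\<^sup>4 |u|\<^sup>2\<close>, because
  \<open>\<beta> + (q-2)(N-4)/2 = 4\<close>. With \<open>G = \<integral>|\<Delta>u|\<^sup>2\<close> and \<open>B = \<integral>|x|\<^sup>-\<^sup>4|u|\<^sup>2\<close> the denominator of \<open>Q\<close> is thus at
  most a constant times \<open>G powr (1 - 2/q) B powr (2/q)\<close>. The numerator \<open>G + L B\<close> dominates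
  \<open>G powr (1 - 2/q) (L B) powr (2/q)\<close>, so \<open>Q(u)\<close> is at least a constant times \<open>L powr (2/q)\<close>
  (lemma \<open>radial_quotient_lower_bound\<close>). The exponents differ by \<open>(N/4 - 1)(1 - 2/q) > 0\<close>, which is
  where \<open>N > 4\<close> and \<open>q > 2\<close> enter.

  The pointwise bound is proved by duality, since a radial element of the completion is a limit of
  test functions that need not be radial. For a continuous radial density \<open>\<rho>\<close> supported in a shell,
  let \<open>\<psi>\<close> be its Newtonian potential. Green's identity passes to the limit and gives
  \<open>\<integral> u \<rho> = \<integral> \<Delta>u \<psi>\<close> (lemma \<open>weak_laplacian\<close>). For \<open>N \<ge> 5\<close> the fundamental solution is square
  integrable at infinity, so \<open>\<psi>\<close> is square integrable, with a norm controlled by \<open>\<integral> |\<rho>|\<close>. Thus \<open>u\<close> is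
  bounded on the shell when tested against radial densities; for radial \<open>u\<close> this is a pointwise
  bound.

  Finiteness of \<open>B\<close>, without which the integrals could degenerate to \<open>0\<close>, is Rellich's inequality.
  It comes from Green's identity for \<open>\<phi>\<^sup>2\<close> and \<open>|x|\<^sup>-\<^sup>2\<close> and from Fatou's lemma
  (lemmas \<open>rellich_inequality_regularized\<close> and \<open>rellich_integrable\<close>).
\<close>

section \<open>Calculus of iterated directional derivatives\<close>

lemma directional_deriv_eqI:
  "(f has_derivative f') (at x) \<Longrightarrow> directional_deriv v f x = f' v"
  unfolding directional_deriv_def by (rule fun_cong[OF frechet_derivative_at[symmetric]])

lemma has_derivative_directional_deriv:
  "f differentiable (at x) \<Longrightarrow> (f has_derivative (\<lambda>v. directional_deriv v f x)) (at x)"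
  unfolding directional_deriv_def by (simp add: frechet_derivative_works)

lemma directional_deriv_add:
  assumes "f differentiable (at x)" "g differentiable (at x)"
  shows "directional_deriv v (\<lambda>x. f x + g x) x = directional_deriv v f x + directional_deriv v g x"
  by (rule directional_deriv_eqI[OF has_derivative_add[OF assms[THEN has_derivative_directional_deriv]]])

lemma directional_deriv_mult:
  assumes "f differentiable (at x)" "g differentiable (at x)"
  shows "directional_deriv v (\<lambda>x. f x * g x) x
    = f x * directional_deriv v g x + directional_deriv v f x * g x"
  by (rule directional_deriv_eqI[OF has_derivative_mult[OF assms[THEN has_derivative_directional_deriv]]])

lemma times_cont_differentiable_Suc_imp:
  "times_cont_differentiable (Suc k) f \<Longrightarrow> times_cont_differentiable k f"
proof (induction k arbitrary: f)
  case 0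
  then show ?case
    by (auto intro!: differentiable_imp_continuous_on differentiable_at_imp_differentiable_on)
next
  case (Suc k)
  have "f differentiable (at x)" for x using Suc.prems by simp
  moreover have "times_cont_differentiable k (directional_deriv v f)" for v
    by (rule Suc.IH) (use Suc.prems in simp)
  ultimately show ?case by simp
qed

lemma times_cont_differentiable_continuous:
  "times_cont_differentiable k f \<Longrightarrow> continuous_on UNIV f"
  by (induction k) (use times_cont_differentiable_Suc_imp in simp, blast dest: times_cont_differentiable_Suc_imp)

lemma times_cont_differentiable_SucI:
  assumes "\<And>x. f differentiable (at x)" "\<And>v. directional_deriv v f = f' v"
    and "\<And>v. times_cont_differentiable k (f' v)"
  shows "times_cont_differentiable (Suc k) f"
  using assms by simp

lemma times_cont_differentiable_SucD:
  assumes "times_cont_differentiable (Suc k) f"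
  shows "f differentiable (at x)" "times_cont_differentiable k (directional_deriv v f)"
  using assms by simp_all

lemma times_cont_differentiable_add:
  "times_cont_differentiable k f \<Longrightarrow> times_cont_differentiable k g \<Longrightarrow>
   times_cont_differentiable k (\<lambda>x. f x + g x)"
proof (induction k arbitrary: f g)
  case (Suc k)
  note f = times_cont_differentiable_SucD[OF Suc.prems(1)]
  note g = times_cont_differentiable_SucD[OF Suc.prems(2)]
  show ?case
  proof (rule times_cont_differentiable_SucI)
    show "(\<lambda>x. f x + g x) differentiable (at x)" for x
      by (rule differentiable_add[OF f(1) g(1)])
    show "directional_deriv v (\<lambda>x. f x + g x)
        = (\<lambda>x. directional_deriv v f x + directional_deriv v g x)" for v
      by (rule ext, rule directional_deriv_add[OF f(1) g(1)])
    show "times_cont_differentiable k (\<lambda>x. directional_deriv v f x + directional_deriv v g x)" for v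
      by (rule Suc.IH[OF f(2) g(2)])
  qed
qed (simp add: continuous_on_add)

lemma times_cont_differentiable_mult:
  "times_cont_differentiable k f \<Longrightarrow> times_cont_differentiable k g \<Longrightarrow>
   times_cont_differentiable k (\<lambda>x. f x * g x)"
proof (induction k arbitrary: f g)
  case (Suc k)
  note f = times_cont_differentiable_SucD[OF Suc.prems(1)]
    times_cont_differentiable_Suc_imp[OF Suc.prems(1)]
  note g = times_cont_differentiable_SucD[OF Suc.prems(2)]
    times_cont_differentiable_Suc_imp[OF Suc.prems(2)]
  show ?case
  proof (rule times_cont_differentiable_SucI)
    show "(\<lambda>x. f x * g x) differentiable (at x)" for x
      by (rule differentiable_mult[OF f(1) g(1)])
    show "directional_deriv v (\<lambda>x. f x * g x)
        = (\<lambda>x. f x * directional_deriv v g x + directional_deriv v f x * g x)" for v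
      by (rule ext, rule directional_deriv_mult[OF f(1) g(1)])
    show "times_cont_differentiable k
        (\<lambda>x. f x * directional_deriv v g x + directional_deriv v f x * g x)" for v
      by (rule times_cont_differentiable_add[OF Suc.IH[OF f(3) g(2)] Suc.IH[OF f(2) g(3)]])
  qed
qed (simp add: continuous_on_mult)

lemma directional_deriv_const: "directional_deriv v (\<lambda>x. c) = (\<lambda>x. 0)"
  by (rule ext, rule directional_deriv_eqI[OF has_derivative_const])

lemma times_cont_differentiable_const:
  "times_cont_differentiable k (\<lambda>x::'a::euclidean_space. c)"
proof (induction k arbitrary: c)
  case (Suc k)
  show ?case
    by (simp add: directional_deriv_const Suc.IH)
qed simp

lemma times_cont_differentiable_sum:
  assumes "\<And>b. b \<in> B \<Longrightarrow> times_cont_differentiable k (f b)"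
  shows "times_cont_differentiable k (\<lambda>x. \<Sum>b\<in>B. f b x)"
  using assms
  by (induction B rule: infinite_finite_induct)
    (simp_all add: times_cont_differentiable_const times_cont_differentiable_add)

lemma times_cont_differentiable_laplacian:
  assumes "times_cont_differentiable (Suc (Suc k)) f"
  shows "times_cont_differentiable k (laplacian f)"
proof -
  have "laplacian f = (\<lambda>x. \<Sum>b\<in>Basis. directional_deriv b (directional_deriv b f) x)"
    by (simp add: laplacian_def fun_eq_iff)
  with assms show ?thesis by (simp add: times_cont_differentiable_sum)
qed

text \<open>
  The factor \<open>a\<close> is there for the induction on the order of differentiability: differentiating
  \<open>f (c x + t)\<close> produces a factor \<open>c\<close> at each step.
\<close>

lemma directional_deriv_affine:
  fixes f :: "'a::euclidean_space \<Rightarrow> real"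
  assumes "f differentiable (at (c *\<^sub>R x + t))"
  shows "(\<lambda>x. a * f (c *\<^sub>R x + t)) differentiable (at x)"
    and "directional_deriv v (\<lambda>x. a * f (c *\<^sub>R x + t)) x
      = (a * c) * directional_deriv v f (c *\<^sub>R x + t)"
proof -
  let ?f' = "frechet_derivative f (at (c *\<^sub>R x + t))"
  have f: "(f has_derivative ?f') (at (c *\<^sub>R x + t))"
    using assms by (simp add: frechet_derivative_works)
  have g: "((\<lambda>x. c *\<^sub>R x + t) has_derivative (\<lambda>v. c *\<^sub>R v)) (at x)"
    by (auto intro!: derivative_eq_intros)
  have h: "((\<lambda>x. a * f (c *\<^sub>R x + t)) has_derivative (\<lambda>v. a * ?f' (c *\<^sub>R v))) (at x)"
    using has_derivative_mult_right[OF has_derivative_compose[OF g f], of a] by simp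
  show "(\<lambda>x. a * f (c *\<^sub>R x + t)) differentiable (at x)"
    using h by (auto simp: differentiable_def)
  have "?f' (c *\<^sub>R v) = c * ?f' v"
    using linear_cmul[OF has_derivative_linear[OF f]] by simp
  with directional_deriv_eqI[OF h]
  show "directional_deriv v (\<lambda>x. a * f (c *\<^sub>R x + t)) x
      = (a * c) * directional_deriv v f (c *\<^sub>R x + t)"
    by (simp add: directional_deriv_def)
qed

lemma times_cont_differentiable_affine:
  fixes f :: "'a::euclidean_space \<Rightarrow> real"
  shows "times_cont_differentiable k f \<Longrightarrow> times_cont_differentiable k (\<lambda>x. a * f (c *\<^sub>R x + t))"
proof (induction k arbitrary: f a)
  case 0
  then show ?case
    by (auto intro!: continuous_intros intro: continuous_on_compose2)
next
  case (Suc k)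
  note f = times_cont_differentiable_SucD[OF Suc.prems]
  show ?case
  proof (rule times_cont_differentiable_SucI)
    show "(\<lambda>x. a * f (c *\<^sub>R x + t)) differentiable (at x)" for x
      by (rule directional_deriv_affine(1)[OF f(1)])
    show "directional_deriv v (\<lambda>x. a * f (c *\<^sub>R x + t))
        = (\<lambda>x. (a * c) * directional_deriv v f (c *\<^sub>R x + t))" for v
      by (rule ext, rule directional_deriv_affine(2)[OF f(1)])
    show "times_cont_differentiable k (\<lambda>x. (a * c) * directional_deriv v f (c *\<^sub>R x + t))" for v
      by (rule Suc.IH[OF f(2)])
  qed
qed

lemma laplacian_affine:
  fixes f :: "'a::euclidean_space \<Rightarrow> real"
  assumes "times_cont_differentiable 2 f"
  shows "laplacian (\<lambda>x. f (c *\<^sub>R x + t)) x = c\<^sup>2 * laplacian f (c *\<^sub>R x + t)"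
proof -
  have d: "\<And>x. f differentiable (at x)" "\<And>v x. directional_deriv v f differentiable (at x)"
    using assms by (auto simp: numeral_2_eq_2)
  have "directional_deriv b (\<lambda>x. f (c *\<^sub>R x + t)) = (\<lambda>x. c * directional_deriv b f (c *\<^sub>R x + t))" for b
  proof
    fix x
    have "directional_deriv b (\<lambda>x. 1 * f (c *\<^sub>R x + t)) x = (1 * c) * directional_deriv b f (c *\<^sub>R x + t)"
      by (rule directional_deriv_affine(2)[OF d(1)])
    then show "directional_deriv b (\<lambda>x. f (c *\<^sub>R x + t)) x = c * directional_deriv b f (c *\<^sub>R x + t)"
      by simp
  qed
  then show ?thesis
    unfolding laplacian_def
    by (simp add: directional_deriv_affine(2)[OF d(2)] sum_distrib_left power2_eq_square)
qed

lemma directional_deriv_eq_0_if_locally_0: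
  assumes "open S" "x \<in> S" "\<And>y. y \<in> S \<Longrightarrow> f y = 0"
  shows "directional_deriv v f x = 0"
proof -
  have "(f has_derivative (\<lambda>_. 0)) (at x)"
    by (rule has_derivative_transform_within_open[OF has_derivative_const[of 0] assms(1,2)])
      (simp add: assms(3))
  from directional_deriv_eqI[OF this] show ?thesis .
qed

lemma directional_deriv_outside:
  fixes f :: "'a::euclidean_space \<Rightarrow> real"
  assumes "\<And>x. R < norm x \<Longrightarrow> f x = 0" "R < norm x"
  shows "directional_deriv v f x = 0"
proof (rule directional_deriv_eq_0_if_locally_0)
  show "open {x::'a. R < norm x}" by (intro open_Collect_less continuous_intros)
qed (use assms in auto)

lemma laplacian_outside:
  assumes "\<And>x. R < norm x \<Longrightarrow> f x = 0" "R < norm x"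
  shows "laplacian f x = 0"
  unfolding laplacian_def
  using directional_deriv_outside[of R, OF directional_deriv_outside[of R, OF assms(1)]] assms(2)
  by (auto intro!: sum.neutral)

section \<open>Test functions\<close>

lemma test_functionD:
  assumes "test_function \<phi>"
  shows "times_cont_differentiable k \<phi>" "continuous_on UNIV \<phi>"
    and "\<exists>R>0. \<forall>x. R < norm x \<longrightarrow> \<phi> x = 0"
proof -
  show "times_cont_differentiable k \<phi>" using assms by (auto simp: test_function_def)
  then show "continuous_on UNIV \<phi>" by (rule times_cont_differentiable_continuous)
  have "bounded (closure {x. \<phi> x \<noteq> 0})"
    using assms by (auto simp: test_function_def compact_imp_bounded)
  then obtain R where "R > 0" "\<forall>x \<in> closure {x. \<phi> x \<noteq> 0}. norm x \<le> R"
    by (auto simp: bounded_pos)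
  moreover have "x \<in> closure {x. \<phi> x \<noteq> 0}" if "\<phi> x \<noteq> 0" for x
    using that closure_subset[of "{x. \<phi> x \<noteq> 0}"] by blast
  ultimately show "\<exists>R>0. \<forall>x. R < norm x \<longrightarrow> \<phi> x = 0"
    by (metis not_le)
qed

lemma test_functionI:
  assumes "\<And>k. times_cont_differentiable k \<phi>" "\<And>x. R < norm x \<Longrightarrow> \<phi> x = 0"
  shows "test_function \<phi>"
proof -
  have "{x. \<phi> x \<noteq> 0} \<subseteq> cball 0 R" using assms(2) by (force simp: not_le[symmetric])
  then have "bounded {x. \<phi> x \<noteq> 0}" by (rule bounded_subset[OF bounded_cball])
  then show ?thesis using assms(1) by (auto simp: test_function_def compact_closure)
qed

lemma test_function_laplacian:
  assumes "test_function \<phi>"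
  shows "test_function (laplacian \<phi>)"
proof -
  obtain R where R: "\<forall>x. R < norm x \<longrightarrow> \<phi> x = 0" using test_functionD(3)[OF assms] by auto
  then have "R < norm x \<Longrightarrow> laplacian \<phi> x = 0" for x
    by (intro laplacian_outside[of R]) auto
  then show ?thesis
    using times_cont_differentiable_laplacian[OF test_functionD(1)[OF assms]]
    by (intro test_functionI[of _ R]) simp_all
qed

lemma test_function_add:
  assumes "test_function \<phi>" "test_function \<psi>"
  shows "test_function (\<lambda>x. \<phi> x + \<psi> x)"
proof -
  obtain R S where "\<forall>x. R < norm x \<longrightarrow> \<phi> x = 0" "\<forall>x. S < norm x \<longrightarrow> \<psi> x = 0"
    using test_functionD(3)[OF assms(1)] test_functionD(3)[OF assms(2)] by blast
  then show ?thesis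
    using times_cont_differentiable_add[OF assms[THEN test_functionD(1)]]
    by (intro test_functionI[of _ "max R S"]) simp_all
qed

lemma test_function_affine:
  assumes "test_function \<phi>" "c \<noteq> 0"
  shows "test_function (\<lambda>x. a * \<phi> (c *\<^sub>R x + t))"
proof -
  obtain R where R: "R > 0" "\<forall>x. R < norm x \<longrightarrow> \<phi> x = 0" using test_functionD(3)[OF assms(1)] by auto
  have "\<phi> (c *\<^sub>R x + t) = 0" if "(R + norm t) / \<bar>c\<bar> < norm x" for x
  proof -
    have "R + norm t < \<bar>c\<bar> * norm x" using that assms(2) by (simp add: divide_simps mult.commute)
    also have "\<dots> \<le> norm (c *\<^sub>R x + t) + norm t"
      using norm_triangle_ineq4[of "c *\<^sub>R x + t" t] by simp
    finally show ?thesis using R by simp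
  qed
  then show ?thesis
    using times_cont_differentiable_affine[OF test_functionD(1)[OF assms(1)]]
    by (intro test_functionI[of _ "(R + norm t) / \<bar>c\<bar>"]) simp_all
qed

section \<open>A smooth bump function\<close>

text \<open>
  The factors \<open>t ^ k\<close> make the family closed under differentiation up to linear combinations, so
  smoothness at \<open>0\<close> need only be seen for first derivatives.
\<close>

definition flat_exp :: "nat \<Rightarrow> real \<Rightarrow> real" where
  "flat_exp k t = (if t > 0 then exp (- 1 / t) / t ^ k else 0)"

text \<open>
  The term of order \<open>k + 2\<close> of the exponential series at \<open>1/t\<close> bounds \<open>exp (1/t)\<close> from below.
  A quadratic bound is what differentiability at \<open>0\<close> with derivative \<open>0\<close> requires.
\<close>

lemma flat_exp_bound: "\<bar>flat_exp k t\<bar> \<le> fact (k + 2) * t\<^sup>2"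
proof (cases "t > 0")
  case True
  have "(1 / t) ^ (k + 2) / fact (k + 2) \<le> exp (1 / t)"
  proof -
    have "(\<Sum>i\<in>{k+2}. (1 / t) ^ i /\<^sub>R fact i) \<le> exp (1 / t)"
      unfolding exp_def by (rule sum_le_suminf) (use True summable_exp[of "1 / t"] in \<open>simp_all add: field_simps\<close>)
    then show ?thesis by (simp add: field_simps)
  qed
  then have "(1 / t) ^ (k + 2) / fact (k + 2) * (fact (k + 2) * t ^ (k + 2))
      \<le> exp (1 / t) * (fact (k + 2) * t ^ (k + 2))"
    using True by (intro mult_right_mono) simp_all
  moreover have "(1 / t) ^ (k + 2) / fact (k + 2) * (fact (k + 2) * t ^ (k + 2)) = 1"
  proof -
    have "y / c * (c * z) = y * z" if "c \<noteq> 0" for y c z :: real using that by simp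
    then have "(1 / t) ^ (k + 2) / fact (k + 2) * (fact (k + 2) * t ^ (k + 2)) = (1 / t) ^ (k + 2) * t ^ (k + 2)"
      by (metis fact_nonzero)
    also have "\<dots> = 1" using True by (simp add: power_mult_distrib[symmetric] del: power_Suc)
    finally show ?thesis .
  qed
  ultimately have "exp (- (1 / t)) * 1 \<le> exp (- (1 / t)) * (exp (1 / t) * (fact (k + 2) * t ^ (k + 2)))"
    by (intro mult_left_mono) simp_all
  then have "exp (- (1 / t)) \<le> fact (k + 2) * t ^ (k + 2)"
    by (simp only: mult.assoc[symmetric] exp_add[symmetric]) simp
  then have "exp (- 1 / t) / t ^ k \<le> fact (k + 2) * t ^ (k + 2) / t ^ k"
    using True by (intro divide_right_mono) simp_all
  also have "\<dots> = fact (k + 2) * t\<^sup>2" using True by (simp add: power_add power2_eq_square)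
  finally show ?thesis using True by (simp add: flat_exp_def)
qed (simp add: flat_exp_def)

lemma flat_exp_deriv:
  "(flat_exp k has_real_derivative flat_exp (k + 2) t - k * flat_exp (k + 1) t) (at t)"
proof -
  consider "t > 0" | "t < 0" | "t = 0" by linarith
  then show ?thesis
  proof cases
    case 1
    have e: "((\<lambda>t. exp (- 1 / t)) has_real_derivative exp (- 1 / t) * (1 / t\<^sup>2)) (at t)"
      using 1 by (auto intro!: derivative_eq_intros simp: power2_eq_square)
    have p: "((\<lambda>t. inverse (t ^ k)) has_real_derivative - (k / t ^ (k + 1))) (at t)"
    proof -
      have "((\<lambda>t. inverse (t ^ k)) has_real_derivative
          - (inverse (t ^ k) * (k * t ^ (k - 1)) * inverse (t ^ k))) (at t)"
        using 1 DERIV_inverse'[OF DERIV_pow[of k t]] by simp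
      moreover have "- (inverse (t ^ k) * (k * t ^ (k - 1)) * inverse (t ^ k)) = - (k / t ^ (k + 1))"
        using 1 by (cases k) (simp_all add: field_simps)
      ultimately show ?thesis by simp
    qed
    have "((\<lambda>t. exp (- 1 / t) * inverse (t ^ k)) has_real_derivative
        flat_exp (k + 2) t - k * flat_exp (k + 1) t) (at t)"
      using DERIV_mult[OF e p] 1
      by (simp add: flat_exp_def field_simps power2_eq_square)
    then show ?thesis
    proof (rule has_field_derivative_transform_within_open)
      show "exp (- 1 / t) * inverse (t ^ k) = flat_exp k t" if "t \<in> {0<..}" for t
        using that by (simp add: flat_exp_def divide_inverse)
    qed (use 1 in auto)
  next
    case 2
    have "(flat_exp k has_real_derivative 0) (at t)"
    proof (rule has_field_derivative_transform_within_open[OF DERIV_const[of 0]])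
      show "0 = flat_exp k t" if "t \<in> {..<0}" for t
        using that by (simp add: flat_exp_def)
    qed (use 2 in auto)
    then show ?thesis using 2 by (simp add: flat_exp_def)
  next
    case 3
    have "((\<lambda>h. flat_exp k h / h) \<longlongrightarrow> 0) (at 0)"
    proof (rule Lim_null_comparison)
      show "\<forall>\<^sub>F h in at 0. norm (flat_exp k h / h) \<le> fact (k + 2) * \<bar>h\<bar>"
      proof (rule eventually_at_topological[THEN iffD2], intro exI[of _ UNIV] conjI ballI impI)
        fix h :: real assume "h \<noteq> 0"
        then show "norm (flat_exp k h / h) \<le> fact (k + 2) * \<bar>h\<bar>"
          using flat_exp_bound[of k h] by (simp add: divide_le_eq power2_eq_square abs_mult[symmetric] mult.assoc)
      qed simp_all
      show "((\<lambda>h. fact (k + 2) * \<bar>h\<bar>) \<longlongrightarrow> 0) (at (0::real))"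
        by (auto intro!: tendsto_eq_intros)
    qed
    then show ?thesis using 3 by (simp add: DERIV_def flat_exp_def)
  qed
qed

text \<open>
  A class of functions that contains the bump function and is closed under directional derivatives.
  All its members are therefore smooth.
\<close>

inductive bump_term :: "('a::euclidean_space \<Rightarrow> real) \<Rightarrow> bool" where
  const: "bump_term (\<lambda>x. c)"
| inner: "bump_term (\<lambda>x. x \<bullet> v)"
| flat: "bump_term (\<lambda>x. flat_exp k (1 - x \<bullet> x))"
| add: "bump_term f \<Longrightarrow> bump_term g \<Longrightarrow> bump_term (\<lambda>x. f x + g x)"
| mult: "bump_term f \<Longrightarrow> bump_term g \<Longrightarrow> bump_term (\<lambda>x. f x * g x)"

lemma bump_term_deriv:
  "bump_term f \<Longrightarrow> (\<forall>x. f differentiable (at x)) \<and> (\<forall>v. bump_term (directional_deriv v f))"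
proof (induction rule: bump_term.induct)
  case (const c)
  show ?case by (simp add: directional_deriv_const bump_term.const)
next
  case (inner w)
  have d: "((\<lambda>x. x \<bullet> w) has_derivative (\<lambda>v. v \<bullet> w)) (at x)" for x
    by (auto intro!: derivative_eq_intros)
  have "directional_deriv v (\<lambda>x. x \<bullet> w) = (\<lambda>x. v \<bullet> w)" for v
    by (rule ext, rule directional_deriv_eqI[OF d])
  with d show ?case by (auto simp: differentiable_def intro: bump_term.const)
next
  case (flat k)
  let ?r = "\<lambda>t. flat_exp (k + 2) t + (- real k) * flat_exp (k + 1) t"
  have d: "((\<lambda>x. flat_exp k (1 - x \<bullet> x)) has_derivative
      (\<lambda>v. ?r (1 - x \<bullet> x) * ((-2) * (x \<bullet> v)))) (at x)" for x :: 'a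
  proof -
    have i: "((\<lambda>x. 1 - x \<bullet> x) has_derivative (\<lambda>v. (-2) * (x \<bullet> v))) (at x)"
      by (auto intro!: derivative_eq_intros simp: inner_commute)
    have "(flat_exp k has_derivative (\<lambda>h. ?r (1 - x \<bullet> x) * h)) (at (1 - x \<bullet> x))"
      using flat_exp_deriv[of k "1 - x \<bullet> x"] by (simp add: has_field_derivative_def)
    from has_derivative_compose[OF i this] show ?thesis .
  qed
  have "directional_deriv v (\<lambda>x. flat_exp k (1 - x \<bullet> x))
      = (\<lambda>x. ?r (1 - x \<bullet> x) * ((-2) * (x \<bullet> v)))" for v :: 'a
    by (rule ext, rule directional_deriv_eqI[OF d])
  moreover have "bump_term (\<lambda>x. ?r (1 - x \<bullet> x) * ((-2) * (x \<bullet> v)))" for v :: 'a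
    by (intro bump_term.intros)
  moreover have "(\<lambda>x. flat_exp k (1 - x \<bullet> x)) differentiable (at x)" for x :: 'a
    using d by (rule differentiableI)
  ultimately show ?case by metis
next
  case (add f g)
  then have "directional_deriv v (\<lambda>x. f x + g x)
      = (\<lambda>x. directional_deriv v f x + directional_deriv v g x)" for v
    by (intro ext directional_deriv_add) auto
  moreover have "bump_term (\<lambda>x. directional_deriv v f x + directional_deriv v g x)" for v
    using add.IH by (intro bump_term.add) simp_all
  moreover have "(\<lambda>x. f x + g x) differentiable (at x)" for x
    using add.IH by (intro differentiable_add) simp_all
  ultimately show ?case by metis
next
  case (mult f g)
  then have "directional_deriv v (\<lambda>x. f x * g x)
      = (\<lambda>x. f x * directional_deriv v g x + directional_deriv v f x * g x)" for v
    by (intro ext directional_deriv_mult) auto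
  moreover have "bump_term (\<lambda>x. f x * directional_deriv v g x + directional_deriv v f x * g x)" for v
    using mult by (intro bump_term.add bump_term.mult) simp_all
  moreover have "(\<lambda>x. f x * g x) differentiable (at x)" for x
    using mult.IH by (intro differentiable_mult) simp_all
  ultimately show ?case by metis
qed

lemma bump_term_times_cont_differentiable: "bump_term f \<Longrightarrow> times_cont_differentiable k f"
proof (induction k arbitrary: f)
  case 0
  then have "f differentiable (at x)" for x using bump_term_deriv by blast
  then show ?case
    by (auto intro!: differentiable_imp_continuous_on differentiable_at_imp_differentiable_on)
next
  case (Suc k)
  have "f differentiable (at x)" for x using Suc.prems bump_term_deriv by blast
  moreover have "times_cont_differentiable k (directional_deriv v f)" for v
    by (rule Suc.IH) (use Suc.prems bump_term_deriv in blast)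
  ultimately show ?case by simp
qed

definition bump :: "'a::euclidean_space \<Rightarrow> real" where
  "bump x = flat_exp 0 (1 - x \<bullet> x)"

lemma bump_outside: "1 \<le> norm x \<Longrightarrow> bump x = 0"
  by (simp add: bump_def flat_exp_def norm_eq_sqrt_inner)

lemma bump_pos: "norm x < 1 \<Longrightarrow> bump x > 0"
  by (simp add: bump_def flat_exp_def norm_eq_sqrt_inner)

lemma test_function_bump: "test_function bump"
proof (rule test_functionI[of _ 1])
  have "bump_term (bump :: 'a \<Rightarrow> real)"
    using bump_term.flat[of 0] by (simp add: bump_def[abs_def])
  then show "times_cont_differentiable k (bump :: 'a \<Rightarrow> real)" for k
    by (rule bump_term_times_cont_differentiable)
qed (simp add: bump_outside)

section \<open>Integration by parts and Green's identity\<close>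

lemma integrable_continuous_compact_support:
  fixes f :: "'a::euclidean_space \<Rightarrow> real"
  assumes "continuous_on UNIV f" "\<And>x. R < norm x \<Longrightarrow> f x = 0"
  shows "integrable lborel f"
proof -
  have "integrable lborel (\<lambda>x. indicator (cball 0 R) x *\<^sub>R f x)"
    by (rule borel_integrable_compact) (use assms(1) in \<open>auto intro: continuous_on_subset\<close>)
  also have "(\<lambda>x. indicator (cball 0 R) x *\<^sub>R f x) = f"
    using assms(2) by (force simp: indicator_def not_le)
  finally show ?thesis .
qed

lemma has_real_derivative_along_line:
  fixes f :: "'a::euclidean_space \<Rightarrow> real"
  assumes "\<And>x. f differentiable (at x)"
  shows "((\<lambda>t. f (x + t *\<^sub>R v)) has_real_derivative directional_deriv v f (x + t *\<^sub>R v)) (at t)"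
proof -
  let ?f' = "\<lambda>w. directional_deriv w f (x + t *\<^sub>R v)"
  have f: "(f has_derivative ?f') (at (x + t *\<^sub>R v))"
    by (rule has_derivative_directional_deriv[OF assms])
  have "((\<lambda>t. x + t *\<^sub>R v) has_derivative (\<lambda>s. s *\<^sub>R v)) (at t)"
    by (auto intro!: derivative_eq_intros)
  from has_derivative_compose[OF this f]
  have "((\<lambda>t. f (x + t *\<^sub>R v)) has_derivative (\<lambda>s. ?f' (s *\<^sub>R v))) (at t)" .
  moreover have "(\<lambda>s. ?f' (s *\<^sub>R v)) = (*) (?f' v)"
    using linear_cmul[OF has_derivative_linear[OF f]] by (simp add: fun_eq_iff)
  ultimately show ?thesis by (simp add: has_field_derivative_def)
qed

text \<open>
  The difference quotients of \<open>f\<close> in direction \<open>v\<close> have integral \<open>0\<close> by translation invariance. By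
  the mean value theorem they are bounded by a multiple of the indicator of a fixed ball, so the
  dominated convergence theorem applies.
\<close>

lemma integral_directional_deriv_eq_0:
  fixes f :: "'a::euclidean_space \<Rightarrow> real"
  assumes d: "\<And>x. f differentiable (at x)"
    and c: "continuous_on UNIV (directional_deriv v f)"
    and z: "\<And>x. R < norm x \<Longrightarrow> f x = 0"
  shows "(\<integral>x. directional_deriv v f x \<partial>lborel) = 0"
proof -
  define h where "h n = inverse (real (Suc n))" for n
  have h: "0 < h n" "h n \<le> 1" for n by (auto simp: h_def field_simps)
  define s where "s n x = (f (x + h n *\<^sub>R v) - f x) / h n" for n x
  have cf: "continuous_on UNIV f"
    using d by (simp add: differentiable_imp_continuous_on differentiable_at_imp_differentiable_on)
  have [measurable]: "f \<in> borel_measurable borel" "directional_deriv v f \<in> borel_measurable borel"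
    using cf c by (auto intro: borel_measurable_continuous_onI)
  have i: "integrable lborel f" by (rule integrable_continuous_compact_support[OF cf z])
  have i': "integrable lborel (\<lambda>x. f (x + w))" "(\<integral>x. f (x + w) \<partial>lborel) = (\<integral>x. f x \<partial>lborel)" for w
  proof -
    have *: "distr lborel borel ((+) w) = (lborel :: 'a measure)" by (rule lborel_distr_plus)
    have "integrable (distr lborel borel ((+) w)) f" unfolding * by (rule i)
    then show "integrable lborel (\<lambda>x. f (x + w))"
      by (subst (asm) integrable_distr_eq) (auto simp: add.commute)
    have "(\<integral>x. f x \<partial>(distr lborel borel ((+) w))) = (\<integral>x. f (x + w) \<partial>lborel)"
      by (subst integral_distr) (auto simp: add.commute)
    then show "(\<integral>x. f (x + w) \<partial>lborel) = (\<integral>x. f x \<partial>lborel)" unfolding * by simp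
  qed
  obtain K where K: "\<And>x. norm x \<le> R + 2 * norm v \<Longrightarrow> \<bar>directional_deriv v f x\<bar> \<le> K"
  proof -
    have "compact (directional_deriv v f ` cball 0 (R + 2 * norm v))"
      by (intro compact_continuous_image continuous_on_subset[OF c]) auto
    then obtain K where "\<forall>y\<in>directional_deriv v f ` cball 0 (R + 2 * norm v). norm y \<le> K"
      by (meson bounded_iff compact_imp_bounded)
    then show ?thesis by (intro that[of K]) auto
  qed
  have "(\<lambda>n. \<integral>x. s n x \<partial>lborel) \<longlonglongrightarrow> (\<integral>x. directional_deriv v f x \<partial>lborel)"
  proof (rule integral_dominated_convergence)
    show "integrable lborel (\<lambda>x::'a. K * indicator (cball 0 (R + norm v)) x)"
      by (intro integrable_mult_right integrable_real_indicator) (use emeasure_bounded_finite[OF bounded_cball] in auto)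
    show "AE x in lborel. (\<lambda>n. s n x) \<longlonglongrightarrow> directional_deriv v f x"
    proof (intro AE_I2)
      fix x
      have "filterlim h (at 0) sequentially"
        unfolding h_def using LIMSEQ_inverse_real_of_nat by (intro filterlim_atI) auto
      moreover have "((\<lambda>t. (f (x + t *\<^sub>R v) - f x) / t) \<longlongrightarrow> directional_deriv v f x) (at 0)"
        using has_real_derivative_along_line[OF d, of x v 0] by (simp add: DERIV_def)
      ultimately show "(\<lambda>n. s n x) \<longlonglongrightarrow> directional_deriv v f x"
        unfolding s_def by (rule filterlim_compose[rotated])
    qed
    show "AE x in lborel. norm (s n x) \<le> K * indicator (cball 0 (R + norm v)) x" for n
    proof (intro AE_I2)
      fix x
      have v: "norm (t *\<^sub>R v) \<le> norm v" if "0 \<le> t" "t \<le> h n" for t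
        using that h(2)[of n] by (simp add: mult_left_le_one_le)
      show "norm (s n x) \<le> K * indicator (cball 0 (R + norm v)) x"
      proof (cases "norm x \<le> R + norm v")
        case True
        obtain y where y: "0 < y" "y < h n"
          "f (x + h n *\<^sub>R v) - f (x + 0 *\<^sub>R v) = (h n - 0) * directional_deriv v f (x + y *\<^sub>R v)"
          using MVT2[OF h(1)[of n], of "\<lambda>t. f (x + t *\<^sub>R v)" "\<lambda>t. directional_deriv v f (x + t *\<^sub>R v)"]
            has_real_derivative_along_line[OF d] by blast
        then have "s n x = directional_deriv v f (x + y *\<^sub>R v)" using h(1)[of n] by (simp add: s_def)
        moreover have "norm (x + y *\<^sub>R v) \<le> R + 2 * norm v"
          using norm_triangle_ineq[of x "y *\<^sub>R v"] True v[of y] y by linarith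
        ultimately show ?thesis using K True by simp
      next
        case False
        have "norm x \<le> norm (x + h n *\<^sub>R v) + norm (h n *\<^sub>R v)"
          using norm_triangle_ineq4[of "x + h n *\<^sub>R v" "h n *\<^sub>R v"] by simp
        then have "R < norm (x + h n *\<^sub>R v)"
          using False v[of "h n"] h(1)[of n] by linarith
        moreover have "R < norm x" using False norm_ge_zero[of v] by linarith
        ultimately show ?thesis using False z by (simp add: s_def)
      qed
    qed
  qed (auto simp: s_def[abs_def])
  moreover have "(\<integral>x. s n x \<partial>lborel) = 0" for n
    unfolding s_def using i i' by (simp add: Bochner_Integration.integral_diff)
  ultimately show ?thesis by (simp add: LIMSEQ_const_iff)
qed

lemma times_cont_differentiable_2D:
  assumes "times_cont_differentiable 2 f"
  shows "f differentiable (at x)" "directional_deriv v f differentiable (at x)"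
    and "continuous_on UNIV f" "continuous_on UNIV (directional_deriv v f)"
    and "continuous_on UNIV (directional_deriv w (directional_deriv v f))"
    and "continuous_on UNIV (laplacian f)"
proof -
  have f: "times_cont_differentiable (Suc (Suc 0)) f" using assms by (simp only: numeral_2_eq_2)
  show "f differentiable (at x)" "directional_deriv v f differentiable (at x)"
    "continuous_on UNIV (directional_deriv w (directional_deriv v f))" using f by simp_all
  show "continuous_on UNIV f" by (rule times_cont_differentiable_continuous[OF f])
  show "continuous_on UNIV (directional_deriv v f)"
    by (rule times_cont_differentiable_continuous[OF times_cont_differentiable_SucD(2)[OF f]])
  show "continuous_on UNIV (laplacian f)"
    using times_cont_differentiable_laplacian[OF f] by simp
qed

text \<open>
  The second function may fail to have compact support: below it will be a Newtonian potential, which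
  decays only like a power.
\<close>

lemma green_identity:
  fixes f g :: "'a::euclidean_space \<Rightarrow> real"
  assumes f: "times_cont_differentiable 2 f" and g: "times_cont_differentiable 2 g"
    and z: "\<And>x. R < norm x \<Longrightarrow> f x = 0"
  shows "(\<integral>x. f x * laplacian g x \<partial>lborel) = (\<integral>x. laplacian f x * g x \<partial>lborel)"
proof -
  note F = times_cont_differentiable_2D[OF f] and G = times_cont_differentiable_2D[OF g]
  note z' = directional_deriv_outside[of R, OF z]
  have i: "integrable lborel (\<lambda>x. f x * directional_deriv b (directional_deriv b g) x)"
    "integrable lborel (\<lambda>x. directional_deriv b (directional_deriv b f) x * g x)"
    "integrable lborel (\<lambda>x. directional_deriv b f x * directional_deriv b g x)" for b
    using z z' directional_deriv_outside[of R, OF z']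
    by (auto intro!: integrable_continuous_compact_support[of _ R] continuous_on_mult F G)
  have *: "(\<integral>x. f x * directional_deriv b (directional_deriv b g) x \<partial>lborel)
      = (\<integral>x. directional_deriv b (directional_deriv b f) x * g x \<partial>lborel)" for b
  proof -
    have "0 = (\<integral>x. directional_deriv b (\<lambda>x. f x * directional_deriv b g x) x \<partial>lborel)"
      using z by (intro integral_directional_deriv_eq_0[symmetric, of _ _ R] differentiable_mult F G)
        (auto simp: directional_deriv_mult[OF F(1) G(2)] cong: continuous_on_cong
          intro!: continuous_intros F G)
    also have "\<dots> = (\<integral>x. f x * directional_deriv b (directional_deriv b g) x \<partial>lborel)
        + (\<integral>x. directional_deriv b f x * directional_deriv b g x \<partial>lborel)"
      by (simp add: directional_deriv_mult[OF F(1) G(2)] i)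
    finally have 1: "0 = \<dots>" .
    have "0 = (\<integral>x. directional_deriv b (\<lambda>x. directional_deriv b f x * g x) x \<partial>lborel)"
      using z' by (intro integral_directional_deriv_eq_0[symmetric, of _ _ R] differentiable_mult F G)
        (auto simp: directional_deriv_mult[OF F(2) G(1)] cong: continuous_on_cong
          intro!: continuous_intros F G)
    also have "\<dots> = (\<integral>x. directional_deriv b f x * directional_deriv b g x \<partial>lborel)
        + (\<integral>x. directional_deriv b (directional_deriv b f) x * g x \<partial>lborel)"
      by (simp add: directional_deriv_mult[OF F(2) G(1)] i)
    finally show ?thesis using 1 by linarith
  qed
  show ?thesis
    unfolding laplacian_def by (simp add: sum_distrib_left sum_distrib_right i *)
qed

section \<open>Laplacians of radial functions and Rellich's inequality\<close>

lemma radial_has_derivative: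
  fixes x :: "'a::euclidean_space"
  assumes "(F has_real_derivative F') (at (x \<bullet> x))"
  shows "((\<lambda>x. F (x \<bullet> x)) has_derivative (\<lambda>v. F' * (2 * (x \<bullet> v)))) (at x)"
proof -
  have i: "((\<lambda>x. x \<bullet> x) has_derivative (\<lambda>v. 2 * (x \<bullet> v))) (at x)"
    by (auto intro!: derivative_eq_intros simp: inner_commute)
  have "(F has_derivative (\<lambda>h. F' * h)) (at (x \<bullet> x))"
    using assms by (simp add: has_field_derivative_def)
  from has_derivative_compose[OF i this] show ?thesis .
qed

text \<open>
  Radial functions are written as functions of \<open>x \<bullet> x\<close> rather than of the norm, since the former is
  smooth at the origin. Derivatives are required only on the range \<open>[0,\<infinity>)\<close> of \<open>x \<bullet> x\<close>, which admits
  profiles such as \<open>1 / (s + e)\<close>.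
\<close>

lemma radial_laplacian:
  fixes P P1 P2 :: "real \<Rightarrow> real"
  assumes P: "\<And>s. 0 \<le> s \<Longrightarrow> (P has_real_derivative P1 s) (at s)"
    and P1: "\<And>s. 0 \<le> s \<Longrightarrow> (P1 has_real_derivative P2 s) (at s)"
    and P2: "continuous_on {0..} P2"
  shows "times_cont_differentiable 2 (\<lambda>x::'a::euclidean_space. P (x \<bullet> x))"
    and "laplacian (\<lambda>x::'a. P (x \<bullet> x)) x
      = 2 * real DIM('a) * P1 (x \<bullet> x) + 4 * (x \<bullet> x) * P2 (x \<bullet> x)"
proof -
  note d = radial_has_derivative[OF P[OF inner_ge_zero]]
  note d1 = radial_has_derivative[OF P1[OF inner_ge_zero]]
  have e: "directional_deriv v (\<lambda>x::'a. P (x \<bullet> x)) = (\<lambda>x. P1 (x \<bullet> x) * (2 * (x \<bullet> v)))" for v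
    by (rule ext, rule directional_deriv_eqI[OF d])
  have l: "((\<lambda>x. 2 * (x \<bullet> v)) has_derivative (\<lambda>w. 2 * (w \<bullet> v))) (at x)" for v x :: 'a
    by (auto intro!: derivative_eq_intros)
  note d2 = has_derivative_mult[OF d1 l]
  have e2: "directional_deriv w (\<lambda>x::'a. P1 (x \<bullet> x) * (2 * (x \<bullet> v)))
      = (\<lambda>x. P1 (x \<bullet> x) * (2 * (w \<bullet> v)) + P2 (x \<bullet> x) * (2 * (x \<bullet> w)) * (2 * (x \<bullet> v)))" for v w
    by (rule ext, rule directional_deriv_eqI[OF d2])
  have "(\<lambda>x::'a. P1 (x \<bullet> x)) differentiable (at x)" for x
    using d1 by (rule differentiableI)
  then have "continuous_on UNIV (\<lambda>x::'a. P1 (x \<bullet> x))"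
    by (simp add: differentiable_imp_continuous_on differentiable_at_imp_differentiable_on)
  moreover have "continuous_on UNIV (\<lambda>x::'a. P2 (x \<bullet> x))"
    by (rule continuous_on_compose2[OF P2]) (auto intro!: continuous_intros)
  ultimately have c: "continuous_on UNIV (\<lambda>x::'a. P1 (x \<bullet> x) * (2 * (w \<bullet> v))
      + P2 (x \<bullet> x) * (2 * (x \<bullet> w)) * (2 * (x \<bullet> v)))" for v w
    by (intro continuous_intros)
  show "times_cont_differentiable 2 (\<lambda>x::'a. P (x \<bullet> x))"
    unfolding numeral_2_eq_2
  proof (rule times_cont_differentiable_SucI[OF _ e])
    show "(\<lambda>x::'a. P (x \<bullet> x)) differentiable (at x)" for x
      using d by (rule differentiableI)
    show "times_cont_differentiable (Suc 0) (\<lambda>x::'a. P1 (x \<bullet> x) * (2 * (x \<bullet> v)))" for v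
    proof (rule times_cont_differentiable_SucI[OF _ e2])
      show "(\<lambda>x::'a. P1 (x \<bullet> x) * (2 * (x \<bullet> v))) differentiable (at x)" for x
        using d2 by (rule differentiableI)
      show "times_cont_differentiable 0 (\<lambda>x::'a. P1 (x \<bullet> x) * (2 * (w \<bullet> v))
          + P2 (x \<bullet> x) * (2 * (x \<bullet> w)) * (2 * (x \<bullet> v)))" for w
        unfolding times_cont_differentiable.simps by (rule c)
    qed
  qed
  have "laplacian (\<lambda>x::'a. P (x \<bullet> x)) x
      = (\<Sum>b\<in>Basis. 2 * P1 (x \<bullet> x) + 4 * P2 (x \<bullet> x) * ((x \<bullet> b) * (x \<bullet> b)))"
    unfolding laplacian_def e e2 by (rule sum.cong) (simp_all add: inner_same_Basis)
  also have "\<dots> = 2 * real DIM('a) * P1 (x \<bullet> x) + 4 * P2 (x \<bullet> x) * (x \<bullet> x)"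
    by (subst euclidean_inner[of x x]) (simp add: sum.distrib sum_distrib_left)
  finally show "laplacian (\<lambda>x::'a. P (x \<bullet> x)) x
      = 2 * real DIM('a) * P1 (x \<bullet> x) + 4 * (x \<bullet> x) * P2 (x \<bullet> x)"
    by (simp add: mult_ac)
qed

text \<open>
  The difference of the two sides is \<open>2 |\<nabla>f|\<^sup>2\<close>.
\<close>

lemma laplacian_square_ge:
  fixes f :: "'a::euclidean_space \<Rightarrow> real"
  assumes "times_cont_differentiable 2 f"
  shows "2 * (f x * laplacian f x) \<le> laplacian (\<lambda>x. f x * f x) x"
proof -
  note F = times_cont_differentiable_2D[OF assms]
  have e: "directional_deriv b (\<lambda>x. f x * f x)
      = (\<lambda>x. f x * directional_deriv b f x + directional_deriv b f x * f x)" for b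
    by (rule ext, rule directional_deriv_mult[OF F(1) F(1)])
  have "directional_deriv b (directional_deriv b (\<lambda>x. f x * f x)) x
      = 2 * (f x * directional_deriv b (directional_deriv b f) x) + 2 * (directional_deriv b f x)\<^sup>2" for b
    unfolding e
    by (subst directional_deriv_add)
      (simp_all add: F differentiable_mult directional_deriv_mult power2_eq_square)
  then show ?thesis
    unfolding laplacian_def by (simp add: sum.distrib sum_distrib_left sum_nonneg)
qed

text \<open>
  Let \<open>w = 1 / (|x|\<^sup>2 + e)\<close>, a regularization of \<open>|x|\<^sup>-\<^sup>2\<close>. Then \<open>\<Delta>w \<le> -2 (N - 4) w\<^sup>2\<close>, and Green's identity
  for \<open>f\<^sup>2\<close> and \<open>w\<close> together with \<open>\<Delta>(f\<^sup>2) \<ge> 2 f \<Delta>f\<close> gives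
  \<open>(N - 4) \<integral> f\<^sup>2 w\<^sup>2 \<le> - \<integral> f w \<Delta>f\<close>. Young's inequality absorbs the factor \<open>f w\<close>; the
  resulting constant \<open>(N - 4)\<^sup>-\<^sup>2\<close> is at most \<open>1\<close>.
\<close>

lemma rellich_inequality_regularized:
  fixes f :: "'a::euclidean_space \<Rightarrow> real"
  assumes f: "test_function f" and N: "DIM('a) \<ge> 5" and e: "e > 0"
  shows "(\<integral>x. (f x / (x \<bullet> x + e))\<^sup>2 \<partial>lborel) \<le> (\<integral>x. (laplacian f x)\<^sup>2 \<partial>lborel)"
    and "integrable lborel (\<lambda>x. (f x / (x \<bullet> x + e))\<^sup>2)"
    and "integrable lborel (\<lambda>x. (laplacian f x)\<^sup>2)"
proof -
  obtain R where R: "\<And>x. R < norm x \<Longrightarrow> f x = 0" using test_functionD(3)[OF f] by blast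
  note f2 = test_functionD(1)[OF f, of 2]
  define N where "N = real DIM('a)"
  have N5: "N \<ge> 5" using N by (simp add: N_def)
  define w where "w = (\<lambda>x::'a. inverse (x \<bullet> x + e))"
  have pos: "s + e > 0" if "0 \<le> s" for s using that e by simp
  note rad = radial_laplacian[of "\<lambda>s. inverse (s + e)" "\<lambda>s. - (inverse (s + e))\<^sup>2" "\<lambda>s. 2 * (inverse (s + e))^3",
      where ?'a = 'a]
  have D: "((\<lambda>s. inverse (s + e)) has_real_derivative - (inverse (s + e))\<^sup>2) (at s)"
    "((\<lambda>s. - (inverse (s + e))\<^sup>2) has_real_derivative 2 * (inverse (s + e))^3) (at s)"
    if "0 \<le> s" for s
    using pos[OF that] by (auto intro!: derivative_eq_intros simp: power2_eq_square power3_eq_cube)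
  have C: "continuous_on {0..} (\<lambda>s. 2 * (inverse (s + e))^3)"
    using e by (auto intro!: continuous_intros simp: add_nonneg_eq_0_iff)
  have w2: "times_cont_differentiable 2 w"
    unfolding w_def by (rule rad(1)[OF D(1) D(2) C])
  \<comment> \<open>Here \<open>N \<ge> 5\<close> gives the sign.\<close>
  have wlap: "laplacian w x \<le> - 2 * (N - 4) * (w x)\<^sup>2" for x
  proof -
    let ?s = "x \<bullet> x"
    have "laplacian w x = 2 * N * (- (w x)\<^sup>2) + 4 * ?s * (2 * (w x)^3)"
      using rad(2)[OF D(1) D(2) C] by (simp add: w_def N_def)
    also have "4 * ?s * (2 * (w x)^3) = 8 * (?s * w x) * (w x)\<^sup>2"
      by (simp add: power2_eq_square power3_eq_cube)
    also have "\<dots> \<le> 8 * 1 * (w x)\<^sup>2"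
      using e by (intro mult_right_mono mult_left_mono) (auto simp: w_def divide_simps add_nonneg_pos)
    finally show ?thesis by (simp add: algebra_simps)
  qed
  have ff2: "times_cont_differentiable 2 (\<lambda>x. f x * f x)"
    by (rule times_cont_differentiable_mult[OF f2 f2])
  have Rl: "\<And>x. R < norm x \<Longrightarrow> laplacian f x = 0"
    by (rule laplacian_outside[OF R])
  have Rl2: "\<And>x. R < norm x \<Longrightarrow> laplacian (\<lambda>x. f x * f x) x = 0"
    by (rule laplacian_outside[of R]) (simp_all add: R)
  note cont = times_cont_differentiable_2D[OF f2] times_cont_differentiable_2D[OF w2]
    times_cont_differentiable_2D[OF ff2]
  have i: "integrable lborel (\<lambda>x. (f x * w x)\<^sup>2)" "integrable lborel (\<lambda>x. (laplacian f x)\<^sup>2)"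
    "integrable lborel (\<lambda>x. f x * f x * laplacian w x)"
    "integrable lborel (\<lambda>x. laplacian (\<lambda>x. f x * f x) x * w x)"
    "integrable lborel (\<lambda>x. 2 * (f x * laplacian f x) * w x)"
    by (rule integrable_continuous_compact_support[of _ R];
      auto intro!: continuous_on_mult continuous_on_power continuous_on_const cont simp: R Rl Rl2)+
  have "2 * (\<integral>x. (f x * w x)\<^sup>2 \<partial>lborel) \<le> (\<integral>x. (f x * w x)\<^sup>2 \<partial>lborel) + (\<integral>x. (laplacian f x)\<^sup>2 \<partial>lborel)"
  proof -
    have "(\<integral>x. 2 * (f x * laplacian f x) * w x \<partial>lborel) \<le> (\<integral>x. laplacian (\<lambda>x. f x * f x) x * w x \<partial>lborel)"
      using e by (intro integral_mono i mult_right_mono laplacian_square_ge f2)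
        (simp_all add: w_def add_nonneg_nonneg)
    also have "\<dots> = (\<integral>x. f x * f x * laplacian w x \<partial>lborel)"
      using green_identity[OF ff2 w2, of R] R by simp
    also have "\<dots> \<le> (\<integral>x. - 2 * (N - 4) * (f x * w x)\<^sup>2 \<partial>lborel)"
    proof (intro integral_mono i integrable_mult_right)
      fix x
      have "f x * f x * laplacian w x \<le> f x * f x * (- 2 * (N - 4) * (w x)\<^sup>2)"
        by (intro mult_left_mono wlap) simp
      then show "f x * f x * laplacian w x \<le> - 2 * (N - 4) * (f x * w x)\<^sup>2"
        by (simp add: power_mult_distrib power2_eq_square mult_ac)
    qed
    also have "\<dots> = - 2 * (N - 4) * (\<integral>x. (f x * w x)\<^sup>2 \<partial>lborel)" by simp
    also have "\<dots> \<le> - 2 * 1 * (\<integral>x. (f x * w x)\<^sup>2 \<partial>lborel)"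
      using N5 by (intro mult_right_mono) auto
    finally have "2 * (\<integral>x. (f x * w x)\<^sup>2 \<partial>lborel) \<le> - (\<integral>x. 2 * (f x * laplacian f x) * w x \<partial>lborel)"
      by simp
    also have "\<dots> = (\<integral>x. - (2 * (f x * laplacian f x) * w x) \<partial>lborel)" by simp
    also have "\<dots> \<le> (\<integral>x. (f x * w x)\<^sup>2 + (laplacian f x)\<^sup>2 \<partial>lborel)"
    proof (intro integral_mono integrable_minus Bochner_Integration.integrable_add i)
      fix x
      have "0 \<le> (f x * w x + laplacian f x)\<^sup>2" by simp
      then show "- (2 * (f x * laplacian f x) * w x) \<le> (f x * w x)\<^sup>2 + (laplacian f x)\<^sup>2"
        unfolding power2_sum by (simp add: mult_ac)
    qed
    also have "\<dots> = (\<integral>x. (f x * w x)\<^sup>2 \<partial>lborel) + (\<integral>x. (laplacian f x)\<^sup>2 \<partial>lborel)"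
      by (intro Bochner_Integration.integral_add i)
    finally show ?thesis .
  qed
  then show "(\<integral>x. (f x / (x \<bullet> x + e))\<^sup>2 \<partial>lborel) \<le> (\<integral>x. (laplacian f x)\<^sup>2 \<partial>lborel)"
    by (simp add: w_def divide_inverse)
  show "integrable lborel (\<lambda>x. (f x / (x \<bullet> x + e))\<^sup>2)" "integrable lborel (\<lambda>x. (laplacian f x)\<^sup>2)"
    using i(1,2) by (simp_all add: w_def divide_inverse)
qed

text \<open>
  Dropping finitely many members of an approximating sequence makes all the distances finite, so that
  the convergence can be stated with Bochner integrals.
\<close>

lemma D22_approximation:
  fixes u g :: "'a::euclidean_space \<Rightarrow> real"
  assumes "has_D22_laplacian u g"
  defines "p \<equiv> critical_exponent DIM('a)"
  obtains \<phi> where "\<And>n. test_function (\<phi> n)"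
    and "\<And>n. integrable lborel (\<lambda>x. (laplacian (\<phi> n) x - g x)\<^sup>2)"
    and "(\<lambda>n. \<integral>x. (laplacian (\<phi> n) x - g x)\<^sup>2 \<partial>lborel) \<longlonglongrightarrow> 0"
    and "\<And>n. integrable lborel (\<lambda>x. \<bar>\<phi> n x - u x\<bar> powr p)"
    and "(\<lambda>n. \<integral>x. \<bar>\<phi> n x - u x\<bar> powr p \<partial>lborel) \<longlonglongrightarrow> 0"
proof -
  have [measurable]: "u \<in> borel_measurable borel" "g \<in> borel_measurable borel"
    using assms by (auto simp: has_D22_laplacian_def)
  obtain \<phi> where \<phi>: "\<And>n. test_function (\<phi> n)" "Lp_tendsto 2 (\<lambda>n. laplacian (\<phi> n)) g" "Lp_tendsto p \<phi> u"
    using assms by (auto simp: has_D22_laplacian_def)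
  have [measurable]: "\<phi> n \<in> borel_measurable borel" "laplacian (\<phi> n) \<in> borel_measurable borel" for n
    using test_functionD(2)[OF \<phi>(1)] test_functionD(2)[OF test_function_laplacian[OF \<phi>(1)]]
    by (auto intro: borel_measurable_continuous_onI)
  have L: "(\<lambda>n. \<integral>\<^sup>+x. ennreal ((laplacian (\<phi> n) x - g x)\<^sup>2) \<partial>lborel) \<longlonglongrightarrow> 0"
    using \<phi>(2) by (simp add: Lp_tendsto_def)
  have U: "(\<lambda>n. \<integral>\<^sup>+x. ennreal (\<bar>\<phi> n x - u x\<bar> powr p) \<partial>lborel) \<longlonglongrightarrow> 0"
    using \<phi>(3) by (simp add: Lp_tendsto_def)
  have "\<forall>\<^sub>F n in sequentially. (\<integral>\<^sup>+x. ennreal ((laplacian (\<phi> n) x - g x)\<^sup>2) \<partial>lborel) < 1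
      \<and> (\<integral>\<^sup>+x. ennreal (\<bar>\<phi> n x - u x\<bar> powr p) \<partial>lborel) < 1"
    using order_tendstoD(2)[OF L, of 1] order_tendstoD(2)[OF U, of 1] by (auto intro: eventually_conj)
  then obtain m where m: "\<And>n. n \<ge> m \<Longrightarrow> (\<integral>\<^sup>+x. ennreal ((laplacian (\<phi> n) x - g x)\<^sup>2) \<partial>lborel) < 1"
    "\<And>n. n \<ge> m \<Longrightarrow> (\<integral>\<^sup>+x. ennreal (\<bar>\<phi> n x - u x\<bar> powr p) \<partial>lborel) < 1"
    by (auto simp: eventually_sequentially)
  have i: "integrable lborel (\<lambda>x. (laplacian (\<phi> (n + m)) x - g x)\<^sup>2)"
    "integrable lborel (\<lambda>x. \<bar>\<phi> (n + m) x - u x\<bar> powr p)" for n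
    using m[of "n + m"] by (auto intro!: integrableI_nonneg elim: order_less_trans)
  show thesis
  proof (rule that[of "\<lambda>n. \<phi> (n + m)"])
    have "(\<lambda>n. ennreal (\<integral>x. (laplacian (\<phi> (n + m)) x - g x)\<^sup>2 \<partial>lborel)) \<longlonglongrightarrow> ennreal 0"
      using LIMSEQ_ignore_initial_segment[OF L, of m] by (simp add: nn_integral_eq_integral i)
    then show "(\<lambda>n. \<integral>x. (laplacian (\<phi> (n + m)) x - g x)\<^sup>2 \<partial>lborel) \<longlonglongrightarrow> 0"
      by (subst (asm) tendsto_ennreal_iff) simp_all
    have "(\<lambda>n. ennreal (\<integral>x. \<bar>\<phi> (n + m) x - u x\<bar> powr p \<partial>lborel)) \<longlonglongrightarrow> ennreal 0"
      using LIMSEQ_ignore_initial_segment[OF U, of m] by (simp add: nn_integral_eq_integral i)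
    then show "(\<lambda>n. \<integral>x. \<bar>\<phi> (n + m) x - u x\<bar> powr p \<partial>lborel) \<longlonglongrightarrow> 0"
      by (subst (asm) tendsto_ennreal_iff) simp_all
  qed (use \<phi>(1) i in auto)
qed

lemma has_D22_laplacian_measurable:
  assumes "has_D22_laplacian u g"
  shows "u \<in> borel_measurable borel" "g \<in> borel_measurable borel"
  using assms by (auto simp: has_D22_laplacian_def)

lemma test_function_measurable:
  assumes "test_function \<phi>"
  shows "\<phi> \<in> borel_measurable borel" "laplacian \<phi> \<in> borel_measurable borel"
  using test_functionD(2)[OF assms] test_functionD(2)[OF test_function_laplacian[OF assms]]
  by (auto intro: borel_measurable_continuous_onI)

lemma has_D22_laplacian_square_integrable:
  fixes u g :: "'a::euclidean_space \<Rightarrow> real"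
  assumes "has_D22_laplacian u g" "DIM('a) \<ge> 5"
  shows "integrable lborel (\<lambda>x. (g x)\<^sup>2)"
proof -
  note [measurable] = has_D22_laplacian_measurable[OF assms(1)]
  obtain \<phi> :: "nat \<Rightarrow> 'a \<Rightarrow> real" where \<phi>: "\<And>n. test_function (\<phi> n)"
    "\<And>n. integrable lborel (\<lambda>x. (laplacian (\<phi> n) x - g x)\<^sup>2)"
    by (rule D22_approximation[OF assms(1)], rule that)
  show ?thesis
  proof (rule Bochner_Integration.integrable_bound)
    show "integrable lborel (\<lambda>x. 2 * (laplacian (\<phi> 0) x)\<^sup>2 + 2 * (laplacian (\<phi> 0) x - g x)\<^sup>2)"
      using rellich_inequality_regularized(3)[OF \<phi>(1) assms(2), of 1] \<phi>(2) by simp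
    have "(g x)\<^sup>2 \<le> 2 * (laplacian (\<phi> 0) x)\<^sup>2 + 2 * (laplacian (\<phi> 0) x - g x)\<^sup>2" for x
      using sum_squares_bound[of "laplacian (\<phi> 0) x" "g x - laplacian (\<phi> 0) x"]
      by (simp add: power2_eq_square algebra_simps)
    then show "AE x in lborel. norm ((g x)\<^sup>2)
        \<le> norm (2 * (laplacian (\<phi> 0) x)\<^sup>2 + 2 * (laplacian (\<phi> 0) x - g x)\<^sup>2)"
      by (simp add: add_nonneg_nonneg)
  qed simp
qed

text \<open>
  Along a subsequence the approximating test functions converge almost everywhere. Letting the
  regularization parameter tend to \<open>0\<close> along the same subsequence, a single application of Fatou's
  lemma yields the singular weight and the limit function at once.
\<close>

lemma rellich_integrable:
  fixes u g :: "'a::euclidean_space \<Rightarrow> real"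
  assumes u: "has_D22_laplacian u g" and N: "DIM('a) \<ge> 5"
  shows "integrable lborel (\<lambda>x. (u x / (x \<bullet> x))\<^sup>2)"
proof -
  note [measurable] = has_D22_laplacian_measurable[OF u]
  note gi = has_D22_laplacian_square_integrable[OF u N]
  let ?p = "critical_exponent DIM('a)"
  have p: "?p > 0" using N by (simp add: critical_exponent_def)
  obtain \<phi> where \<phi>: "\<And>n. test_function (\<phi> n)"
    "\<And>n. integrable lborel (\<lambda>x. (laplacian (\<phi> n) x - g x)\<^sup>2)"
    "(\<lambda>n. \<integral>x. (laplacian (\<phi> n) x - g x)\<^sup>2 \<partial>lborel) \<longlonglongrightarrow> 0"
    "\<And>n. integrable lborel (\<lambda>x. \<bar>\<phi> n x - u x\<bar> powr ?p)"
    "(\<lambda>n. \<integral>x. \<bar>\<phi> n x - u x\<bar> powr ?p \<partial>lborel) \<longlonglongrightarrow> 0"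
    by (rule D22_approximation[OF u], rule that)
  note [measurable] = test_function_measurable[OF \<phi>(1)]
  obtain r where r: "strict_mono r" "AE x in lborel. (\<lambda>n. \<bar>\<phi> (r n) x - u x\<bar> powr ?p) \<longlonglongrightarrow> 0"
    using tendsto_L1_AE_subseq[of lborel "\<lambda>n x. \<bar>\<phi> n x - u x\<bar> powr ?p", OF \<phi>(4)] \<phi>(5) by auto
  define e where "e n = inverse (real (Suc n))" for n
  have e: "e n > 0" for n by (simp add: e_def)
  obtain K where K: "\<And>n. (\<integral>x. (laplacian (\<phi> n) x - g x)\<^sup>2 \<partial>lborel) \<le> K"
    using convergent_imp_Bseq[OF convergentI[OF \<phi>(3)]] by (auto simp: Bseq_def abs_le_iff)
  define C where "C = 2 * (\<integral>x. (g x)\<^sup>2 \<partial>lborel) + 2 * K"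
  have b: "(\<integral>\<^sup>+x. ennreal ((\<phi> (r n) x / (x \<bullet> x + e n))\<^sup>2) \<partial>lborel) \<le> ennreal C" for n
  proof -
    note R = rellich_inequality_regularized[OF \<phi>(1)[of "r n"] N e[of n]]
    have "(\<integral>\<^sup>+x. ennreal ((\<phi> (r n) x / (x \<bullet> x + e n))\<^sup>2) \<partial>lborel)
        = ennreal (\<integral>x. (\<phi> (r n) x / (x \<bullet> x + e n))\<^sup>2 \<partial>lborel)"
      by (intro nn_integral_eq_integral R) simp
    also have "(\<integral>x. (\<phi> (r n) x / (x \<bullet> x + e n))\<^sup>2 \<partial>lborel) \<le> (\<integral>x. (laplacian (\<phi> (r n)) x)\<^sup>2 \<partial>lborel)"
      by (rule R)
    also have "\<dots> \<le> (\<integral>x. 2 * (g x)\<^sup>2 + 2 * (laplacian (\<phi> (r n)) x - g x)\<^sup>2 \<partial>lborel)"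
    proof (intro integral_mono R Bochner_Integration.integrable_add integrable_mult_right gi \<phi>)
      show "(laplacian (\<phi> (r n)) x)\<^sup>2 \<le> 2 * (g x)\<^sup>2 + 2 * (laplacian (\<phi> (r n)) x - g x)\<^sup>2" for x
        using sum_squares_bound[of "g x" "laplacian (\<phi> (r n)) x - g x"]
        by (simp add: power2_eq_square algebra_simps)
    qed
    also have "\<dots> = 2 * (\<integral>x. (g x)\<^sup>2 \<partial>lborel) + 2 * (\<integral>x. (laplacian (\<phi> (r n)) x - g x)\<^sup>2 \<partial>lborel)"
      using gi \<phi>(2) by simp
    also have "\<dots> \<le> C" using K[of "r n"] by (simp add: C_def)
    finally show ?thesis by (simp add: ennreal_leI)
  qed
  have AE: "AE x in lborel. ennreal ((u x / (x \<bullet> x))\<^sup>2)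
      = liminf (\<lambda>n. ennreal ((\<phi> (r n) x / (x \<bullet> x + e n))\<^sup>2))"
    using r(2) AE_lborel_singleton[of 0]
  proof eventually_elim
    case (elim x)
    have "(\<lambda>n. (\<bar>\<phi> (r n) x - u x\<bar> powr ?p) powr (1 / ?p)) \<longlonglongrightarrow> 0 powr (1 / ?p)"
      using elim(1) p by (intro tendsto_powr') (auto)
    then have "(\<lambda>n. \<phi> (r n) x - u x) \<longlonglongrightarrow> 0"
      using p by (simp add: powr_powr tendsto_rabs_zero_iff)
    then have "(\<lambda>n. \<phi> (r n) x) \<longlonglongrightarrow> u x" by (simp add: LIM_zero_iff)
    moreover have "e \<longlonglongrightarrow> 0" unfolding e_def by (rule LIMSEQ_inverse_real_of_nat)
    ultimately have "(\<lambda>n. (\<phi> (r n) x / (x \<bullet> x + e n))\<^sup>2) \<longlonglongrightarrow> (u x / (x \<bullet> x + 0))\<^sup>2"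
      using elim(2) by (intro tendsto_intros) auto
    then have "(\<lambda>n. ennreal ((\<phi> (r n) x / (x \<bullet> x + e n))\<^sup>2)) \<longlonglongrightarrow> ennreal ((u x / (x \<bullet> x))\<^sup>2)"
      by (intro tendsto_ennrealI) simp
    then show ?case by (rule lim_imp_Liminf[OF sequentially_bot, symmetric])
  qed
  have "(\<integral>\<^sup>+x. ennreal ((u x / (x \<bullet> x))\<^sup>2) \<partial>lborel)
      = (\<integral>\<^sup>+x. liminf (\<lambda>n. ennreal ((\<phi> (r n) x / (x \<bullet> x + e n))\<^sup>2)) \<partial>lborel)"
    by (rule nn_integral_cong_AE[OF AE])
  also have "\<dots> \<le> liminf (\<lambda>n. \<integral>\<^sup>+x. ennreal ((\<phi> (r n) x / (x \<bullet> x + e n))\<^sup>2) \<partial>lborel)"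
    by (rule nn_integral_liminf) measurable
  also have "\<dots> \<le> liminf (\<lambda>n. ennreal C)"
    by (rule Liminf_mono) (simp add: b)
  also have "\<dots> < \<infinity>" by (simp add: Liminf_const)
  finally show ?thesis by (intro integrableI_nonneg) auto
qed

section \<open>The Laplacian on the completion as a weak Laplacian\<close>

text \<open>
  A replacement for Hoelder's inequality in limit arguments: a pointwise Young-type bound with a
  small multiple of a fixed integrable function is enough, and it treats \<open>L\<^sup>2\<close> and \<open>L\<^sup>p\<close> convergence
  uniformly.
\<close>

lemma integral_tendsto_0_if_small_plus_vanishing:
  fixes f w :: "nat \<Rightarrow> 'b \<Rightarrow> real"
  assumes m: "\<And>n. f n \<in> borel_measurable M" and k: "integrable M \<kappa>"
    and w: "\<And>n. integrable M (w n)" and lim: "(\<lambda>n. \<integral>x. w n x \<partial>M) \<longlonglongrightarrow> 0"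
    and b: "\<And>\<epsilon>. \<epsilon> > 0 \<Longrightarrow> \<exists>C. \<forall>n x. \<bar>f n x\<bar> \<le> \<epsilon> * \<kappa> x + C * w n x"
  shows "integrable M (f n)" and "(\<lambda>n. \<integral>x. f n x \<partial>M) \<longlonglongrightarrow> 0"
proof -
  show i: "integrable M (f n)" for n
  proof -
    obtain C where C: "\<bar>f n x\<bar> \<le> 1 * \<kappa> x + C * w n x" for x using b[of 1] by auto
    have le: "\<bar>f n x\<bar> \<le> \<bar>1 * \<kappa> x + C * w n x\<bar>" for x
      using C[of x] abs_ge_self order_trans by blast
    show ?thesis
      by (rule Bochner_Integration.integrable_bound[of M "\<lambda>x. 1 * \<kappa> x + C * w n x"])
        (use k w m le in auto)
  qed
  show "(\<lambda>n. \<integral>x. f n x \<partial>M) \<longlonglongrightarrow> 0"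
  proof (rule LIMSEQ_I)
    fix r :: real assume "r > 0"
    define \<epsilon> where "\<epsilon> = r / (2 * (\<bar>\<integral>x. \<kappa> x \<partial>M\<bar> + 1))"
    have "\<epsilon> > 0" using \<open>r > 0\<close> by (simp add: \<epsilon>_def add_nonneg_pos)
    then obtain C where C: "\<And>n x. \<bar>f n x\<bar> \<le> \<epsilon> * \<kappa> x + C * w n x" using b by blast
    have "(\<lambda>n. C * (\<integral>x. w n x \<partial>M)) \<longlonglongrightarrow> C * 0" by (intro tendsto_intros lim)
    then have "\<forall>\<^sub>F n in sequentially. C * (\<integral>x. w n x \<partial>M) < r / 2"
      using \<open>r > 0\<close> by (intro order_tendstoD(2)) auto
    then obtain n0 where n0: "\<And>n. n \<ge> n0 \<Longrightarrow> C * (\<integral>x. w n x \<partial>M) < r / 2"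
      by (auto simp: eventually_sequentially)
    have "\<epsilon> * (\<integral>x. \<kappa> x \<partial>M) \<le> \<epsilon> * (\<bar>\<integral>x. \<kappa> x \<partial>M\<bar> + 1)"
      using \<open>\<epsilon> > 0\<close> by (intro mult_left_mono) auto
    also have "\<dots> = r / 2"
    proof -
      have "\<bar>\<integral>x. \<kappa> x \<partial>M\<bar> + 1 \<noteq> 0" by linarith
      moreover have "r / (2 * y) * y = r / 2" if "y \<noteq> 0" for y using that by simp
      ultimately show ?thesis unfolding \<epsilon>_def by blast
    qed
    finally have e: "\<epsilon> * (\<integral>x. \<kappa> x \<partial>M) \<le> r / 2" .
    have "norm ((\<integral>x. f n x \<partial>M) - 0) < r" if "n \<ge> n0" for n
    proof -
      have "norm (\<integral>x. f n x \<partial>M) \<le> (\<integral>x. \<bar>f n x\<bar> \<partial>M)"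
        using integral_norm_bound[of M "f n"] by simp
      also have "\<dots> \<le> (\<integral>x. \<epsilon> * \<kappa> x + C * w n x \<partial>M)"
        using k w i C by (intro integral_mono) auto
      also have "\<dots> = \<epsilon> * (\<integral>x. \<kappa> x \<partial>M) + C * (\<integral>x. w n x \<partial>M)"
        using k w by simp
      also have "\<dots> < r" using e n0[OF that] by linarith
      finally show ?thesis by simp
    qed
    then show "\<exists>n0. \<forall>n\<ge>n0. norm ((\<integral>x. f n x \<partial>M) - 0) < r" by blast
  qed
qed

lemma abs_mult_le_eps_squares:
  fixes a b \<epsilon> :: real
  assumes "\<epsilon> > 0"
  shows "\<bar>a * b\<bar> \<le> \<epsilon> * b\<^sup>2 + (1 / \<epsilon>) * a\<^sup>2"
proof -
  have "0 \<le> (\<epsilon> * \<bar>b\<bar> - \<bar>a\<bar>)\<^sup>2 / \<epsilon>" using assms by simp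
  also have "\<dots> = \<epsilon> * b\<^sup>2 + (1 / \<epsilon>) * a\<^sup>2 - 2 * \<bar>a * b\<bar>"
    using assms by (simp add: power2_diff field_simps abs_mult power2_eq_square)
  finally show ?thesis using abs_ge_zero[of "a * b"] by linarith
qed

lemma abs_le_eps_plus_powr:
  fixes a \<epsilon> p :: real
  assumes "\<epsilon> > 0" "p \<ge> 1"
  shows "\<bar>a\<bar> \<le> \<epsilon> + \<epsilon> powr (1 - p) * \<bar>a\<bar> powr p"
proof (cases "\<bar>a\<bar> \<le> \<epsilon>")
  case True
  then show ?thesis by (simp add: add_increasing2)
next
  case False
  then have "\<bar>a\<bar> = \<bar>a\<bar> powr (1 - p) * \<bar>a\<bar> powr p"
    using assms by (simp add: powr_add[symmetric])
  also have "\<dots> \<le> \<epsilon> powr (1 - p) * \<bar>a\<bar> powr p"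
    using False assms by (intro mult_right_mono powr_mono2') auto
  finally show ?thesis using assms by linarith
qed

lemma integrable_mult_square_integrable:
  fixes f g :: "'b \<Rightarrow> real"
  assumes "f \<in> borel_measurable M" "g \<in> borel_measurable M"
    and "integrable M (\<lambda>x. (f x)\<^sup>2)" "integrable M (\<lambda>x. (g x)\<^sup>2)"
  shows "integrable M (\<lambda>x. f x * g x)"
proof (rule Bochner_Integration.integrable_bound)
  show "integrable M (\<lambda>x. (f x)\<^sup>2 + (g x)\<^sup>2)" using assms by simp
  have "\<bar>f x * g x\<bar> \<le> (f x)\<^sup>2 + (g x)\<^sup>2" for x
    using abs_mult_le_eps_squares[of 1 "f x" "g x"] by simp
  then show "AE x in M. norm (f x * g x) \<le> norm ((f x)\<^sup>2 + (g x)\<^sup>2)" by simp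
qed (use assms in measurable)

text \<open>
  Green's identity holds for each approximating test function. On the left the convergence in \<open>L\<^sup>p\<close> is
  tested against a bounded function of compact support, on the right the convergence in \<open>L\<^sup>2\<close> against
  a square integrable one.
\<close>

lemma weak_laplacian:
  fixes u g \<psi> :: "'a::euclidean_space \<Rightarrow> real"
  assumes u: "has_D22_laplacian u g" and N: "DIM('a) \<ge> 5"
    and \<psi>: "times_cont_differentiable 2 \<psi>" and \<psi>2: "integrable lborel (\<lambda>x. (\<psi> x)\<^sup>2)"
    and R: "\<And>x. R < norm x \<Longrightarrow> laplacian \<psi> x = 0"
  shows "integrable lborel (\<lambda>x. u x * laplacian \<psi> x)"
    and "(\<integral>x. u x * laplacian \<psi> x \<partial>lborel) = (\<integral>x. g x * \<psi> x \<partial>lborel)"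
proof -
  note [measurable] = has_D22_laplacian_measurable[OF u]
  note C = times_cont_differentiable_2D[OF \<psi>]
  have [measurable]: "\<psi> \<in> borel_measurable borel" "laplacian \<psi> \<in> borel_measurable borel"
    using C by (auto intro: borel_measurable_continuous_onI)
  note gi = has_D22_laplacian_square_integrable[OF u N]
  define p where "p = critical_exponent DIM('a)"
  have p: "p \<ge> 1" using N by (simp add: p_def critical_exponent_def le_divide_eq)
  obtain \<phi> where \<phi>: "\<And>n. test_function (\<phi> n)"
    "\<And>n. integrable lborel (\<lambda>x. (laplacian (\<phi> n) x - g x)\<^sup>2)"
    "(\<lambda>n. \<integral>x. (laplacian (\<phi> n) x - g x)\<^sup>2 \<partial>lborel) \<longlonglongrightarrow> 0"
    "\<And>n. integrable lborel (\<lambda>x. \<bar>\<phi> n x - u x\<bar> powr p)"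
    "(\<lambda>n. \<integral>x. \<bar>\<phi> n x - u x\<bar> powr p \<partial>lborel) \<longlonglongrightarrow> 0"
    by (rule D22_approximation[OF u, folded p_def], rule that)
  note [measurable] = test_function_measurable[OF \<phi>(1)]
  obtain K where K: "\<And>x. \<bar>laplacian \<psi> x\<bar> \<le> K"
  proof -
    have "compact (laplacian \<psi> ` cball 0 R)"
      by (intro compact_continuous_image continuous_on_subset[OF C(6)]) auto
    then obtain K where "\<forall>y\<in>laplacian \<psi> ` cball 0 R. norm y \<le> K"
      by (meson bounded_iff compact_imp_bounded)
    then have "\<bar>laplacian \<psi> x\<bar> \<le> max K 0" for x
      using R[of x] by (cases "norm x \<le> R") (auto simp: le_max_iff_disj)
    then show ?thesis by (rule that)
  qed
  have K0: "K \<ge> 0" using K[of 0] abs_ge_zero order_trans by blast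
  have li: "integrable lborel (laplacian \<psi>)"
    by (rule integrable_continuous_compact_support[OF C(6) R])
  have \<phi>R: "\<exists>R. \<forall>x. R < norm x \<longrightarrow> \<phi> n x = 0" for n using test_functionD(3)[OF \<phi>(1)] by blast
  have i1: "integrable lborel (\<lambda>x. \<phi> n x * laplacian \<psi> x)" for n
    by (rule integrable_continuous_compact_support[of _ R])
      (use R test_functionD(2)[OF \<phi>(1)] C in \<open>auto intro!: continuous_on_mult\<close>)
  have i2: "integrable lborel (\<lambda>x. g x * \<psi> x)"
    by (rule integrable_mult_square_integrable) (use gi \<psi>2 in auto)
  have gr: "(\<integral>x. \<phi> n x * laplacian \<psi> x \<partial>lborel) = (\<integral>x. laplacian (\<phi> n) x * \<psi> x \<partial>lborel)" for n
    using green_identity[OF test_functionD(1)[OF \<phi>(1)] \<psi>] \<phi>R[of n] by blast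
  have b1: "\<exists>C. \<forall>n x. \<bar>(\<phi> n x - u x) * laplacian \<psi> x\<bar>
      \<le> \<epsilon> * \<bar>laplacian \<psi> x\<bar> + C * (\<bar>\<phi> n x - u x\<bar> powr p)" if "\<epsilon> > 0" for \<epsilon>
  proof (intro exI allI)
    fix n x
    have "\<bar>(\<phi> n x - u x) * laplacian \<psi> x\<bar>
        \<le> (\<epsilon> + \<epsilon> powr (1 - p) * \<bar>\<phi> n x - u x\<bar> powr p) * \<bar>laplacian \<psi> x\<bar>"
      unfolding abs_mult by (intro mult_right_mono abs_le_eps_plus_powr that p) simp
    also have "\<dots> = \<epsilon> * \<bar>laplacian \<psi> x\<bar> + \<epsilon> powr (1 - p) * \<bar>\<phi> n x - u x\<bar> powr p * \<bar>laplacian \<psi> x\<bar>"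
      by (simp add: algebra_simps)
    also have "\<dots> \<le> \<epsilon> * \<bar>laplacian \<psi> x\<bar> + \<epsilon> powr (1 - p) * \<bar>\<phi> n x - u x\<bar> powr p * K"
      by (intro add_left_mono mult_left_mono K) simp
    finally show "\<bar>(\<phi> n x - u x) * laplacian \<psi> x\<bar>
        \<le> \<epsilon> * \<bar>laplacian \<psi> x\<bar> + (\<epsilon> powr (1 - p) * K) * (\<bar>\<phi> n x - u x\<bar> powr p)"
      by (simp add: mult_ac)
  qed
  have b2: "\<exists>C. \<forall>n x. \<bar>(laplacian (\<phi> n) x - g x) * \<psi> x\<bar>
      \<le> \<epsilon> * (\<psi> x)\<^sup>2 + C * (laplacian (\<phi> n) x - g x)\<^sup>2" if "\<epsilon> > 0" for \<epsilon>
    using abs_mult_le_eps_squares[OF that] by blast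
  have lim1: "integrable lborel (\<lambda>x. (\<phi> n x - u x) * laplacian \<psi> x)"
    "(\<lambda>n. \<integral>x. (\<phi> n x - u x) * laplacian \<psi> x \<partial>lborel) \<longlonglongrightarrow> 0" for n
    using integral_tendsto_0_if_small_plus_vanishing[of "\<lambda>n x. (\<phi> n x - u x) * laplacian \<psi> x" lborel
        "\<lambda>x. \<bar>laplacian \<psi> x\<bar>" "\<lambda>n x. \<bar>\<phi> n x - u x\<bar> powr p", OF _ _ \<phi>(4,5) b1] li by simp_all
  have lim2: "integrable lborel (\<lambda>x. (laplacian (\<phi> n) x - g x) * \<psi> x)"
    "(\<lambda>n. \<integral>x. (laplacian (\<phi> n) x - g x) * \<psi> x \<partial>lborel) \<longlonglongrightarrow> 0" for n
    using integral_tendsto_0_if_small_plus_vanishing[of "\<lambda>n x. (laplacian (\<phi> n) x - g x) * \<psi> x" lborel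
        "\<lambda>x. (\<psi> x)\<^sup>2" "\<lambda>n x. (laplacian (\<phi> n) x - g x)\<^sup>2", OF _ _ \<phi>(2,3) b2] \<psi>2 by simp_all
  have "integrable lborel (\<lambda>x. \<phi> 0 x * laplacian \<psi> x - (\<phi> 0 x - u x) * laplacian \<psi> x)"
    by (intro Bochner_Integration.integrable_diff i1 lim1)
  then show i3: "integrable lborel (\<lambda>x. u x * laplacian \<psi> x)"
    by (simp add: algebra_simps)
  have e1: "(\<integral>x. (\<phi> n x - u x) * laplacian \<psi> x \<partial>lborel)
      = (\<integral>x. \<phi> n x * laplacian \<psi> x \<partial>lborel) - (\<integral>x. u x * laplacian \<psi> x \<partial>lborel)" for n
    by (simp add: left_diff_distrib i1 i3)
  have i4: "integrable lborel (\<lambda>x. laplacian (\<phi> n) x * \<psi> x)" for n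
  proof -
    have "integrable lborel (\<lambda>x. (laplacian (\<phi> n) x - g x) * \<psi> x + g x * \<psi> x)"
      by (intro Bochner_Integration.integrable_add lim2 i2)
    then show ?thesis by (simp add: algebra_simps)
  qed
  have e2: "(\<integral>x. (laplacian (\<phi> n) x - g x) * \<psi> x \<partial>lborel)
      = (\<integral>x. laplacian (\<phi> n) x * \<psi> x \<partial>lborel) - (\<integral>x. g x * \<psi> x \<partial>lborel)" for n
    by (simp add: left_diff_distrib i4 i2)
  have "(\<lambda>n. (\<integral>x. (laplacian (\<phi> n) x - g x) * \<psi> x \<partial>lborel)
      - (\<integral>x. (\<phi> n x - u x) * laplacian \<psi> x \<partial>lborel)) \<longlonglongrightarrow> 0 - 0"
    by (intro tendsto_diff lim1 lim2)
  then show "(\<integral>x. u x * laplacian \<psi> x \<partial>lborel) = (\<integral>x. g x * \<psi> x \<partial>lborel)"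
    by (simp add: e1 e2 gr LIMSEQ_const_iff)
qed

lemma has_D22_laplacian_test_function:
  assumes "test_function \<phi>"
  shows "has_D22_laplacian \<phi> (laplacian \<phi>)"
  using assms test_function_measurable[OF assms]
  unfolding has_D22_laplacian_def Lp_tendsto_def
  by (auto intro!: exI[of _ "\<lambda>_. \<phi>"])

lemma test_function_square_integrable:
  assumes "test_function \<phi>"
  shows "integrable lborel (\<lambda>x. (\<phi> x)\<^sup>2)"
proof -
  obtain R where "\<forall>x. R < norm x \<longrightarrow> \<phi> x = 0" using test_functionD(3)[OF assms] by blast
  then show ?thesis
    by (intro integrable_continuous_compact_support[of _ R] continuous_on_power
        test_functionD(2)[OF assms]) auto
qed

text \<open>
  The difference \<open>d\<close> of two Laplacians of \<open>\<phi>\<close> is orthogonal to all test functions. The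
  Laplacians of an approximating sequence, minus the classical Laplacian of \<open>\<phi>\<close>, are themselves test
  functions and converge to \<open>d\<close>, so \<open>d\<close> is orthogonal to itself.
\<close>

lemma D22_laplacian_test_function:
  fixes \<phi> :: "'a::euclidean_space \<Rightarrow> real"
  assumes \<phi>: "test_function \<phi>" and N: "DIM('a) \<ge> 5" and g: "has_D22_laplacian \<phi> g"
  shows "AE x in lborel. g x = laplacian \<phi> x"
proof -
  note h = has_D22_laplacian_test_function[OF \<phi>]
  note [measurable] = has_D22_laplacian_measurable[OF g] has_D22_laplacian_measurable[OF h]
  define d where "d = (\<lambda>x. g x - laplacian \<phi> x)"
  have [measurable]: "d \<in> borel_measurable borel" by (simp add: d_def)
  note gi = has_D22_laplacian_square_integrable[OF g N]
  note hi = has_D22_laplacian_square_integrable[OF h N]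
  have dd: "(d x)\<^sup>2 = (g x)\<^sup>2 + (laplacian \<phi> x)\<^sup>2 - 2 * (g x * laplacian \<phi> x)" for x
    by (simp add: d_def power2_diff)
  have di: "integrable lborel (\<lambda>x. (d x)\<^sup>2)"
    unfolding dd using gi hi integrable_mult_square_integrable[OF _ _ gi hi] by simp
  have orth: "(\<integral>x. d x * \<psi> x \<partial>lborel) = 0" if \<psi>: "test_function \<psi>" for \<psi> :: "'a \<Rightarrow> real"
  proof -
    note [measurable] = test_function_measurable[OF \<psi>]
    note \<psi>i = test_function_square_integrable[OF \<psi>]
    obtain R where R: "\<forall>x. R < norm x \<longrightarrow> \<psi> x = 0" using test_functionD(3)[OF \<psi>] by blast
    have R': "R < norm x \<Longrightarrow> laplacian \<psi> x = 0" for x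
      using R by (intro laplacian_outside[of R]) auto
    have "(\<integral>x. g x * \<psi> x \<partial>lborel) = (\<integral>x. laplacian \<phi> x * \<psi> x \<partial>lborel)"
      using weak_laplacian(2)[OF g N test_functionD(1)[OF \<psi>] \<psi>i R']
        weak_laplacian(2)[OF h N test_functionD(1)[OF \<psi>] \<psi>i R'] by simp
    moreover have "integrable lborel (\<lambda>x. g x * \<psi> x)" "integrable lborel (\<lambda>x. laplacian \<phi> x * \<psi> x)"
      using gi hi \<psi>i by (auto intro!: integrable_mult_square_integrable)
    ultimately show ?thesis by (simp add: d_def left_diff_distrib)
  qed
  obtain \<phi>' where \<phi>': "\<And>n. test_function (\<phi>' n)"
    "\<And>n. integrable lborel (\<lambda>x. (laplacian (\<phi>' n) x - g x)\<^sup>2)"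
    "(\<lambda>n. \<integral>x. (laplacian (\<phi>' n) x - g x)\<^sup>2 \<partial>lborel) \<longlonglongrightarrow> 0"
    "\<And>n. integrable lborel (\<lambda>x. \<bar>\<phi>' n x - \<phi> x\<bar> powr (critical_exponent DIM('a)))"
    "(\<lambda>n. \<integral>x. \<bar>\<phi>' n x - \<phi> x\<bar> powr (critical_exponent DIM('a)) \<partial>lborel) \<longlonglongrightarrow> 0"
    by (rule D22_approximation[OF g], rule that)
  note [measurable] = test_function_measurable[OF \<phi>'(1)]
  \<comment> \<open>The difference of the two Laplacians, in the form of a sum with an affine substitution under which test functions are closed.\<close>
  define \<psi> where "\<psi> n x = laplacian (\<phi>' n) x + (-1) * laplacian \<phi> (1 *\<^sub>R x + 0)" for n x
  have \<psi>: "test_function (\<psi> n)" for n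
    unfolding \<psi>_def
    by (rule test_function_add[OF test_function_laplacian[OF \<phi>'(1)]
          test_function_affine[OF test_function_laplacian[OF \<phi>]]]) simp
  have split: "(d x)\<^sup>2 = d x * \<psi> n x - (laplacian (\<phi>' n) x - g x) * d x" for n x
    by (simp add: d_def \<psi>_def power2_eq_square algebra_simps)
  have b: "\<exists>C. \<forall>n x. \<bar>(laplacian (\<phi>' n) x - g x) * d x\<bar>
      \<le> \<epsilon> * (d x)\<^sup>2 + C * (laplacian (\<phi>' n) x - g x)\<^sup>2" if "\<epsilon> > 0" for \<epsilon>
    using abs_mult_le_eps_squares[OF that] by blast
  have lim: "integrable lborel (\<lambda>x. (laplacian (\<phi>' n) x - g x) * d x)"
    "(\<lambda>n. \<integral>x. (laplacian (\<phi>' n) x - g x) * d x \<partial>lborel) \<longlonglongrightarrow> 0" for n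
    using integral_tendsto_0_if_small_plus_vanishing[of "\<lambda>n x. (laplacian (\<phi>' n) x - g x) * d x" lborel
        "\<lambda>x. (d x)\<^sup>2" "\<lambda>n x. (laplacian (\<phi>' n) x - g x)\<^sup>2", OF _ _ \<phi>'(2,3) b] di by simp_all
  have "(\<integral>x. (d x)\<^sup>2 \<partial>lborel) = - (\<integral>x. (laplacian (\<phi>' n) x - g x) * d x \<partial>lborel)" for n
  proof -
    have "integrable lborel (\<lambda>x. d x * \<psi> n x)"
      using test_function_measurable[OF \<psi>] test_function_square_integrable[OF \<psi>] di
      by (intro integrable_mult_square_integrable) auto
    then show ?thesis unfolding split[of _ n] using orth[OF \<psi>] lim(1) by simp
  qed
  then have "(\<lambda>n. \<integral>x. (d x)\<^sup>2 \<partial>lborel) \<longlonglongrightarrow> - 0" using tendsto_minus[OF lim(2)] by presburger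
  then have "(\<integral>x. (d x)\<^sup>2 \<partial>lborel) = 0" by (simp add: LIMSEQ_const_iff)
  then have "AE x in lborel. (d x)\<^sup>2 = 0"
    using di by (subst (asm) integral_nonneg_eq_0_iff_AE) auto
  then show ?thesis by (simp add: d_def)
qed

section \<open>Radial functions and the distribution of the squared norm\<close>

lemma AE_lborel_scaleR:
  fixes P :: "'a::euclidean_space \<Rightarrow> bool"
  assumes "Measurable.pred borel P" "AE x in lborel. P x" "c \<noteq> 0"
  shows "AE x in lborel. P (c *\<^sub>R x)"
  using assms(2) lborel_affine[OF assms(3), of "0::'a"] assms(1,3)
  by (subst (asm) lborel_affine[OF assms(3), of "0::'a"]) (simp add: AE_density AE_distr_iff)

lemma AE_lborel_imp_ex:
  assumes "AE x::'a::euclidean_space in lborel. P x"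
  shows "\<exists>x. P x"
proof (rule ccontr)
  assume "\<nexists>x. P x"
  with assms have "AE x::'a in lborel. False" by simp
  then have "emeasure lborel (UNIV :: 'a set) = 0"
    by (simp add: AE_iff_measurable[OF _ refl])
  then show False by simp
qed

text \<open>
  By Fubini's theorem applied to the dilations \<open>s x\<close>, almost every dilation of the set of all \<open>x\<close> with
  norm in \<open>T\<close> is a null set; by scaling, so is the set itself.
\<close>

lemma AE_norm_notin_null_set:
  assumes T: "T \<in> null_sets (lborel :: real measure)"
  shows "AE x::'a::euclidean_space in lborel. norm x \<notin> T"
proof -
  have [measurable]: "T \<in> sets borel" using T by auto
  have "AE t in lborel. t \<notin> T" using T by (rule AE_not_in)
  then have *: "AE s in lborel. c * s \<notin> T" if "c \<noteq> 0" for c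
    using AE_lborel_scaleR[of "\<lambda>t. t \<notin> T" c] that by simp
  have ne: "AE s in lborel. norm x * \<bar>s\<bar> \<notin> T" if "x \<noteq> 0" for x :: 'a
  proof -
    have "norm x \<noteq> 0" "- norm x \<noteq> 0" using that by auto
    from *[OF this(1)] *[OF this(2)] show ?thesis by eventually_elim (auto simp: abs_if)
  qed
  from AE_lborel_singleton[of "0::'a"] have "AE x::'a in lborel. AE s in lborel. norm x * \<bar>s\<bar> \<notin> T"
    by eventually_elim (rule ne)
  moreover have "{x \<in> space (lborel \<Otimes>\<^sub>M lborel). norm (fst x :: 'a) * \<bar>snd x\<bar> \<notin> T}
      \<in> sets (lborel \<Otimes>\<^sub>M lborel)" by measurable
  ultimately have "AE s in lborel. AE x::'a in lborel. norm x * \<bar>s\<bar> \<notin> T"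
    using lborel_pair.AE_commute[of "\<lambda>(x::'a) s. norm x * \<bar>s\<bar> \<notin> T"] by simp
  with AE_lborel_singleton[of "0::real"]
  have "AE s in lborel. s \<noteq> 0 \<and> (AE x::'a in lborel. norm x * \<bar>s\<bar> \<notin> T)"
    by eventually_elim simp
  then obtain s where s: "s \<noteq> 0" "AE x::'a in lborel. norm x * \<bar>s\<bar> \<notin> T"
    by (blast dest: AE_lborel_imp_ex)
  have "AE x::'a in lborel. norm ((1 / s) *\<^sub>R x) * \<bar>s\<bar> \<notin> T"
    by (rule AE_lborel_scaleR[OF _ s(2)]) (use s(1) in auto)
  then show ?thesis using s(1) by simp
qed

text \<open>
  The profile \<open>h\<close> need not be measurable. By Fubini's theorem the identity \<open>u(x) = h(|x|)\<close> holds at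
  almost all points of almost every line through the origin, and the restriction of \<open>u\<close> to one such
  line is a Borel profile. The resulting function of \<open>x \<bullet> x\<close> has the form used for radial functions
  throughout.
\<close>

lemma radial_borel_representative:
  fixes u :: "'a::euclidean_space \<Rightarrow> real"
  assumes [measurable]: "u \<in> borel_measurable borel" and h: "AE x in lborel. u x = h (norm x)"
  obtains k where "k \<in> borel_measurable borel" "AE x in lborel. u x = k (x \<bullet> x)"
proof -
  obtain Z where Z: "{x. u x \<noteq> h (norm x)} \<subseteq> Z" "Z \<in> null_sets lborel"
    using h by (auto elim!: AE_E simp: null_sets_def)
  have ZD: "u x = h (norm x)" if "x \<notin> Z" for x using Z(1) that by blast
  have [measurable]: "Z \<in> sets borel" using Z by auto
  have "AE x in lborel. x \<notin> Z" using Z by (intro AE_not_in)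
  then have ne: "AE x in lborel. s *\<^sub>R x \<notin> Z" if "s \<noteq> 0" for s :: real
    using AE_lborel_scaleR[of "\<lambda>x. x \<notin> Z" s] that by simp
  from AE_lborel_singleton[of "0::real"]
  have "AE s::real in lborel. AE x in lborel. s *\<^sub>R x \<notin> Z"
    by eventually_elim (rule ne)
  moreover have "{x \<in> space (lborel \<Otimes>\<^sub>M lborel). (fst x :: real) *\<^sub>R snd x \<notin> Z}
      \<in> sets (lborel \<Otimes>\<^sub>M lborel)" by measurable
  ultimately have "AE x in lborel. AE s::real in lborel. s *\<^sub>R x \<notin> Z"
    using lborel_pair.AE_commute[of "\<lambda>(s::real) x. s *\<^sub>R x \<notin> Z"] by simp
  with AE_lborel_singleton[of "0::'a"]
  have "AE x in lborel. x \<noteq> 0 \<and> (AE s::real in lborel. s *\<^sub>R x \<notin> Z)"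
    by eventually_elim simp
  then obtain x0 where x0: "x0 \<noteq> 0" "AE s::real in lborel. s *\<^sub>R x0 \<notin> Z"
    by (blast dest: AE_lborel_imp_ex)
  define T where "T = {r. (r / norm x0) *\<^sub>R x0 \<in> Z}"
  define k where "k s = u ((sqrt s / norm x0) *\<^sub>R x0)" for s
  have Tm[measurable]: "T \<in> sets borel" unfolding T_def by measurable
  have "AE r in lborel. ((1 / norm x0) *\<^sub>R r) *\<^sub>R x0 \<notin> Z"
    by (rule AE_lborel_scaleR[OF _ x0(2)]) (use x0(1) in auto)
  then have "AE r in lborel. r \<notin> T" by (simp add: T_def)
  then have "T \<in> null_sets lborel" by (subst AE_iff_null_sets) auto
  from AE_norm_notin_null_set[OF this, where ?'a = 'a] \<open>AE x in lborel. x \<notin> Z\<close>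
  have "AE x in lborel. u x = k (x \<bullet> x)"
  proof eventually_elim
    case (elim x)
    let ?y = "(norm x / norm x0) *\<^sub>R x0"
    have "?y \<notin> Z" using elim by (simp add: T_def)
    then have "u ?y = h (norm ?y)" by (rule ZD)
    moreover have "norm ?y = norm x" using x0(1) by simp
    moreover have "u x = h (norm x)" using elim by (intro ZD) simp
    ultimately show ?case by (simp add: k_def norm_eq_sqrt_inner[symmetric])
  qed
  moreover have "k \<in> borel_measurable borel" unfolding k_def by measurable
  ultimately show thesis by (rule that[rotated])
qed

text \<open>
  Surface measure of spheres in the variable \<open>s = |x|\<^sup>2\<close>: integrating it up to \<open>t\<close> gives the volume of
  the ball of radius \<open>sqrt t\<close>.
\<close>

definition radial_density :: "nat \<Rightarrow> real \<Rightarrow> real" where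
  "radial_density N s = unit_ball_vol N * (N / 2) * s powr (N / 2 - 1) * indicator {0..} s"

lemma radial_density_nonneg: "0 \<le> radial_density N s"
  by (simp add: radial_density_def unit_ball_vol_nonneg)

lemma radial_density_measurable[measurable]: "radial_density N \<in> borel_measurable borel"
  unfolding radial_density_def by measurable

lemma distr_inner_self:
  "distr lborel borel (\<lambda>x::'a::euclidean_space. x \<bullet> x)
    = density lborel (\<lambda>s. ennreal (radial_density DIM('a) s))"
proof (rule measure_eqI_generator_eq[where E="range (\<lambda>t::real. {..t})" and \<Omega>=UNIV
      and A="\<lambda>n. {..real n}"])
  let ?D = "distr lborel borel (\<lambda>x::'a. x \<bullet> x)"
  define N where "N = real DIM('a)"
  have N: "N > 0" by (simp add: N_def)
  have ball: "emeasure ?D {..t} = (if t < 0 then 0 else ennreal (unit_ball_vol N * t powr (N / 2)))" for t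
  proof (cases "t < 0")
    case True
    have "\<not> x \<bullet> x \<le> t" for x :: 'a using True inner_ge_zero[of x] by linarith
    then have "(\<lambda>x::'a. x \<bullet> x) -` {..t} = {}" by auto
    then show ?thesis using True by (simp add: emeasure_distr)
  next
    case False
    have "(\<lambda>x::'a. x \<bullet> x) -` {..t} = cball 0 (sqrt t)"
      using False by (auto simp: norm_eq_sqrt_inner)
    then have "emeasure ?D {..t} = ennreal (unit_ball_vol N * sqrt t ^ DIM('a))"
      using False by (simp add: emeasure_distr emeasure_cball N_def)
    also have "sqrt t ^ DIM('a) = t powr (N / 2)"
      using False N by (cases "t = 0")
        (simp_all add: powr_half_sqrt[symmetric] powr_realpow[symmetric] powr_powr N_def)
    finally show ?thesis using False by simp
  qed
  show "emeasure ?D X = emeasure (density lborel (\<lambda>s. ennreal (radial_density DIM('a) s))) X"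
    if range: "X \<in> range (\<lambda>t::real. {..t})" for X
  proof -
    obtain t where X: "X = {..t}" using range by (rule rangeE)
    have e: "emeasure (density lborel (\<lambda>s. ennreal (radial_density DIM('a) s))) {..t}
        = (\<integral>\<^sup>+s. ennreal (radial_density DIM('a) s) * indicator {..t} s \<partial>lborel)"
      by (simp add: emeasure_density)
    show ?thesis
    proof (cases "t < 0")
      case True
      have "(\<integral>\<^sup>+s. ennreal (radial_density DIM('a) s) * indicator {..t} s \<partial>lborel) = (\<integral>\<^sup>+(s::real). 0 \<partial>lborel)"
        using True by (intro nn_integral_cong) (auto simp: radial_density_def indicator_def)
      then show ?thesis using True by (simp add: X e ball)
    next
      case False
      have "((\<lambda>s. s powr (N / 2 - 1)) has_integral (t powr (N / 2 - 1 + 1) / (N / 2 - 1 + 1))) {0..t}"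
        using False N by (intro has_integral_powr_from_0) auto
      from has_integral_mult_right[OF this, of "unit_ball_vol N * (N / 2)"]
      have "((\<lambda>s. unit_ball_vol N * (N / 2) * s powr (N / 2 - 1)) has_integral
          unit_ball_vol N * t powr (N / 2)) {0..t}"
        using N by (simp add: mult_ac)
      from nn_integral_has_integral_lebesgue'[OF _ this]
      have "(\<integral>\<^sup>+s. ennreal (unit_ball_vol N * (N / 2) * s powr (N / 2 - 1)) * indicator {0..t} s \<partial>lborel)
          = ennreal (unit_ball_vol N * t powr (N / 2))"
        using N by (simp add: unit_ball_vol_nonneg)
      also have "(\<integral>\<^sup>+s. ennreal (unit_ball_vol N * (N / 2) * s powr (N / 2 - 1)) * indicator {0..t} s \<partial>lborel)
          = (\<integral>\<^sup>+s. ennreal (radial_density DIM('a) s) * indicator {..t} s \<partial>lborel)"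
        by (intro nn_integral_cong) (auto simp: radial_density_def indicator_def N_def)
      finally show ?thesis using False by (simp add: X e ball)
    qed
  qed
  show "Int_stable (range (\<lambda>t::real. {..t}))" by (auto simp: Int_stable_def)
  have b: "sets (borel :: real measure) = sigma_sets UNIV (range (\<lambda>t::real. {..t}))"
    by (simp add: borel_eq_atMost)
  show "sets ?D = sigma_sets UNIV (range (\<lambda>t::real. {..t}))"
    "sets (density lborel (\<lambda>s. ennreal (radial_density DIM('a) s)))
      = sigma_sets UNIV (range (\<lambda>t::real. {..t}))"
    using b by simp_all
  show "(\<Union>i. {..real i}) = UNIV" using real_arch_simple by auto
  show "emeasure ?D {..real i} \<noteq> \<infinity>" for i unfolding ball by simp
qed auto

section \<open>Pointwise bound for radial functions\<close>

lemma cauchy_schwarz_integral: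
  fixes f g :: "'b \<Rightarrow> real"
  assumes [measurable]: "f \<in> borel_measurable M" "g \<in> borel_measurable M"
    and f: "integrable M (\<lambda>x. (f x)\<^sup>2)" and g: "integrable M (\<lambda>x. (g x)\<^sup>2)"
  shows "\<bar>\<integral>x. f x * g x \<partial>M\<bar> \<le> sqrt (\<integral>x. (f x)\<^sup>2 \<partial>M) * sqrt (\<integral>x. (g x)\<^sup>2 \<partial>M)"
proof -
  have i: "integrable M (\<lambda>x. \<bar>f x * g x\<bar>)"
    using integrable_mult_square_integrable[OF assms] by simp
  have "(\<integral>\<^sup>+x. ennreal \<bar>f x\<bar> * ennreal \<bar>g x\<bar> \<partial>M)\<^sup>2
      \<le> (\<integral>\<^sup>+x. (ennreal \<bar>f x\<bar>)\<^sup>2 \<partial>M) * (\<integral>\<^sup>+x. (ennreal \<bar>g x\<bar>)\<^sup>2 \<partial>M)"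
    by (rule Cauchy_Schwarz_nn_integral) measurable
  also have "(\<integral>\<^sup>+x. ennreal \<bar>f x\<bar> * ennreal \<bar>g x\<bar> \<partial>M) = ennreal (\<integral>x. \<bar>f x * g x\<bar> \<partial>M)"
    using nn_integral_eq_integral[OF i] by (simp add: ennreal_mult[symmetric] abs_mult)
  also have "(\<integral>\<^sup>+x. (ennreal \<bar>f x\<bar>)\<^sup>2 \<partial>M) = ennreal (\<integral>x. (f x)\<^sup>2 \<partial>M)"
    using nn_integral_eq_integral[OF f] by (simp add: ennreal_power)
  also have "(\<integral>\<^sup>+x. (ennreal \<bar>g x\<bar>)\<^sup>2 \<partial>M) = ennreal (\<integral>x. (g x)\<^sup>2 \<partial>M)"
    using nn_integral_eq_integral[OF g] by (simp add: ennreal_power)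
  finally have "(\<integral>x. \<bar>f x * g x\<bar> \<partial>M)\<^sup>2 \<le> (\<integral>x. (f x)\<^sup>2 \<partial>M) * (\<integral>x. (g x)\<^sup>2 \<partial>M)"
    by (simp add: ennreal_power ennreal_mult[symmetric])
  then have "(\<integral>x. \<bar>f x * g x\<bar> \<partial>M) \<le> sqrt ((\<integral>x. (f x)\<^sup>2 \<partial>M) * (\<integral>x. (g x)\<^sup>2 \<partial>M))"
    by (rule real_le_rsqrt)
  moreover have "\<bar>\<integral>x. f x * g x \<partial>M\<bar> \<le> (\<integral>x. \<bar>f x * g x\<bar> \<partial>M)"
    using integral_norm_bound[of M "\<lambda>x. f x * g x"] by simp
  ultimately show ?thesis unfolding real_sqrt_mult by linarith
qed

text \<open>
  If \<open>k > K\<close> on a set of positive measure inside \<open>[a', b']\<close>, inner regularity gives a compact subset of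
  positive measure. Continuous cutoffs decreasing to its indicator, supported in the larger interval,
  violate the hypothesis in the limit.
\<close>

lemma AE_le_if_le_weakly:
  fixes \<mu> :: "real measure" and k :: "real \<Rightarrow> real"
  assumes \<mu>: "sets \<mu> = sets borel" "emeasure \<mu> (space \<mu>) \<noteq> \<infinity>"
    and k: "integrable \<mu> k" and ab: "a < a'" "b' < b"
    and le: "\<And>\<rho>. continuous_on UNIV \<rho> \<Longrightarrow> (\<And>s. 0 \<le> \<rho> s) \<Longrightarrow> (\<And>s. s \<le> a \<Longrightarrow> \<rho> s = 0)
      \<Longrightarrow> (\<And>s. b \<le> s \<Longrightarrow> \<rho> s = 0) \<Longrightarrow> (\<integral>s. k s * \<rho> s \<partial>\<mu>) \<le> K * (\<integral>s. \<rho> s \<partial>\<mu>)"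
  shows "AE s in \<mu>. a' \<le> s \<and> s \<le> b' \<longrightarrow> k s \<le> K"
proof -
  interpret finite_measure \<mu> by (rule finite_measureI) (rule \<mu>(2))
  have [measurable_cong]: "sets \<mu> = sets borel" by (rule \<mu>(1))
  have [simp]: "space \<mu> = UNIV" using sets_eq_imp_space_eq[OF \<mu>(1)] by simp
  have [measurable]: "k \<in> borel_measurable borel"
    using borel_measurable_integrable[OF k] by simp
  define E where "E = {s. a' \<le> s \<and> s \<le> b' \<and> K < k s}"
  have Em[measurable]: "E \<in> sets borel" unfolding E_def by measurable
  have "emeasure \<mu> E = 0"
  proof (rule ccontr)
    assume "emeasure \<mu> E \<noteq> 0"
    then have "0 < (SUP F \<in> {F. F \<subseteq> E \<and> compact F}. emeasure \<mu> F)"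
      using inner_regular[OF \<mu> Em] by (simp add: zero_less_iff_neq_zero)
    then obtain F where F: "F \<subseteq> E" "compact F" "0 < emeasure \<mu> F"
      by (auto simp: less_SUP_iff)
    then have F0: "F \<noteq> {}" by auto
    have [measurable]: "F \<in> sets borel" using F(2) by (simp add: borel_compact)
    obtain n0 :: nat where n0: "1 / real n0 < min (a' - a) (b - b')" "n0 > 0"
    proof -
      have "0 < min (a' - a) (b - b')" using ab by simp
      then obtain n where "inverse (real (Suc n)) < min (a' - a) (b - b')"
        using reals_Archimedean by blast
      then show thesis by (intro that[of "Suc n"]) (simp_all add: inverse_eq_divide)
    qed
    define \<rho> where "\<rho> n s = max 0 (1 - real (n + n0) * infdist s F)" for n s
    have c: "continuous_on UNIV (\<rho> n)" for n
      unfolding \<rho>_def by (intro continuous_intros)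
    have [measurable]: "\<rho> n \<in> borel_measurable borel" for n
      using c by (rule borel_measurable_continuous_onI)
    have far: "\<rho> n s = 0" if "min (a' - a) (b - b') \<le> infdist s F" for n s
    proof -
      have "1 / real n0 \<le> infdist s F" using n0(1) that by linarith
      then have "1 \<le> real n0 * infdist s F" using n0(2) by (simp add: divide_simps mult.commute)
      also have "\<dots> \<le> real (n + n0) * infdist s F"
        by (intro mult_right_mono infdist_nonneg) simp
      finally show ?thesis by (simp add: \<rho>_def)
    qed
    have left: "\<rho> n s = 0" if "s \<le> a" for n s
    proof (rule far)
      have "min (a' - a) (b - b') \<le> dist s y" if "y \<in> F" for y
        using F(1) that \<open>s \<le> a\<close> by (force simp: E_def dist_real_def)
      then show "min (a' - a) (b - b') \<le> infdist s F"
        using F0 by (simp add: infdist_notempty cINF_greatest)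
    qed
    have right: "\<rho> n s = 0" if "b \<le> s" for n s
    proof (rule far)
      have "min (a' - a) (b - b') \<le> dist s y" if "y \<in> F" for y
        using F(1) that \<open>b \<le> s\<close> by (force simp: E_def dist_real_def)
      then show "min (a' - a) (b - b') \<le> infdist s F"
        using F0 by (simp add: infdist_notempty cINF_greatest)
    qed
    have \<rho>01: "0 \<le> \<rho> n s" "\<rho> n s \<le> 1" for n s by (simp_all add: \<rho>_def infdist_nonneg)
    have lim: "(\<lambda>n. \<rho> n s) \<longlonglongrightarrow> indicator F s" for s
    proof (cases "s \<in> F")
      case True
      then show ?thesis by (simp add: \<rho>_def)
    next
      case False
      then have pos: "infdist s F > 0"
        using F F0 by (simp add: infdist_pos_not_in_closed compact_imp_closed)
      have "\<forall>\<^sub>F n in sequentially. \<rho> n s = 0"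
      proof -
        obtain n1 :: nat where n1: "1 / infdist s F < real n1" using reals_Archimedean2 by blast
        have "\<rho> n s = 0" if "n \<ge> n1" for n
        proof -
          have "1 < real n1 * infdist s F" using n1 pos by (simp add: divide_simps)
          also have "\<dots> \<le> real (n + n0) * infdist s F"
            using that by (intro mult_right_mono infdist_nonneg) simp
          finally show ?thesis by (simp add: \<rho>_def)
        qed
        then show ?thesis by (auto simp: eventually_sequentially)
      qed
      then show ?thesis using False by (simp add: tendsto_eventually)
    qed
    have l1: "(\<lambda>n. \<integral>s. k s * \<rho> n s \<partial>\<mu>) \<longlonglongrightarrow> (\<integral>s. k s * indicator F s \<partial>\<mu>)"
    proof (rule integral_dominated_convergence)
      show "integrable \<mu> (\<lambda>s. \<bar>k s\<bar>)" using k by simp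
      show "AE s in \<mu>. (\<lambda>n. k s * \<rho> n s) \<longlonglongrightarrow> k s * indicator F s"
        by (intro AE_I2 tendsto_intros lim)
      show "AE s in \<mu>. norm (k s * \<rho> n s) \<le> \<bar>k s\<bar>" for n
        using \<rho>01[of n] by (intro AE_I2) (simp add: abs_mult mult_left_le)
    qed measurable
    have l2: "(\<lambda>n. \<integral>s. \<rho> n s \<partial>\<mu>) \<longlonglongrightarrow> (\<integral>s. indicator F s \<partial>\<mu>)"
    proof (rule integral_dominated_convergence)
      show "integrable \<mu> (\<lambda>s. 1)" by simp
      show "AE s in \<mu>. (\<lambda>n. \<rho> n s) \<longlonglongrightarrow> indicator F s"
        by (intro AE_I2 lim)
      show "AE s in \<mu>. norm (\<rho> n s) \<le> 1" for n
        using \<rho>01[of n] by (intro AE_I2) simp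
    qed measurable
    have "(\<integral>s. k s * \<rho> n s \<partial>\<mu>) \<le> K * (\<integral>s. \<rho> n s \<partial>\<mu>)" for n
      by (rule le[OF c]) (simp_all add: \<rho>01 left right)
    then have "(\<integral>s. k s * indicator F s \<partial>\<mu>) \<le> K * (\<integral>s. indicator F s \<partial>\<mu>)"
      by (intro LIMSEQ_le[OF l1 tendsto_mult[OF tendsto_const l2]]) auto
    moreover have i: "integrable \<mu> (\<lambda>s. k s * indicator F s)" "integrable \<mu> (\<lambda>s. indicator F s :: real)"
    proof -
      show "integrable \<mu> (\<lambda>s. k s * indicator F s)"
        by (rule integrable_real_mult_indicator) (use k in auto)
      show "integrable \<mu> (\<lambda>s. indicator F s :: real)"
        by (rule integrable_real_indicator) (simp_all add: emeasure_eq_measure)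
    qed
    ultimately have le0: "(\<integral>s. k s * indicator F s - K * indicator F s \<partial>\<mu>) \<le> 0" by simp
    have nn: "0 \<le> k s * indicator F s - K * indicator F s" for s
      using F(1) by (auto simp: indicator_def E_def)
    have "0 \<le> (\<integral>s. k s * indicator F s - K * indicator F s \<partial>\<mu>)"
      by (rule Bochner_Integration.integral_nonneg) (rule nn)
    with le0 have "(\<integral>s. k s * indicator F s - K * indicator F s \<partial>\<mu>) = 0"
      by linarith
    then have "AE s in \<mu>. k s * indicator F s - K * indicator F s = 0"
      using i nn by (subst (asm) integral_nonneg_eq_0_iff_AE) auto
    then have "AE s in \<mu>. s \<notin> F"
      by eventually_elim (use F(1) in \<open>auto simp: E_def\<close>)
    then have "F \<in> null_sets \<mu>" by (subst AE_iff_null_sets) auto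
    then show False using F(3) by auto
  qed
  then have "E \<in> null_sets \<mu>" by auto
  then have "AE s in \<mu>. s \<notin> E" by (rule AE_not_in)
  then show ?thesis by eventually_elim (auto simp: E_def)
qed

lemma integral_Icc_has_derivative:
  fixes f :: "real \<Rightarrow> real"
  assumes "continuous_on UNIV f" "a < s"
  shows "((\<lambda>s. integral {a..s} f) has_real_derivative f s) (at s)"
proof -
  have "((\<lambda>s. integral {a..s} f) has_real_derivative f s) (at s within {a..s + 1})"
    by (rule integral_has_real_derivative) (use assms in \<open>auto intro: continuous_on_subset\<close>)
  then show ?thesis using assms(2) by (simp add: at_within_Icc_at)
qed

lemma integral_Icc_eq_lebesgue:
  fixes f :: "real \<Rightarrow> real"
  assumes "integrable lborel f"
  shows "integral {a..b} f = (\<integral>s. indicator {a..b} s * f s \<partial>lborel)"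
    and "integrable lborel (\<lambda>s. indicator {a..b} s * f s)"
proof -
  have "set_integrable lborel {a..b} f"
    unfolding set_integrable_def using assms by (intro integrable_mult_indicator) auto
  from set_borel_integral_eq_integral(2)[OF this] this
  show "integral {a..b} f = (\<integral>s. indicator {a..b} s * f s \<partial>lborel)"
    "integrable lborel (\<lambda>s. indicator {a..b} s * f s)"
    by (simp_all add: set_lebesgue_integral_def set_integrable_def)
qed

text \<open>
  In terms of \<open>s = |x|\<^sup>2\<close> and \<open>m = N/2 - 1\<close>, the Newtonian potential of the radial density \<open>\<rho>\<close> is
  \<open>- (1/m) (s\<^sup>-\<^sup>m J(s) + H(s))\<close>, where \<open>J\<close> integrates \<open>\<rho>(t) t\<^sup>m / 4\<close> over \<open>t \<le> s\<close> (the mass inside) and \<open>H\<close>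
  integrates \<open>\<rho>(t) / 4\<close> over \<open>t \<ge> s\<close> (the contribution of the shells outside). As \<open>\<rho>\<close> vanishes below
  \<open>A\<close>, the potential is constant near the origin, so the singular powers of \<open>s\<close> do no harm.
\<close>

lemma newton_potential:
  fixes \<rho> :: "real \<Rightarrow> real" and A B :: real
  defines "m \<equiv> real DIM('a::euclidean_space) / 2 - 1"
  assumes N: "DIM('a::euclidean_space) \<ge> 5" and c: "continuous_on UNIV \<rho>" and A: "A > 0"
    and left: "\<And>s. s \<le> A \<Longrightarrow> \<rho> s = 0" and right: "\<And>s. B \<le> s \<Longrightarrow> \<rho> s = 0"
  obtains \<psi> :: "'a::euclidean_space \<Rightarrow> real" where "times_cont_differentiable 2 \<psi>"
    "\<And>x. laplacian \<psi> x = \<rho> (x \<bullet> x)"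
    "\<And>x. \<bar>\<psi> x\<bar> \<le> 2 / m * (\<integral>s. \<bar>\<rho> s\<bar> * max s A powr m / 4 \<partial>lborel) * max (x \<bullet> x) A powr (- m)"
proof -
  have m: "m > 0" using N by (simp add: m_def)
  \<comment> \<open>Since \<open>\<rho>\<close> vanishes below \<open>A\<close>, replacing \<open>s\<close> by \<open>max s A\<close> changes nothing but makes \<open>j\<close> continuous on the line.\<close>
  define j where "j s = \<rho> s * max s A powr m / 4" for s
  have cj: "continuous_on UNIV j"
    unfolding j_def using A by (intro continuous_intros c) auto
  have j0: "j s = 0" if "s \<le> A" for s using left[OF that] by (simp add: j_def)
  have out: "\<rho> s = 0" if "max \<bar>A\<bar> \<bar>B\<bar> < norm s" for s
    using left[of s] right[of s] that by (cases "s \<le> A") auto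
  have ij: "integrable lborel j"
    by (rule integrable_continuous_compact_support[OF cj, of "max \<bar>A\<bar> \<bar>B\<bar>"]) (simp add: j_def out)
  have c4: "continuous_on UNIV (\<lambda>s. \<rho> s / 4)" by (intro continuous_intros c) simp
  have ic: "integrable lborel (\<lambda>s. \<rho> s / 4)"
    by (rule integrable_continuous_compact_support[OF c4, of "max \<bar>A\<bar> \<bar>B\<bar>"]) (simp add: out)
  define M where "M = (\<integral>s. \<bar>j s\<bar> \<partial>lborel)"
  have M: "M = (\<integral>s. \<bar>\<rho> s\<bar> * max s A powr m / 4 \<partial>lborel)"
    by (simp add: M_def j_def abs_mult)
  have M0: "M \<ge> 0" by (simp add: M_def)
  \<comment> \<open>The lower limit \<open>-1\<close>, instead of \<open>0\<close>, gives two-sided derivatives at \<open>s = 0\<close>.\<close>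
  define J where "J s = integral {-1..s} j" for s
  define H where "H s = (\<integral>s. \<rho> s / 4 \<partial>lborel) - integral {-1..s} (\<lambda>s. \<rho> s / 4)" for s
  have DJ: "(J has_real_derivative j s) (at s)" if "s > -1" for s
    unfolding J_def by (rule integral_Icc_has_derivative[OF cj that])
  have DH: "(H has_real_derivative - (\<rho> s / 4)) (at s)" if "s > -1" for s
    unfolding H_def using DERIV_diff[OF DERIV_const integral_Icc_has_derivative[OF c4 that]] by simp
  have J0: "J s = 0" if "s \<le> A" for s
  proof -
    have "J s = integral {-1..s} (\<lambda>_. 0)"
      unfolding J_def by (rule integral_cong) (use that j0 in auto)
    then show ?thesis by simp
  qed
  have Jb: "\<bar>J s\<bar> \<le> M" for s
  proof -
    have "\<bar>J s\<bar> \<le> (\<integral>t. \<bar>indicator {-1..s} t * j t\<bar> \<partial>lborel)"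
      unfolding J_def integral_Icc_eq_lebesgue(1)[OF ij]
      using integral_norm_bound[of lborel "\<lambda>t. indicator {-1..s} t * j t"] by simp
    also have "\<dots> \<le> M" unfolding M_def
      using ij integral_Icc_eq_lebesgue(2)[OF ij]
      by (intro integral_mono integrable_abs) (auto simp: indicator_def)
    finally show ?thesis .
  qed
  have Hb: "\<bar>H s\<bar> \<le> max s A powr (- m) * M" for s
  proof -
    have "H s = (\<integral>t. \<rho> t / 4 - indicator {-1..s} t * (\<rho> t / 4) \<partial>lborel)"
      unfolding H_def integral_Icc_eq_lebesgue(1)[OF ic]
      using ic integral_Icc_eq_lebesgue(2)[OF ic]
      by (intro Bochner_Integration.integral_diff[symmetric])
    then have "\<bar>H s\<bar> \<le> (\<integral>t. \<bar>\<rho> t / 4 - indicator {-1..s} t * (\<rho> t / 4)\<bar> \<partial>lborel)"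
      using integral_norm_bound[of lborel "\<lambda>t. \<rho> t / 4 - indicator {-1..s} t * (\<rho> t / 4)"] by simp
    also have "\<dots> \<le> (\<integral>t. max s A powr (- m) * \<bar>j t\<bar> \<partial>lborel)"
    proof (intro integral_mono integrable_abs integrable_mult_right Bochner_Integration.integrable_diff
        ic ij integral_Icc_eq_lebesgue(2))
      fix t
      show "\<bar>\<rho> t / 4 - indicator {-1..s} t * (\<rho> t / 4)\<bar> \<le> max s A powr (- m) * \<bar>j t\<bar>"
      proof (cases "t \<le> A \<or> (-1 \<le> t \<and> t \<le> s)")
        case True
        then show ?thesis using left by (auto simp: indicator_def)
      next
        case False
        then have t: "t > A" "t > s" using A by auto
        have "t powr (- m) \<le> max s A powr (- m)"
          using t A m by (intro powr_mono2') auto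
        moreover have "max s A powr (- m) * \<bar>j t\<bar> = (max s A powr (- m) * t powr m) * (\<bar>\<rho> t\<bar> / 4)"
          using t by (simp add: j_def abs_mult)
        moreover have "t powr (- m) * t powr m = 1"
          using t A by (simp add: powr_add[symmetric])
        ultimately have "1 * (\<bar>\<rho> t\<bar> / 4) \<le> max s A powr (- m) * \<bar>j t\<bar>"
          by (metis mult_right_mono abs_ge_zero divide_nonneg_pos powr_ge_zero zero_less_numeral)
        then show ?thesis using t by (simp add: indicator_def)
      qed
    qed
    also have "\<dots> = max s A powr (- m) * M" by (simp add: M_def)
    finally show ?thesis .
  qed
  define P where "P s = - (1 / m) * (J s * s powr (- m) + H s)" for s
  define P1 where "P1 s = J s * s powr (- m - 1)" for s
  define P2 where "P2 s = j s * s powr (- m - 1) + J s * ((- m - 1) * s powr (- m - 2))" for s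
  have jm: "j s * s powr (- m) = \<rho> s / 4" for s
  proof (cases "s \<le> A")
    case False
    then show ?thesis using A by (simp add: j_def powr_add[symmetric])
  qed (simp add: j0 left)
  have near: "(f has_real_derivative 0) (at s)"
    if s: "s \<ge> 0" "s \<le> A / 2" and const: "\<And>t. -1 < t \<Longrightarrow> t < A \<Longrightarrow> f t = f s" for f s
  proof (rule has_field_derivative_transform_within_open[OF DERIV_const[of "f s"]])
    show "open {-1<..<A}" "s \<in> {-1<..<A}" using s A by auto
    show "f s = f t" if "t \<in> {-1<..<A}" for t using that const[of t] by simp
  qed
  have Hc: "H t = H 0" if "-1 < t" "t < A" for t
  proof -
    have "integral {-1..r} (\<lambda>s. \<rho> s / 4) = integral {-1..r} (\<lambda>_. 0)" if "r < A" for r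
      by (rule integral_cong) (use that left in auto)
    then show ?thesis using that A by (simp add: H_def)
  qed
  have DP: "(P has_real_derivative P1 s) (at s)" if "s \<ge> 0" for s
  proof (cases "s \<le> A / 2")
    case True
    have "(P has_real_derivative 0) (at s)"
    proof (rule near[OF that True])
      have Pc: "P t = - (1 / m) * H 0" if "-1 < t" "t < A" for t
        using that by (simp add: P_def J0 Hc[OF that])
      show "P t = P s" if t: "-1 < t" "t < A" for t
        using Pc[OF t] Pc[of s] True A \<open>s \<ge> 0\<close> by simp
    qed
    then show ?thesis using True A by (simp add: P1_def J0)
  next
    case False
    then have s: "s > 0" using A by simp
    have pw: "((\<lambda>s. s powr (- m)) has_real_derivative (- m) * s powr (- m - 1)) (at s)"
      using s by (auto intro!: derivative_eq_intros)
    have "(P has_real_derivative - (1 / m) *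
        ((J s * ((- m) * s powr (- m - 1)) + j s * s powr (- m)) + - (\<rho> s / 4))) (at s)"
      unfolding P_def using s
      by (intro DERIV_cmult DERIV_add DH DERIV_mult'[OF DJ pw]) auto
    also have "- (1 / m) * ((J s * ((- m) * s powr (- m - 1)) + j s * s powr (- m)) + - (\<rho> s / 4)) = P1 s"
      using m by (simp add: jm P1_def)
    finally show ?thesis .
  qed
  have DP1: "(P1 has_real_derivative P2 s) (at s)" if "s \<ge> 0" for s
  proof (cases "s \<le> A / 2")
    case True
    have "(P1 has_real_derivative 0) (at s)"
      by (rule near[OF that True]) (use True A in \<open>auto simp: P1_def J0\<close>)
    then show ?thesis using True A by (simp add: P2_def J0 j0)
  next
    case False
    then have s: "s > 0" using A by simp
    have pw: "((\<lambda>s. s powr (- m - 1)) has_real_derivative (- m - 1) * s powr (- m - 2)) (at s)"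
    proof -
      have "- m - 1 - 1 = - m - 2" by simp
      with has_real_derivative_powr[OF s, of "- m - 1"] show ?thesis by (simp only:)
    qed
    show ?thesis
      unfolding P1_def P2_def using DERIV_mult'[OF DJ pw] s by (simp add: add.commute)
  qed
  have "continuous_on {0..} (\<lambda>s. j s * max s A powr (- m - 1) + J s * ((- m - 1) * max s A powr (- m - 2)))"
  proof -
    have "continuous_on {0..} J"
      by (rule DERIV_continuous_on[where D = j], rule DERIV_subset[OF DJ]) auto
    moreover have "continuous_on {0..} j" using cj by (rule continuous_on_subset) simp
    ultimately show ?thesis using A by (intro continuous_intros) auto
  qed
  also have "?this \<longleftrightarrow> continuous_on {0..} P2"
  proof (rule continuous_on_cong[OF refl])
    fix s show "j s * max s A powr (- m - 1) + J s * ((- m - 1) * max s A powr (- m - 2)) = P2 s"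
      by (cases "s \<le> A") (simp_all add: P2_def J0 j0)
  qed
  finally have CP2: "continuous_on {0..} P2" .
  show thesis
  proof (rule that)
    show "times_cont_differentiable 2 (\<lambda>x::'a. P (x \<bullet> x))"
      by (rule radial_laplacian(1)[OF DP DP1 CP2])
    show "laplacian (\<lambda>x::'a. P (x \<bullet> x)) x = \<rho> (x \<bullet> x)" for x
    proof -
      define s where "s = x \<bullet> x"
      have "laplacian (\<lambda>x::'a. P (x \<bullet> x)) x = 2 * real DIM('a) * P1 s + 4 * s * P2 s"
        unfolding s_def by (rule radial_laplacian(2)[OF DP DP1 CP2])
      also have "\<dots> = \<rho> s"
      proof (cases "s \<le> A")
        case True
        then show ?thesis by (simp add: P1_def P2_def J0 j0 left)
      next
        case False
        then have s: "s > 0" using A by simp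
        have e: "s * s powr (- m - 2) = s powr (- m - 1)" "s * s powr (- m - 1) = s powr (- m)"
        proof -
          have e: "1 + (- m - 2) = - m - 1" "1 + (- m - 1) = - m" by simp_all
          show "s * s powr (- m - 2) = s powr (- m - 1)" "s * s powr (- m - 1) = s powr (- m)"
            using powr_mult_base[of s "- m - 2"] powr_mult_base[of s "- m - 1"] s unfolding e by simp_all
        qed
        have "4 * s * P2 s = 4 * (j s * (s * s powr (- m - 1))) - 4 * (m + 1) * (J s * (s * s powr (- m - 2)))"
          unfolding P2_def by (simp add: algebra_simps)
        then have "4 * s * P2 s = 4 * (j s * s powr (- m)) - 4 * (m + 1) * (J s * s powr (- m - 1))"
          unfolding e .
        moreover have "2 * real DIM('a) = 4 * (m + 1)" by (simp add: m_def)
        ultimately show ?thesis by (simp add: P1_def jm)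
      qed
      finally show ?thesis by (simp add: s_def)
    qed
    show "\<bar>P (x \<bullet> x)\<bar> \<le> 2 / m * (\<integral>s. \<bar>\<rho> s\<bar> * max s A powr m / 4 \<partial>lborel) * max (x \<bullet> x) A powr (- m)"
      for x :: 'a
    proof -
      define s where "s = x \<bullet> x"
      have "\<bar>J s * s powr (- m)\<bar> \<le> max s A powr (- m) * M"
      proof (cases "s \<le> A")
        case False
        then show ?thesis using mult_right_mono[OF Jb[of s], of "s powr (- m)"] by (simp add: abs_mult mult.commute)
      qed (simp add: J0 M0)
      then have "\<bar>J s * s powr (- m) + H s\<bar> \<le> 2 * (max s A powr (- m) * M)"
        using Hb[of s] abs_triangle_ineq[of "J s * s powr (- m)" "H s"] by linarith
      then have "(1 / m) * \<bar>J s * s powr (- m) + H s\<bar> \<le> (1 / m) * (2 * (max s A powr (- m) * M))"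
        using m by (intro mult_left_mono) auto
      then show ?thesis using m by (simp add: P_def M s_def abs_mult mult_ac)
    qed
  qed
qed

lemma nn_integral_radial:
  fixes f :: "real \<Rightarrow> ennreal"
  assumes [measurable]: "f \<in> borel_measurable borel"
  shows "(\<integral>\<^sup>+x. f ((x::'a::euclidean_space) \<bullet> x) \<partial>lborel)
    = (\<integral>\<^sup>+s. ennreal (radial_density DIM('a) s) * f s \<partial>lborel)"
proof -
  have "(\<integral>\<^sup>+x. f ((x::'a) \<bullet> x) \<partial>lborel) = (\<integral>\<^sup>+s. f s \<partial>distr lborel borel (\<lambda>x::'a. x \<bullet> x))"
    by (subst nn_integral_distr) auto
  then show ?thesis unfolding distr_inner_self by (simp add: nn_integral_density)
qed

lemma integral_radial:
  fixes f :: "real \<Rightarrow> real"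
  assumes [measurable]: "f \<in> borel_measurable borel"
  shows "(\<integral>x. f ((x::'a::euclidean_space) \<bullet> x) \<partial>lborel)
    = (\<integral>s. radial_density DIM('a) s * f s \<partial>lborel)"
proof -
  have "(\<integral>x. f ((x::'a) \<bullet> x) \<partial>lborel) = (\<integral>s. f s \<partial>distr lborel borel (\<lambda>x::'a. x \<bullet> x))"
    by (subst integral_distr) auto
  then show ?thesis
    unfolding distr_inner_self by (simp add: integral_density radial_density_nonneg)
qed

text \<open>
  The square of the potential of a mass on the sphere \<open>|x|\<^sup>2 = A\<close> is, up to a factor, the integrand. It
  is integrable at infinity because \<open>m > 1\<close>, that is, \<open>N > 4\<close>.
\<close>

lemma nn_integral_max_powr_le:
  fixes A :: real
  defines "m \<equiv> real DIM('a::euclidean_space) / 2 - 1"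
  assumes N: "DIM('a::euclidean_space) \<ge> 5" and A: "A > 0"
  shows "(\<integral>\<^sup>+x. ennreal (max ((x::'a::euclidean_space) \<bullet> x) A powr (- 2 * m)) \<partial>lborel)
    \<le> ennreal (unit_ball_vol DIM('a) * (DIM('a) / 2) * (1 / (m + 1) + 1 / (m - 1)) * A powr (1 - m))"
proof -
  define c where "c = unit_ball_vol (real DIM('a)) * (real DIM('a) / 2)"
  have c: "c \<ge> 0" by (simp add: c_def unit_ball_vol_nonneg)
  have m: "m > 1" using N by (simp add: m_def)
  have "((\<lambda>s. s powr m) has_integral (A powr (m + 1) / (m + 1))) {0..A}"
    using A m by (intro has_integral_powr_from_0) auto
  from has_integral_mult_right[OF this, of "c * A powr (- 2 * m)"]
  have "((\<lambda>s. c * A powr (- 2 * m) * s powr m) has_integral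
      c * A powr (- 2 * m) * (A powr (m + 1) / (m + 1))) {0..A}" .
  also have "c * A powr (- 2 * m) * (A powr (m + 1) / (m + 1))
      = c * (1 / (m + 1)) * (A powr (- 2 * m) * A powr (m + 1))" by simp
  also have "A powr (- 2 * m) * A powr (m + 1) = A powr (1 - m)"
    by (simp add: powr_add[symmetric])
  finally have I1: "(\<integral>\<^sup>+s. ennreal (c * A powr (- 2 * m) * s powr m) * indicator {0..A} s \<partial>lborel)
      = ennreal (c * (1 / (m + 1)) * A powr (1 - m))"
    using c by (intro nn_integral_has_integral_lebesgue') auto
  have "((\<lambda>s. s powr (- m)) has_integral - (A powr (- m + 1)) / (- m + 1)) {A..}"
    using A m by (intro has_integral_powr_to_inf) auto
  from has_integral_mult_right[OF this, of c]
  have "((\<lambda>s. c * s powr (- m)) has_integral c * (- (A powr (- m + 1)) / (- m + 1))) {A..}" .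
  also have "c * (- (A powr (- m + 1)) / (- m + 1)) = c * (1 / (m - 1)) * A powr (1 - m)"
    using m by (simp add: divide_simps) (simp add: algebra_simps)
  finally have I2: "(\<integral>\<^sup>+s. ennreal (c * s powr (- m)) * indicator {A..} s \<partial>lborel)
      = ennreal (c * (1 / (m - 1)) * A powr (1 - m))"
    using c by (intro nn_integral_has_integral_lebesgue') auto
  have "(\<integral>\<^sup>+x. ennreal (max ((x::'a) \<bullet> x) A powr (- 2 * m)) \<partial>lborel)
      = (\<integral>\<^sup>+s. ennreal (radial_density DIM('a) s) * ennreal (max s A powr (- 2 * m)) \<partial>lborel)"
    by (rule nn_integral_radial) measurable
  also have "\<dots> \<le> (\<integral>\<^sup>+s. ennreal (c * A powr (- 2 * m) * s powr m) * indicator {0..A} s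
      + ennreal (c * s powr (- m)) * indicator {A..} s \<partial>lborel)"
  proof (rule nn_integral_mono)
    fix s :: real
    have d: "radial_density DIM('a) s = c * s powr m * indicator {0..} s"
      by (simp add: radial_density_def c_def m_def)
    consider "s < 0" | "0 \<le> s" "s \<le> A" | "A < s" by linarith
    then show "ennreal (radial_density DIM('a) s) * ennreal (max s A powr (- 2 * m))
      \<le> ennreal (c * A powr (- 2 * m) * s powr m) * indicator {0..A} s
      + ennreal (c * s powr (- m)) * indicator {A..} s"
    proof cases
      case 1
      then show ?thesis by (simp add: d)
    next
      case 2
      then have "ennreal (radial_density DIM('a) s) * ennreal (max s A powr (- 2 * m))
          = ennreal (c * A powr (- 2 * m) * s powr m)"
        using c by (simp add: d ennreal_mult[symmetric] max_def mult_ac)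
      then show ?thesis using 2 by simp
    next
      case 3
      then have "s powr m * s powr (- 2 * m) = s powr (- m)"
        using A by (simp add: powr_add[symmetric])
      then have "ennreal (radial_density DIM('a) s) * ennreal (max s A powr (- 2 * m))
          = ennreal (c * s powr (- m))"
        using 3 A c by (simp add: d ennreal_mult[symmetric] max_def mult.assoc)
      then show ?thesis using 3 by simp
    qed
  qed
  also have "\<dots> = ennreal (c * (1 / (m + 1)) * A powr (1 - m)) + ennreal (c * (1 / (m - 1)) * A powr (1 - m))"
    unfolding I1[symmetric] I2[symmetric] by (rule nn_integral_add) measurable
  also have "\<dots> = ennreal (c * (1 / (m + 1) + 1 / (m - 1)) * A powr (1 - m))"
    using c m by (subst ennreal_plus[symmetric]) (auto simp: algebra_simps)
  finally show ?thesis by (simp add: c_def)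
qed

text \<open>
  By the weak form of the Laplacian the left-hand side is the integral of \<open>g \<psi>\<close> for the potential \<open>\<psi>\<close> of
  \<open>\<rho>\<close>; the Cauchy--Schwarz inequality then reduces the claim to the norm of \<open>\<psi>\<close>.
\<close>

lemma weak_radial_bound:
  defines "m \<equiv> real DIM('a::euclidean_space) / 2 - 1"
  assumes N: "DIM('a::euclidean_space) \<ge> 5"
  shows "\<exists>K\<ge>0. \<forall>(u :: 'a::euclidean_space \<Rightarrow> real) g \<rho> A B. has_D22_laplacian u g \<longrightarrow> continuous_on UNIV \<rho>
      \<longrightarrow> A > 0 \<longrightarrow> (\<forall>s\<le>A. \<rho> s = 0) \<longrightarrow> (\<forall>s\<ge>B. \<rho> s = 0)
      \<longrightarrow> \<bar>\<integral>x. u x * \<rho> (x \<bullet> x) \<partial>lborel\<bar>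
        \<le> K * sqrt (\<integral>x. (g x)\<^sup>2 \<partial>lborel) * A powr ((1 - m) / 2) * (\<integral>x. \<bar>\<rho> ((x::'a) \<bullet> x)\<bar> \<partial>lborel)"
proof -
  define c where "c = unit_ball_vol (real DIM('a)) * (real DIM('a) / 2)"
  have c: "c > 0" by (simp add: c_def)
  have m: "m > 1" using N by (simp add: m_def)
  define L where "L = c * (1 / (m + 1) + 1 / (m - 1))"
  have L: "L \<ge> 0" using c m by (simp add: L_def)
  define K where "K = 2 / m * (1 / (4 * c)) * sqrt L"
  have "\<bar>\<integral>x. u x * \<rho> (x \<bullet> x) \<partial>lborel\<bar>
        \<le> K * sqrt (\<integral>x. (g x)\<^sup>2 \<partial>lborel) * A powr ((1 - m) / 2) * (\<integral>x. \<bar>\<rho> ((x::'a) \<bullet> x)\<bar> \<partial>lborel)"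
    if u: "has_D22_laplacian u g" and cont: "continuous_on UNIV \<rho>" and A: "A > 0"
      and left: "\<And>s. s \<le> A \<Longrightarrow> \<rho> s = 0" and right: "\<And>s. B \<le> s \<Longrightarrow> \<rho> s = 0"
    for u :: "'a \<Rightarrow> real" and g \<rho> A B
  proof -
    note [measurable] = has_D22_laplacian_measurable[OF u]
    have [measurable]: "\<rho> \<in> borel_measurable borel" using cont by (rule borel_measurable_continuous_onI)
    define I where "I = (\<integral>x. \<bar>\<rho> ((x::'a) \<bullet> x)\<bar> \<partial>lborel)"
    define M where "M = (\<integral>s. \<bar>\<rho> s\<bar> * max s A powr m / 4 \<partial>lborel)"
    have "I = (\<integral>s. radial_density DIM('a) s * \<bar>\<rho> s\<bar> \<partial>lborel)"
      unfolding I_def by (rule integral_radial) measurable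
    also have "\<dots> = (\<integral>s. (4 * c) * (\<bar>\<rho> s\<bar> * max s A powr m / 4) \<partial>lborel)"
    proof (rule Bochner_Integration.integral_cong[OF refl])
      fix s
      show "radial_density DIM('a) s * \<bar>\<rho> s\<bar> = (4 * c) * (\<bar>\<rho> s\<bar> * max s A powr m / 4)"
      proof (cases "s \<le> A")
        case False
        then show ?thesis using A by (simp add: radial_density_def c_def m_def max_def)
      qed (simp add: left)
    qed
    also have "\<dots> = 4 * c * M" unfolding M_def by (rule integral_mult_right_zero)
    finally have M: "M = 1 / (4 * c) * I" using c by simp
    have I0: "I \<ge> 0" by (simp add: I_def)
    obtain \<psi> :: "'a \<Rightarrow> real" where \<psi>: "times_cont_differentiable 2 \<psi>" "\<And>x. laplacian \<psi> x = \<rho> (x \<bullet> x)"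
      "\<And>x. \<bar>\<psi> x\<bar> \<le> 2 / m * M * max (x \<bullet> x) A powr (- m)"
    proof (rule newton_potential[OF N cont A, where B = B, folded m_def, folded M_def])
      show "\<rho> s = 0" if "s \<le> A" for s by (rule left[OF that])
      show "\<rho> s = 0" if "B \<le> s" for s by (rule right[OF that])
    qed (rule that)
    have [measurable]: "\<psi> \<in> borel_measurable borel"
      using times_cont_differentiable_2D(3)[OF \<psi>(1)] by (rule borel_measurable_continuous_onI)
    define D where "D = (2 / m * M)\<^sup>2 * (L * A powr (1 - m))"
    have "(\<integral>\<^sup>+x. ennreal ((\<psi> x)\<^sup>2) \<partial>lborel)
        \<le> (\<integral>\<^sup>+x. ennreal ((2 / m * M)\<^sup>2) * ennreal (max ((x::'a) \<bullet> x) A powr (- 2 * m)) \<partial>lborel)"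
    proof (rule nn_integral_mono)
      fix x :: 'a
      have "(\<psi> x)\<^sup>2 \<le> (2 / m * M * max (x \<bullet> x) A powr (- m))\<^sup>2"
        unfolding abs_le_square_iff[symmetric] by (rule order_trans[OF \<psi>(3) abs_ge_self])
      also have "\<dots> = (2 / m * M)\<^sup>2 * max (x \<bullet> x) A powr (- 2 * m)"
        by (simp add: power_mult_distrib power2_eq_square powr_add[symmetric])
      finally show "ennreal ((\<psi> x)\<^sup>2)
          \<le> ennreal ((2 / m * M)\<^sup>2) * ennreal (max (x \<bullet> x) A powr (- 2 * m))"
        by (simp add: ennreal_mult[symmetric] ennreal_leI)
    qed
    also have "\<dots> = ennreal ((2 / m * M)\<^sup>2) * (\<integral>\<^sup>+x. ennreal (max ((x::'a) \<bullet> x) A powr (- 2 * m)) \<partial>lborel)"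
      by (rule nn_integral_cmult) measurable
    also have "\<dots> \<le> ennreal ((2 / m * M)\<^sup>2) * ennreal (L * A powr (1 - m))"
      unfolding L_def c_def m_def by (intro mult_left_mono nn_integral_max_powr_le N A) simp
    also have "\<dots> = ennreal D" using L by (simp add: D_def ennreal_mult[symmetric])
    finally have nD: "(\<integral>\<^sup>+x. ennreal ((\<psi> x)\<^sup>2) \<partial>lborel) \<le> ennreal D" .
    then have i\<psi>: "integrable lborel (\<lambda>x. (\<psi> x)\<^sup>2)"
      by (intro integrableI_nonneg) (auto intro: le_less_trans)
    have D0: "D \<ge> 0" using L by (simp add: D_def)
    have "(\<integral>x. (\<psi> x)\<^sup>2 \<partial>lborel) \<le> D"
      using nD D0 by (subst (asm) nn_integral_eq_integral[OF i\<psi>]) auto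
    then have s\<psi>: "sqrt (\<integral>x. (\<psi> x)\<^sup>2 \<partial>lborel) \<le> sqrt D" by simp
    have "\<bar>2 / m * M\<bar> = 2 / m * M" using m M c I0 by simp
    moreover have "sqrt (A powr (1 - m)) = A powr ((1 - m) / 2)"
      using A by (simp add: powr_half_sqrt[symmetric] powr_powr)
    ultimately have sD: "sqrt D = K * A powr ((1 - m) / 2) * I"
      unfolding D_def real_sqrt_mult by (simp add: K_def M)
    have out: "laplacian \<psi> x = 0" if "sqrt (max B 0) < norm x" for x
    proof -
      have "max B 0 < norm x ^ 2"
        using that real_sqrt_less_iff[of "max B 0" "(norm x)\<^sup>2"] by simp
      then show ?thesis using right[of "x \<bullet> x"] by (simp add: \<psi>(2) power2_norm_eq_inner)
    qed
    have "\<bar>\<integral>x. u x * \<rho> (x \<bullet> x) \<partial>lborel\<bar> = \<bar>\<integral>x. g x * \<psi> x \<partial>lborel\<bar>"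
      using weak_laplacian(2)[OF u N \<psi>(1) i\<psi> out] by (simp add: \<psi>(2))
    also have "\<dots> \<le> sqrt (\<integral>x. (g x)\<^sup>2 \<partial>lborel) * sqrt (\<integral>x. (\<psi> x)\<^sup>2 \<partial>lborel)"
      by (rule cauchy_schwarz_integral) (use has_D22_laplacian_square_integrable[OF u N] i\<psi> in auto)
    also have "\<dots> \<le> sqrt (\<integral>x. (g x)\<^sup>2 \<partial>lborel) * sqrt D"
      by (intro mult_left_mono s\<psi>) simp
    finally show ?thesis by (simp add: sD I_def mult_ac)
  qed
  moreover have "K \<ge> 0" using m c L by (simp add: K_def)
  ultimately show ?thesis by (intro exI[of _ K]) blast
qed

text \<open>
  The measure \<open>\<mu>\<close> in the proof is the distribution of \<open>x \<bullet> x\<close> on a ball: it turns testing \<open>u\<close> against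
  radial functions into testing the profile \<open>k\<close> on the line.
\<close>

lemma radial_local_bound:
  fixes u :: "'a::euclidean_space \<Rightarrow> real" and k
  assumes N: "DIM('a::euclidean_space) \<ge> 5"
    and u: "has_D22_laplacian u g"
    and k[measurable]: "k \<in> borel_measurable borel" and uk: "AE x in lborel. u x = k (x \<bullet> x)"
    and A: "A > 0"
    and K: "\<And>\<rho>. continuous_on UNIV \<rho> \<Longrightarrow> (\<And>s. s \<le> A / 2 \<Longrightarrow> \<rho> s = 0) \<Longrightarrow> (\<And>s. 3 * A \<le> s \<Longrightarrow> \<rho> s = 0)
      \<Longrightarrow> \<bar>\<integral>x. u x * \<rho> (x \<bullet> x) \<partial>lborel\<bar> \<le> K * (\<integral>x. \<bar>\<rho> ((x::'a) \<bullet> x)\<bar> \<partial>lborel)"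
  shows "AE x in lborel. A \<le> x \<bullet> x \<and> x \<bullet> x \<le> 2 * A \<longrightarrow> \<bar>u x\<bar> \<le> K"
proof -
  note [measurable] = has_D22_laplacian_measurable[OF u]
  define S where "S = cball (0::'a) (sqrt (3 * A))"
  have [measurable]: "S \<in> sets borel" by (simp add: S_def)
  have S: "x \<in> S \<longleftrightarrow> x \<bullet> x \<le> 3 * A" for x by (simp add: S_def norm_eq_sqrt_inner)
  define \<nu> where "\<nu> = density lborel (\<lambda>x::'a. indicator S x :: ennreal)"
  define \<mu> where "\<mu> = distr \<nu> borel (\<lambda>x. x \<bullet> x)"
  have [measurable_cong]: "sets \<nu> = sets borel" by (simp add: \<nu>_def)
  have [simp]: "space \<nu> = UNIV" by (simp add: \<nu>_def)
  have \<mu>: "sets \<mu> = sets borel" by (simp add: \<mu>_def)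
  have fin: "emeasure lborel S < \<infinity>" unfolding S_def by (rule emeasure_bounded_finite) simp
  have "emeasure \<mu> (space \<mu>) = emeasure \<nu> UNIV" by (simp add: \<mu>_def emeasure_distr)
  also have "\<dots> = emeasure lborel S" by (simp add: \<nu>_def emeasure_density)
  finally have \<mu>fin: "emeasure \<mu> (space \<mu>) \<noteq> \<infinity>" using fin by simp
  have AE: "(AE s in \<mu>. P s) \<longleftrightarrow> (AE x in lborel. x \<in> S \<longrightarrow> P (x \<bullet> x))"
    if [measurable]: "Measurable.pred borel P" for P
  proof -
    have "(AE s in \<mu>. P s) \<longleftrightarrow> (AE x in \<nu>. P (x \<bullet> x))"
      unfolding \<mu>_def by (rule AE_distr_iff) measurable
    also have "\<dots> \<longleftrightarrow> (AE x in lborel. 0 < (indicator S x :: ennreal) \<longrightarrow> P (x \<bullet> x))"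
      unfolding \<nu>_def by (rule AE_density) measurable
    also have "\<dots> \<longleftrightarrow> (AE x in lborel. x \<in> S \<longrightarrow> P (x \<bullet> x))"
      by (rule AE_cong) (simp add: indicator_def)
    finally show ?thesis .
  qed
  have int: "(\<integral>s. f s \<partial>\<mu>) = (\<integral>x. indicator S x * f (x \<bullet> x) \<partial>lborel)"
    if [measurable]: "f \<in> borel_measurable borel" for f :: "real \<Rightarrow> real"
  proof -
    have "(\<integral>s. f s \<partial>\<mu>) = (\<integral>x. f (x \<bullet> x) \<partial>\<nu>)" unfolding \<mu>_def by (subst integral_distr) auto
    also have "\<dots> = (\<integral>x. indicator S x * f (x \<bullet> x) \<partial>lborel)"
      unfolding \<nu>_def ennreal_indicator[symmetric] by (subst integral_density) auto
    finally show ?thesis .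
  qed
  have ind: "integrable \<mu> f \<longleftrightarrow> integrable lborel (\<lambda>x. indicator S x * f (x \<bullet> x))"
    if [measurable]: "f \<in> borel_measurable borel" for f :: "real \<Rightarrow> real"
    unfolding \<mu>_def \<nu>_def ennreal_indicator[symmetric]
    by (subst integrable_distr_eq, simp, simp, subst integrable_density) auto
  have "integrable lborel (\<lambda>x. indicator S x * u x)"
  proof (rule Bochner_Integration.integrable_bound)
    show "integrable lborel (\<lambda>x. indicator S x + (3 * A)\<^sup>2 * (u x / (x \<bullet> x))\<^sup>2)"
      using fin by (intro Bochner_Integration.integrable_add integrable_mult_right rellich_integrable[OF u N]
          integrable_real_indicator) auto
    have "norm (indicator S x * u x) \<le> norm (indicator S x + (3 * A)\<^sup>2 * (u x / (x \<bullet> x))\<^sup>2)"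
      if "x \<noteq> 0" for x
    proof (cases "x \<in> S")
      case True
      have "\<bar>u x\<bar> \<le> 1 + (u x)\<^sup>2" using abs_mult_le_eps_squares[of 1 1 "u x"] by simp
      also have "(u x)\<^sup>2 = (x \<bullet> x)\<^sup>2 * (u x / (x \<bullet> x))\<^sup>2" using that by (simp add: power_divide)
      also have "\<dots> \<le> (3 * A)\<^sup>2 * (u x / (x \<bullet> x))\<^sup>2"
        using True S by (intro mult_right_mono power_mono) auto
      finally show ?thesis using True by simp
    qed simp
    then show "AE x in lborel. norm (indicator S x * u x)
        \<le> norm (indicator S x + (3 * A)\<^sup>2 * (u x / (x \<bullet> x))\<^sup>2)"
      using AE_lborel_singleton[of "0::'a"] by (auto elim: eventually_mono)
  qed measurable
  then have "integrable lborel (\<lambda>x. indicator S x * k (x \<bullet> x))"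
    by (rule integrable_cong_AE_imp) (use uk in \<open>auto elim: eventually_mono\<close>)
  then have ki: "integrable \<mu> k" by (simp add: ind)
  have wk: "(\<integral>s. k s * \<rho> s \<partial>\<mu>) \<le> K * (\<integral>s. \<rho> s \<partial>\<mu>)" "(\<integral>s. (- k s) * \<rho> s \<partial>\<mu>) \<le> K * (\<integral>s. \<rho> s \<partial>\<mu>)"
    if \<rho>: "continuous_on UNIV \<rho>" "\<And>s. 0 \<le> \<rho> s" "\<And>s. s \<le> A / 2 \<Longrightarrow> \<rho> s = 0" "\<And>s. 3 * A \<le> s \<Longrightarrow> \<rho> s = 0"
    for \<rho>
  proof -
    have [measurable]: "\<rho> \<in> borel_measurable borel" using \<rho>(1) by (rule borel_measurable_continuous_onI)
    have z: "\<rho> (x \<bullet> x) = 0" if "x \<notin> S" for x :: 'a using that S \<rho>(4) by auto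
    have "(\<integral>s. k s * \<rho> s \<partial>\<mu>) = (\<integral>x. indicator S x * (k (x \<bullet> x) * \<rho> (x \<bullet> x)) \<partial>lborel)"
      by (rule int) measurable
    also have "\<dots> = (\<integral>x. u x * \<rho> (x \<bullet> x) \<partial>lborel)"
      by (rule integral_cong_AE) (use uk z in \<open>auto elim!: eventually_mono simp: indicator_def\<close>)
    finally have 1: "(\<integral>s. k s * \<rho> s \<partial>\<mu>) = (\<integral>x. u x * \<rho> (x \<bullet> x) \<partial>lborel)" .
    have "(\<integral>s. \<rho> s \<partial>\<mu>) = (\<integral>x. indicator S x * \<rho> (x \<bullet> x) \<partial>lborel)"
      by (rule int) measurable
    also have "\<dots> = (\<integral>x. \<bar>\<rho> ((x::'a) \<bullet> x)\<bar> \<partial>lborel)"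
      by (rule Bochner_Integration.integral_cong) (use \<rho>(2) z in \<open>auto simp: indicator_def\<close>)
    finally have 2: "(\<integral>s. \<rho> s \<partial>\<mu>) = (\<integral>x. \<bar>\<rho> ((x::'a) \<bullet> x)\<bar> \<partial>lborel)" .
    have "\<bar>\<integral>x. u x * \<rho> (x \<bullet> x) \<partial>lborel\<bar> \<le> K * (\<integral>x. \<bar>\<rho> ((x::'a) \<bullet> x)\<bar> \<partial>lborel)"
      by (rule K) (use \<rho> in auto)
    then show "(\<integral>s. k s * \<rho> s \<partial>\<mu>) \<le> K * (\<integral>s. \<rho> s \<partial>\<mu>)" "(\<integral>s. (- k s) * \<rho> s \<partial>\<mu>) \<le> K * (\<integral>s. \<rho> s \<partial>\<mu>)"
      unfolding 2 by (simp_all add: 1)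
  qed
  have "AE s in \<mu>. A \<le> s \<and> s \<le> 2 * A \<longrightarrow> k s \<le> K"
    by (rule AE_le_if_le_weakly[where a = "A / 2" and b = "3 * A", OF \<mu> \<mu>fin ki _ _ wk(1)]) (use A in auto)
  moreover have "AE s in \<mu>. A \<le> s \<and> s \<le> 2 * A \<longrightarrow> - k s \<le> K"
    by (rule AE_le_if_le_weakly[where a = "A / 2" and b = "3 * A", OF \<mu> \<mu>fin _ _ _ wk(2)]) (use A ki in auto)
  ultimately have "AE s in \<mu>. A \<le> s \<and> s \<le> 2 * A \<longrightarrow> \<bar>k s\<bar> \<le> K"
    by eventually_elim auto
  then have "AE x in lborel. x \<in> S \<longrightarrow> A \<le> (x::'a) \<bullet> x \<and> x \<bullet> x \<le> 2 * A \<longrightarrow> \<bar>k (x \<bullet> x)\<bar> \<le> K"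
    by (subst (asm) AE) auto
  with uk show ?thesis
    by eventually_elim (use A in \<open>auto simp: S\<close>)
qed

text \<open>
  The local bound is applied on the dyadic shells \<open>2\<^sup>i \<le> |x|\<^sup>2 \<le> 2\<^sup>i\<^sup>+\<^sup>1\<close>, where it scales with the right power
  of the radius.
\<close>

lemma radial_pointwise_bound:
  assumes N: "DIM('a::euclidean_space) \<ge> 5"
  obtains K where "K \<ge> 0"
    "\<And>(u :: 'a::euclidean_space \<Rightarrow> real) g. has_D22_laplacian u g \<Longrightarrow> radially_symmetric u
      \<Longrightarrow> AE x in lborel. \<bar>u x\<bar> \<le> K * sqrt (\<integral>x. (g x)\<^sup>2 \<partial>lborel) * norm x powr (- ((real DIM('a) - 4) / 2))"
proof -
  define m where "m = real DIM('a) / 2 - 1"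
  define e where "e = (1 - m) / 2"
  have e: "e < 0" "2 * e = - ((real DIM('a) - 4) / 2)" using N by (simp_all add: e_def m_def field_simps)
  obtain K0 where K0: "K0 \<ge> 0"
    "\<forall>(u :: 'a \<Rightarrow> real) g \<rho> A B. has_D22_laplacian u g \<longrightarrow> continuous_on UNIV \<rho>
      \<longrightarrow> A > 0 \<longrightarrow> (\<forall>s\<le>A. \<rho> s = 0) \<longrightarrow> (\<forall>s\<ge>B. \<rho> s = 0)
      \<longrightarrow> \<bar>\<integral>x. u x * \<rho> (x \<bullet> x) \<partial>lborel\<bar>
        \<le> K0 * sqrt (\<integral>x. (g x)\<^sup>2 \<partial>lborel) * A powr e * (\<integral>x. \<bar>\<rho> ((x::'a) \<bullet> x)\<bar> \<partial>lborel)"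
    using weak_radial_bound[OF N, folded m_def, folded e_def] by blast
  \<comment> \<open>On the shell \<open>A \<le> |x|\<^sup>2 \<le> 2 A\<close> the local bound has \<open>A / 2\<close> in place of \<open>|x|\<^sup>2\<close>, and \<open>A / 2 \<ge> |x|\<^sup>2 / 4\<close>.\<close>
  define K where "K = K0 * (1 / 4) powr e"
  have "AE x in lborel. \<bar>u x\<bar> \<le> K * sqrt (\<integral>x. (g x)\<^sup>2 \<partial>lborel) * norm x powr (- ((real DIM('a) - 4) / 2))"
    if u: "has_D22_laplacian u g" and rad: "radially_symmetric u" for u :: "'a \<Rightarrow> real" and g
  proof -
    define G where "G = sqrt (\<integral>x. (g x)\<^sup>2 \<partial>lborel)"
    have G0: "G \<ge> 0" by (simp add: G_def)
    obtain h where "AE x in lborel. u x = h (norm x)" using rad by (auto simp: radially_symmetric_def)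
    then obtain k where k: "k \<in> borel_measurable borel" "AE x in lborel. u x = k (x \<bullet> x)"
      using radial_borel_representative[OF has_D22_laplacian_measurable(1)[OF u]] by blast
    have loc: "AE x in lborel. A \<le> x \<bullet> x \<and> x \<bullet> x \<le> 2 * A \<longrightarrow> \<bar>u x\<bar> \<le> K0 * G * (A / 2) powr e"
      if A: "A > 0" for A
      by (rule radial_local_bound[OF N u k A])
        (unfold G_def, rule K0(2)[rule_format, OF u], use A in auto)
    have "AE x in lborel. \<forall>i::int. 2 powr i \<le> x \<bullet> x \<and> x \<bullet> x \<le> 2 * 2 powr i
        \<longrightarrow> \<bar>u x\<bar> \<le> K0 * G * (2 powr i / 2) powr e"
      unfolding AE_all_countable by (intro allI loc) simp
    with AE_lborel_singleton[of "0::'a"] show ?thesis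
    proof eventually_elim
      case (elim x)
      define s where "s = x \<bullet> x"
      have s: "s > 0" using elim by (simp add: s_def)
      define i where "i = \<lfloor>log 2 s\<rfloor>"
      have "2 powr i \<le> 2 powr (log 2 s)" by (intro powr_mono) (auto simp: i_def)
      then have i1: "2 powr i \<le> s" using s by simp
      have "log 2 s \<le> i + 1" unfolding i_def by linarith
      then have "2 powr (log 2 s) \<le> 2 powr (i + 1)" by (intro powr_mono) auto
      then have i2: "s \<le> 2 * 2 powr i" using s by (simp add: powr_add)
      have "\<bar>u x\<bar> \<le> K0 * G * (2 powr i / 2) powr e"
        using elim(2) i1 i2 unfolding s_def by blast
      also have "\<dots> \<le> K0 * G * (1 / 4 * s) powr e"
        using i2 s e(1) K0(1) G0 by (intro mult_left_mono powr_mono2') auto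
      also have "\<dots> = K * G * s powr e" using s by (simp add: powr_mult K_def del: times_divide_eq_left)
      also have "s powr e = norm x powr (- ((real DIM('a) - 4) / 2))"
      proof -
        have "s = norm x powr 2" using elim by (simp add: s_def power2_norm_eq_inner)
        then have "s powr e = norm x powr (2 * e)" by (simp only: powr_powr)
        then show ?thesis unfolding e(2) .
      qed
      finally show ?case by (simp add: G_def)
    qed
  qed
  moreover have "K \<ge> 0" using K0(1) by (simp add: K_def)
  ultimately show thesis using that by blast
qed

section \<open>Bounds for the two infima\<close>

lemma has_D22_laplacian_D22_laplacian:
  assumes "u \<in> D22"
  shows "has_D22_laplacian u (D22_laplacian u)"
  using assms unfolding D22_def D22_laplacian_def mem_Collect_eq by (rule someI_ex)

lemma norm_powr_minus_4: "norm x powr (-4) * \<bar>u\<bar>\<^sup>2 = (u / (x \<bullet> x))\<^sup>2"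
proof (cases "x = 0")
  case False
  then have "norm x powr (-4) = inverse (norm x ^ 4)"
    by (simp add: powr_minus powr_numeral)
  also have "norm x ^ 4 = (x \<bullet> x)\<^sup>2"
    by (simp add: power2_norm_eq_inner[symmetric])
  finally show ?thesis by (simp add: divide_inverse power_mult_distrib power_inverse mult.commute)
qed simp

lemma quotient_Q_nonneg:
  assumes "lam \<le> 0"
  shows "0 \<le> quotient_Q q \<beta> lam u"
proof -
  have "0 \<le> (\<integral>x. norm x powr (-4) * \<bar>u x\<bar>\<^sup>2 \<partial>lborel)" by simp
  then have "lam * (\<integral>x. norm x powr (-4) * \<bar>u x\<bar>\<^sup>2 \<partial>lborel) \<le> 0"
    using assms by (rule mult_nonpos_nonneg[rotated])
  moreover have "0 \<le> (\<integral>x. \<bar>D22_laplacian u x\<bar>\<^sup>2 \<partial>lborel)" by simp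
  ultimately have "0 \<le> (\<integral>x. \<bar>D22_laplacian u x\<bar>\<^sup>2 \<partial>lborel)
      - lam * (\<integral>x. norm x powr (-4) * \<bar>u x\<bar>\<^sup>2 \<partial>lborel)" by linarith
  then show ?thesis unfolding quotient_Q_def by (rule divide_nonneg_nonneg) simp
qed

text \<open>
  The interpolation \<open>G powr \<theta> (L B) powr (1 - \<theta>) \<le> G + L B\<close> of the numerator is matched with
  \<open>\<theta> = 1 - 2/q\<close>, the power of \<open>G\<close> that the pointwise bound produces in the denominator.
\<close>

lemma radial_quotient_lower_bound:
  fixes q \<beta> :: real
  assumes N: "DIM('a::euclidean_space) \<ge> 5" and q: "q > 2"
    and \<beta>: "\<beta> = real DIM('a) - q * ((real DIM('a) - 4) / 2)"
  shows "\<exists>c>0. \<forall>lam<0. \<forall>u::'a \<Rightarrow> real. u \<in> D22_nonzero \<longrightarrow> radially_symmetric u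
    \<longrightarrow> c * (- lam) powr (2 / q) \<le> quotient_Q q \<beta> lam u"
proof -
  define a where "a = (real DIM('a) - 4) / 2"
  obtain K0 where K0: "K0 \<ge> 0" and bound: "\<And>(u :: 'a \<Rightarrow> real) g. has_D22_laplacian u g \<Longrightarrow> radially_symmetric u
      \<Longrightarrow> AE x in lborel. \<bar>u x\<bar> \<le> K0 * sqrt (\<integral>x. (g x)\<^sup>2 \<partial>lborel) * norm x powr (- a)"
    using radial_pointwise_bound[OF N, folded a_def] by metis
  \<comment> \<open>A positive constant, so that its powers can be divided by.\<close>
  define K where "K = K0 + 1"
  have K: "K > 0" "K0 \<le> K" using K0 by (auto simp: K_def)
  define \<theta> where "\<theta> = (q - 2) / q"
  have \<theta>: "\<theta> > 0" "2 / q > 0" "\<theta> + 2 / q = 1" using q by (auto simp: \<theta>_def field_simps)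
  define c where "c = 1 / K powr (2 * \<theta>)"
  have "c * (- lam) powr (2 / q) \<le> quotient_Q q \<beta> lam u"
    if lam: "lam < 0" and u: "u \<in> D22_nonzero" and rad: "radially_symmetric u" for lam and u :: "'a \<Rightarrow> real"
  proof -
    have "u \<in> D22" and nz: "\<not> (AE x in lborel. u x = 0)" using u by (auto simp: D22_nonzero_def)
    define g where "g = D22_laplacian u"
    have ug: "has_D22_laplacian u g"
      unfolding g_def by (rule has_D22_laplacian_D22_laplacian[OF \<open>u \<in> D22\<close>])
    note [measurable] = has_D22_laplacian_measurable[OF ug]
    define G where "G = (\<integral>x. (g x)\<^sup>2 \<partial>lborel)"
    define B where "B = (\<integral>x. (u x / (x \<bullet> x))\<^sup>2 \<partial>lborel)"
    define f where "f x = norm x powr (-\<beta>) * \<bar>u x\<bar> powr q" for x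
    define D where "D = (\<integral>x. f x \<partial>lborel)"
    define Y where "Y = (K * sqrt G) powr (q - 2)"
    have [measurable]: "f \<in> borel_measurable borel" unfolding f_def by measurable
    have G0: "G \<ge> 0" by (simp add: G_def)
    have B0: "B \<ge> 0" by (simp add: B_def)
    have f0: "0 \<le> f x" for x by (simp add: f_def)
    have iB: "integrable lborel (\<lambda>x. (u x / (x \<bullet> x))\<^sup>2)" by (rule rellich_integrable[OF ug N])
    have AEf: "AE x in lborel. f x \<le> Y * (u x / (x \<bullet> x))\<^sup>2"
      using bound[OF ug rad] AE_lborel_singleton[of "0::'a"]
    proof eventually_elim
      case (elim x)
      have x: "norm x > 0" using elim by simp
      show ?case
      proof (cases "u x = 0")
        case False
        have "K0 * sqrt G \<le> K * sqrt G" using K(2) G0 by (intro mult_right_mono) auto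
        then have "K0 * sqrt G * norm x powr (- a) \<le> K * sqrt G * norm x powr (- a)"
          by (rule mult_right_mono) simp
        then have le: "\<bar>u x\<bar> \<le> K * sqrt G * norm x powr (- a)"
          using elim(1) unfolding G_def by linarith
        have "\<bar>u x\<bar> powr q = \<bar>u x\<bar> powr (q - 2) * \<bar>u x\<bar> powr 2"
          by (simp only: powr_add[symmetric]) simp
        also have "\<dots> \<le> (K * sqrt G * norm x powr (- a)) powr (q - 2) * \<bar>u x\<bar> powr 2"
          using le q by (intro mult_right_mono powr_mono2) auto
        also have "(K * sqrt G * norm x powr (- a)) powr (q - 2) = Y * norm x powr (- a * (q - 2))"
          using K G0 by (simp add: powr_mult powr_powr Y_def)
        finally have "f x \<le> norm x powr (-\<beta>) * (Y * norm x powr (- a * (q - 2)) * \<bar>u x\<bar> powr 2)"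
          unfolding f_def by (intro mult_left_mono) auto
        also have "\<dots> = Y * (norm x powr (-\<beta>) * norm x powr (- a * (q - 2)) * \<bar>u x\<bar>\<^sup>2)"
          using False by simp
        also have "norm x powr (-\<beta>) * norm x powr (- a * (q - 2)) = norm x powr (-4)"
        proof -
          have "-\<beta> + (- a * (q - 2)) = - 4" unfolding \<beta> a_def by (simp add: field_simps)
          then show ?thesis by (simp only: powr_add[symmetric])
        qed
        finally show ?thesis by (simp only: norm_powr_minus_4)
      qed (simp add: f_def Y_def)
    qed
    have fi: "integrable lborel f"
    proof (rule Bochner_Integration.integrable_bound)
      show "integrable lborel (\<lambda>x. Y * (u x / (x \<bullet> x))\<^sup>2)" using iB by simp
      show "AE x in lborel. norm (f x) \<le> norm (Y * (u x / (x \<bullet> x))\<^sup>2)"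
        using AEf by eventually_elim (use f0 in \<open>auto intro: order_trans[OF _ abs_ge_self]\<close>)
    qed measurable
    have "D \<le> (\<integral>x. Y * (u x / (x \<bullet> x))\<^sup>2 \<partial>lborel)"
      unfolding D_def using iB by (intro integral_mono_AE fi AEf) simp
    then have DB: "D \<le> Y * B" by (simp add: B_def)
    have "D \<noteq> 0"
    proof
      assume "D = 0"
      then have "AE x in lborel. f x = 0"
        unfolding D_def using fi f0 by (subst (asm) integral_nonneg_eq_0_iff_AE) auto
      then have "AE x in lborel. u x = 0"
        using AE_lborel_singleton[of "0::'a"] by eventually_elim (auto simp: f_def)
      with nz show False by simp
    qed
    moreover have "D \<ge> 0" unfolding D_def using f0 by simp
    ultimately have D: "D > 0" by simp
    define n where "n = G - lam * B"
    have LB: "0 \<le> (- lam) * B" using lam B0 by (intro mult_nonneg_nonneg) auto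
    have Gn: "G \<le> n" "(- lam) * B \<le> n" "0 \<le> n" using LB G0 by (simp_all add: n_def)
    have "D powr (2 / q) \<le> (Y * B) powr (2 / q)"
      using D DB \<theta> by (intro powr_mono2) auto
    also have "\<dots> = K powr (2 * \<theta>) * (G powr \<theta> * B powr (2 / q))"
    proof -
      have "Y powr (2 / q) = (K * sqrt G) powr (2 * \<theta>)"
        by (simp add: Y_def powr_powr \<theta>_def mult.commute)
      also have "\<dots> = K powr (2 * \<theta>) * G powr \<theta>"
        using K G0 by (simp add: powr_mult powr_half_sqrt[symmetric] powr_powr)
      finally show ?thesis using B0 by (simp add: powr_mult Y_def)
    qed
    finally have 1: "D powr (2 / q) \<le> K powr (2 * \<theta>) * (G powr \<theta> * B powr (2 / q))" .
    have "G powr \<theta> * ((- lam) * B) powr (2 / q) \<le> n powr \<theta> * n powr (2 / q)"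
      using Gn G0 LB \<theta> by (intro mult_mono powr_mono2) auto
    also have "\<dots> = n"
      using Gn(3) by (cases "n = 0") (simp_all add: powr_add[symmetric] \<theta>(3))
    finally have 2: "G powr \<theta> * ((- lam) powr (2 / q) * B powr (2 / q)) \<le> n"
      using lam B0 by (simp only: powr_mult)
    have "c * (- lam) powr (2 / q) * D powr (2 / q)
        \<le> c * (- lam) powr (2 / q) * (K powr (2 * \<theta>) * (G powr \<theta> * B powr (2 / q)))"
      using 1 by (intro mult_left_mono) (auto simp: c_def)
    also have "\<dots> = G powr \<theta> * ((- lam) powr (2 / q) * B powr (2 / q))"
      using K by (simp add: c_def)
    also note 2
    finally have "c * (- lam) powr (2 / q) \<le> n / D powr (2 / q)"
      using D by (simp add: pos_le_divide_eq)
    also have "n / D powr (2 / q) = quotient_Q q \<beta> lam u"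
      unfolding quotient_Q_def norm_powr_minus_4
      by (simp add: n_def D_def f_def[abs_def] G_def B_def g_def)
    finally show ?thesis .
  qed
  moreover have "c > 0" using K by (simp add: c_def)
  ultimately show ?thesis by blast
qed

lemma test_function_powr_integrable:
  assumes "test_function \<phi>" "q > 0"
  shows "integrable lborel (\<lambda>x. \<bar>\<phi> x\<bar> powr q)"
proof -
  obtain R where "\<forall>x. R < norm x \<longrightarrow> \<phi> x = 0" using test_functionD(3)[OF assms(1)] by blast
  then show ?thesis
    using assms(2) by (intro integrable_continuous_compact_support[of _ R] continuous_on_powr' continuous_on_rabs
        continuous_on_const test_functionD(2)[OF assms(1)]) auto
qed

lemma integral_lborel_affine:
  fixes f :: "'a::euclidean_space \<Rightarrow> real"
  assumes [measurable]: "f \<in> borel_measurable borel" and c: "c > 0"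
  shows "(\<integral>x. f (c *\<^sub>R x + t) \<partial>lborel) = (1 / c) ^ DIM('a) * (\<integral>x. f x \<partial>lborel)"
proof -
  have "(\<integral>x. f x \<partial>lborel) = (\<integral>x. f x \<partial>density (distr lborel borel (\<lambda>x. t + c *\<^sub>R x)) (\<lambda>_. ennreal (\<bar>c\<bar> ^ DIM('a))))"
    using lborel_affine[of c t] c by simp
  also have "\<dots> = (\<integral>x. \<bar>c\<bar> ^ DIM('a) * f x \<partial>distr lborel borel (\<lambda>x. t + c *\<^sub>R x))"
    by (subst integral_density) auto
  also have "\<dots> = c ^ DIM('a) * (\<integral>x. f (c *\<^sub>R x + t) \<partial>lborel)"
    using c by (subst integral_distr) (auto simp: add.commute)
  finally show ?thesis using c by (simp add: power_divide)
qed

lemma not_AE_bump_eq_0: "\<not> (AE x::'a::euclidean_space in lborel. bump x = 0)"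
proof
  assume "AE x::'a in lborel. bump x = 0"
  then have "AE x::'a in lborel. x \<notin> ball 0 1"
  proof eventually_elim
    case (elim x)
    then show ?case using bump_pos[of x] by auto
  qed
  then have "ball (0::'a) 1 \<in> null_sets lborel" by (subst AE_iff_null_sets) auto
  then have "emeasure lborel (ball (0::'a) 1) = 0" by auto
  then show False using unit_ball_vol_pos[of "real DIM('a)"] by (simp add: emeasure_ball)
qed

text \<open>
  The restriction \<open>\<lambda> \<le> -16\<close> makes the radius \<open>\<epsilon> = (-\<lambda>) powr (-1/4)\<close> at most \<open>1/2\<close>, so the bump around a
  unit vector stays in the annulus \<open>1/2 \<le> |x| \<le> 2\<close>, on which both weights are bounded above and
  below.
\<close>

lemma concentrated_quotient_upper_bound:
  fixes q \<beta> :: real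
  assumes N: "DIM('a::euclidean_space) \<ge> 5" and q: "q > 2" and \<beta>: "\<beta> \<ge> 0"
  shows "\<exists>C. \<forall>lam\<le>-16. \<exists>u::'a \<Rightarrow> real. u \<in> D22_nonzero
    \<and> quotient_Q q \<beta> lam u \<le> C * (- lam) powr (1 - real DIM('a) / 4 * (1 - 2 / q))"
proof -
  define N' where "N' = real DIM('a)"
  define I1 where "I1 = (\<integral>x. (laplacian (bump :: 'a \<Rightarrow> real) x)\<^sup>2 \<partial>lborel)"
  define I2 where "I2 = (\<integral>x. (bump (x::'a))\<^sup>2 \<partial>lborel)"
  define I3 where "I3 = (\<integral>x. \<bar>bump (x::'a)\<bar> powr q \<partial>lborel)"
  note B = test_function_bump[where ?'a = 'a]
  note [measurable] = test_function_measurable[OF B]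
  have I3: "I3 > 0"
  proof -
    have "I3 \<noteq> 0"
    proof
      assume "I3 = 0"
      then have "AE x::'a in lborel. \<bar>bump x\<bar> powr q = 0"
        unfolding I3_def using test_function_powr_integrable[OF B, of q] q
        by (subst (asm) integral_nonneg_eq_0_iff_AE) auto
      then show False using not_AE_bump_eq_0[where ?'a = 'a] by simp
    qed
    then show ?thesis by (simp add: I3_def order_less_le)
  qed
  define C where "C = (I1 + 16 * I2) / (2 powr (-\<beta>) * I3) powr (2 / q)"
  have "\<exists>u::'a \<Rightarrow> real. u \<in> D22_nonzero
    \<and> quotient_Q q \<beta> lam u \<le> C * (- lam) powr (1 - real DIM('a) / 4 * (1 - 2 / q))"
    if lam: "lam \<le> -16" for lam
  proof -
    define L where "L = - lam"
    have L: "L \<ge> 16" "L > 0" using lam by (simp_all add: L_def)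
    define \<epsilon> where "\<epsilon> = L powr (- 1 / 4)"
    have \<epsilon>0: "\<epsilon> > 0" using L by (simp add: \<epsilon>_def)
    have \<epsilon>p: "\<epsilon> ^ k = L powr (- k / 4)" for k :: nat
      using L by (simp add: \<epsilon>_def powr_realpow[symmetric] powr_powr)
    have \<epsilon>1: "\<epsilon> \<le> 1 / 2"
    proof -
      have "\<epsilon> \<le> 16 powr (- 1 / 4)" unfolding \<epsilon>_def using L by (intro powr_mono2') auto
      also have "(16::real) powr (- 1 / 4) = (2 powr 4) powr (- 1 / 4)" by (simp add: powr_numeral)
      also have "\<dots> = 1 / 2" unfolding powr_powr by (simp add: powr_minus_divide)
      finally show ?thesis .
    qed
    obtain e :: 'a where e: "e \<in> Basis" using nonempty_Basis by blast
    define t where "t = - (1 / \<epsilon>) *\<^sub>R e"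
    define \<phi> where "\<phi> x = bump ((1 / \<epsilon>) *\<^sub>R x + t)" for x
    have T: "test_function \<phi>"
      using test_function_affine[OF B, of "1 / \<epsilon>" 1 t] \<epsilon>0 by (simp add: \<phi>_def[abs_def])
    note [measurable] = test_function_measurable[OF T]
    have lap: "laplacian \<phi> x = (1 / \<epsilon>)\<^sup>2 * laplacian bump ((1 / \<epsilon>) *\<^sub>R x + t)" for x
      unfolding \<phi>_def by (rule laplacian_affine[OF test_functionD(1)[OF B]])
    have scale: "(\<integral>x. f ((1 / \<epsilon>) *\<^sub>R x + t) \<partial>lborel) = \<epsilon> ^ DIM('a) * (\<integral>x. f x \<partial>lborel)"
      if "f \<in> borel_measurable borel" for f :: "'a \<Rightarrow> real"
      using integral_lborel_affine[OF that, of "1 / \<epsilon>" t] \<epsilon>0 by simp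
    have supp: "1 / 2 \<le> norm x \<and> norm x \<le> 2" if "\<phi> x \<noteq> 0" for x
    proof -
      have "norm ((1 / \<epsilon>) *\<^sub>R x + t) < 1"
        using that bump_outside[of "(1 / \<epsilon>) *\<^sub>R x + t"] by (force simp: \<phi>_def)
      also have "(1 / \<epsilon>) *\<^sub>R x + t = (1 / \<epsilon>) *\<^sub>R (x - e)" by (simp add: t_def algebra_simps)
      finally have "norm (x - e) < \<epsilon>" using \<epsilon>0 by (simp add: divide_simps)
      then have "norm (x - e) \<le> 1 / 2" using \<epsilon>1 by linarith
      moreover have "norm e = 1" using e by simp
      ultimately show ?thesis
        using norm_triangle_ineq[of "x - e" e] norm_triangle_ineq2[of e x] norm_minus_commute[of x e]
        by simp
    qed
    have D22: "\<phi> \<in> D22" using has_D22_laplacian_test_function[OF T] by (auto simp: D22_def)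
    have e3: "(\<integral>x. \<bar>\<phi> x\<bar> powr q \<partial>lborel) = \<epsilon> ^ DIM('a) * I3"
      unfolding \<phi>_def I3_def by (rule scale) measurable
    have nz: "\<not> (AE x in lborel. \<phi> x = 0)"
    proof
      assume "AE x in lborel. \<phi> x = 0"
      then have "(\<integral>x. \<bar>\<phi> x\<bar> powr q \<partial>lborel) = (\<integral>(x::'a). 0 \<partial>lborel)"
        by (intro integral_cong_AE) (auto elim: eventually_mono)
      then show False using e3 I3 \<epsilon>0 by simp
    qed
    note hD = has_D22_laplacian_D22_laplacian[OF D22]
    have "(\<integral>x. \<bar>D22_laplacian \<phi> x\<bar>\<^sup>2 \<partial>lborel) = (\<integral>x. (laplacian \<phi> x)\<^sup>2 \<partial>lborel)"
      using D22_laplacian_test_function[OF T N hD] has_D22_laplacian_measurable(2)[OF hD]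
      by (intro integral_cong_AE) (auto elim: eventually_mono)
    also have "\<dots> = (\<integral>x. (1 / \<epsilon>) ^ 4 * (laplacian bump ((1 / \<epsilon>) *\<^sub>R x + t))\<^sup>2 \<partial>lborel)"
      unfolding lap by (simp add: power_mult_distrib power_divide)
    also have "\<dots> = (1 / \<epsilon>) ^ 4 * (\<epsilon> ^ DIM('a) * I1)"
      unfolding I1_def using scale[of "\<lambda>x. (laplacian bump x)\<^sup>2"] by simp
    also have "(1 / \<epsilon>) ^ 4 = L" using L by (simp add: power_divide \<epsilon>p powr_minus_divide)
    finally have n1: "(\<integral>x. \<bar>D22_laplacian \<phi> x\<bar>\<^sup>2 \<partial>lborel) = L * \<epsilon> ^ DIM('a) * I1" by simp
    have "(\<integral>x. norm x powr (-4) * \<bar>\<phi> x\<bar>\<^sup>2 \<partial>lborel) \<le> (\<integral>x. 16 * (\<phi> x)\<^sup>2 \<partial>lborel)"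
    proof (rule integral_mono')
      show "integrable lborel (\<lambda>x. 16 * (\<phi> x)\<^sup>2)"
        using test_function_square_integrable[OF T] by simp
      show "norm x powr (-4) * \<bar>\<phi> x\<bar>\<^sup>2 \<le> 16 * (\<phi> x)\<^sup>2" for x
      proof (cases "\<phi> x = 0")
        case False
        have "norm x powr (-4) \<le> (1 / 2) powr (-4)"
          using supp[OF False] by (intro powr_mono2') auto
        also have "(1 / 2 :: real) powr (-4) = 16" by (simp add: powr_minus powr_numeral power_divide)
        finally show ?thesis by (simp add: mult_right_mono)
      qed simp
    qed simp
    also have "\<dots> = 16 * (\<epsilon> ^ DIM('a) * I2)"
      unfolding I2_def \<phi>_def using scale[of "\<lambda>x. (bump x)\<^sup>2"] by simp
    finally have n2: "(\<integral>x. norm x powr (-4) * \<bar>\<phi> x\<bar>\<^sup>2 \<partial>lborel) \<le> 16 * (\<epsilon> ^ DIM('a) * I2)" .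
    define D where "D = (\<integral>x. norm x powr (-\<beta>) * \<bar>\<phi> x\<bar> powr q \<partial>lborel)"
    have "2 powr (-\<beta>) * (\<epsilon> ^ DIM('a) * I3) = (\<integral>x. 2 powr (-\<beta>) * \<bar>\<phi> x\<bar> powr q \<partial>lborel)"
      by (simp add: e3)
    also have "\<dots> \<le> D"
      unfolding D_def
    proof (rule integral_mono)
      have q0: "q > 0" using q by simp
      show "integrable lborel (\<lambda>x. 2 powr (-\<beta>) * \<bar>\<phi> x\<bar> powr q)"
        using test_function_powr_integrable[OF T q0] by simp
      show "integrable lborel (\<lambda>x. norm x powr (-\<beta>) * \<bar>\<phi> x\<bar> powr q)"
      proof (rule Bochner_Integration.integrable_bound)
        show "integrable lborel (\<lambda>x. (1 / 2) powr (-\<beta>) * \<bar>\<phi> x\<bar> powr q)"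
          using test_function_powr_integrable[OF T q0] by simp
        have "norm x powr (-\<beta>) * \<bar>\<phi> x\<bar> powr q \<le> (1 / 2) powr (-\<beta>) * \<bar>\<phi> x\<bar> powr q" for x
        proof (cases "\<phi> x = 0")
          case False
          then show ?thesis using supp[OF False] \<beta> by (intro mult_right_mono powr_mono2') auto
        qed simp
        then show "AE x in lborel. norm (norm x powr (-\<beta>) * \<bar>\<phi> x\<bar> powr q)
            \<le> norm ((1 / 2) powr (-\<beta>) * \<bar>\<phi> x\<bar> powr q)" by (simp add: abs_mult)
      qed measurable
      show "2 powr (-\<beta>) * \<bar>\<phi> x\<bar> powr q \<le> norm x powr (-\<beta>) * \<bar>\<phi> x\<bar> powr q" for x
      proof (cases "\<phi> x = 0")
        case False
        then have "0 < norm x" "norm x \<le> 2" using supp[OF False] by auto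
        then show ?thesis using \<beta> by (intro mult_right_mono powr_mono2') auto
      qed simp
    qed
    finally have d: "2 powr (-\<beta>) * I3 * \<epsilon> ^ DIM('a) \<le> D" by (simp add: mult_ac)
    have dpos: "0 < 2 powr (-\<beta>) * I3 * \<epsilon> ^ DIM('a)" using I3 \<epsilon>0 by simp
    define n where "n = (\<integral>x. \<bar>D22_laplacian \<phi> x\<bar>\<^sup>2 \<partial>lborel)
        - lam * (\<integral>x. norm x powr (-4) * \<bar>\<phi> x\<bar>\<^sup>2 \<partial>lborel)"
    have "n \<le> L * \<epsilon> ^ DIM('a) * I1 + L * (16 * (\<epsilon> ^ DIM('a) * I2))"
      unfolding n_def n1 using mult_left_mono[OF n2, of L] L by (simp add: L_def)
    also have "\<dots> = (I1 + 16 * I2) * (L * \<epsilon> ^ DIM('a))" by (simp add: algebra_simps)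
    finally have n: "n \<le> (I1 + 16 * I2) * (L * \<epsilon> ^ DIM('a))" .
    have I0: "I1 \<ge> 0" "I2 \<ge> 0" by (simp_all add: I1_def I2_def)
    have "quotient_Q q \<beta> lam \<phi> = n / D powr (2 / q)"
      by (simp add: quotient_Q_def n_def D_def)
    also have "\<dots> \<le> (I1 + 16 * I2) * (L * \<epsilon> ^ DIM('a)) / (2 powr (-\<beta>) * I3 * \<epsilon> ^ DIM('a)) powr (2 / q)"
    proof (rule frac_le)
      show "0 \<le> (I1 + 16 * I2) * (L * \<epsilon> ^ DIM('a))" using I0 L \<epsilon>0 by simp
      show "0 < (2 powr (-\<beta>) * I3 * \<epsilon> ^ DIM('a)) powr (2 / q)" unfolding powr_gt_zero using dpos by linarith
      show "(2 powr (-\<beta>) * I3 * \<epsilon> ^ DIM('a)) powr (2 / q) \<le> D powr (2 / q)"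
        using d dpos q by (intro powr_mono2) auto
    qed (rule n)
    also have "\<dots> = C * (L * L powr (- N' / 4) / (L powr (- N' / 4)) powr (2 / q))"
      using I3 by (simp add: C_def powr_mult \<epsilon>p N'_def)
    also have "L * L powr (- N' / 4) / (L powr (- N' / 4)) powr (2 / q)
        = L powr (1 - N' / 4 * (1 - 2 / q))"
    proof -
      have "L * L powr (- N' / 4) / (L powr (- N' / 4)) powr (2 / q)
          = L powr 1 * L powr (- N' / 4) / L powr (- N' / 4 * (2 / q))"
        using L by (simp add: powr_powr)
      also have "\<dots> = L powr (1 + - N' / 4 - - N' / 4 * (2 / q))"
        unfolding powr_diff powr_add ..
      also have "1 + - N' / 4 - - N' / 4 * (2 / q) = 1 - N' / 4 * (1 - 2 / q)"
        by (simp add: algebra_simps)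
      finally show ?thesis .
    qed
    finally have "quotient_Q q \<beta> lam \<phi> \<le> C * (- lam) powr (1 - real DIM('a) / 4 * (1 - 2 / q))"
      by (simp add: L_def N'_def)
    then show ?thesis using D22 nz by (auto simp: D22_nonzero_def)
  qed
  then show ?thesis by blast
qed

theorem theorem5p2:
  fixes N :: nat and q \<beta> :: real
  assumes "N = CARD('n::finite)" and "N \<ge> 5"
    and "q \<in> {2 <.. critical_exponent N}"
    and "\<beta> = real N - q * ((real N - 4) / 2)"
  shows "\<exists>lam0::real. lam0 < 0 \<and>
           (\<forall>lam<lam0.
              S_inf TYPE(real ^ 'n) q \<beta> lam < S_rad TYPE(real ^ 'n) q \<beta> lam \<and>
              \<not> (\<exists>u :: real ^ 'n \<Rightarrow> real. is_extremal q \<beta> lam u \<and> radially_symmetric u))"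
proof -
  have dim: "DIM(real ^ 'n) = N" using assms(1) by simp
  have q: "q > 2" "q \<le> 2 * real N / (real N - 4)" using assms(3) by (auto simp: critical_exponent_def)
  have N: "DIM(real ^ 'n) \<ge> 5" using dim assms(2) by simp
  have \<beta>: "\<beta> = real DIM(real ^ 'n) - q * ((real DIM(real ^ 'n) - 4) / 2)" using assms(4) dim by simp
  have \<beta>0: "\<beta> \<ge> 0"
    using q(2) assms(2) unfolding assms(4) by (simp add: pos_le_divide_eq)
  obtain c where c: "c > 0" "\<And>lam u. lam < 0 \<Longrightarrow> (u :: real ^ 'n \<Rightarrow> real) \<in> D22_nonzero \<Longrightarrow> radially_symmetric u
      \<Longrightarrow> c * (- lam) powr (2 / q) \<le> quotient_Q q \<beta> lam u"
    using radial_quotient_lower_bound[OF N q(1) \<beta>] by blast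
  define a where "a = 1 - real N / 4 * (1 - 2 / q)"
  obtain C where C: "\<And>lam. lam \<le> -16 \<Longrightarrow> \<exists>u :: real ^ 'n \<Rightarrow> real. u \<in> D22_nonzero
      \<and> quotient_Q q \<beta> lam u \<le> C * (- lam) powr a"
    using concentrated_quotient_upper_bound[OF N q(1) \<beta>0] unfolding dim a_def by blast
  define \<delta> where "\<delta> = 2 / q - a"
  have "\<delta> = (real N / 4 - 1) * (1 - 2 / q)" by (simp add: \<delta>_def a_def algebra_simps)
  then have \<delta>: "\<delta> > 0" using assms(2) q(1) by simp
  \<comment> \<open>Beyond this threshold \<open>(- lam) powr \<delta>\<close> exceeds \<open>C / c\<close>; the number \<open>16\<close> comes from the upper bound.\<close>
  define lam0 where "lam0 = - max 16 ((max (C / c) 0 + 1) powr (1 / \<delta>))"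
  have "S_inf TYPE(real ^ 'n) q \<beta> lam < S_rad TYPE(real ^ 'n) q \<beta> lam
      \<and> \<not> (\<exists>u :: real ^ 'n \<Rightarrow> real. is_extremal q \<beta> lam u \<and> radially_symmetric u)"
    if lam: "lam < lam0" for lam
  proof -
    define L where "L = - lam"
    have L: "L > 16" "L > (max (C / c) 0 + 1) powr (1 / \<delta>)" using lam by (auto simp: lam0_def L_def)
    have neg: "lam < 0" "lam \<le> -16" using L by (simp_all add: L_def)
    have "C / c < max (C / c) 0 + 1" by simp
    also have "\<dots> = ((max (C / c) 0 + 1) powr (1 / \<delta>)) powr \<delta>"
      using \<delta> by (simp add: powr_powr)
    also have "\<dots> < L powr \<delta>"
      using L \<delta> by (intro powr_less_mono2) auto
    finally have "C < c * L powr \<delta>" using c(1) by (simp add: pos_divide_less_eq mult.commute)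
    then have "C * L powr a < c * L powr \<delta> * L powr a"
      using L by (intro mult_strict_right_mono) auto
    also have "\<dots> = c * L powr (2 / q)" by (simp add: mult.assoc powr_add[symmetric] \<delta>_def)
    finally have gap: "C * L powr a < c * L powr (2 / q)" .
    have bdd: "bdd_below (quotient_Q q \<beta> lam ` D)" for D :: "(real ^ 'n \<Rightarrow> real) set"
      using neg by (intro bdd_belowI2[of _ 0] quotient_Q_nonneg) simp
    obtain v :: "real ^ 'n \<Rightarrow> real" where v: "v \<in> D22_nonzero" "quotient_Q q \<beta> lam v \<le> C * L powr a"
      using C[OF neg(2)] unfolding L_def by blast
    have inf: "S_inf TYPE(real ^ 'n) q \<beta> lam \<le> C * L powr a"
      unfolding S_inf_def by (rule order_trans[OF cINF_lower[OF bdd v(1)] v(2)])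
    have bump: "(bump :: real ^ 'n \<Rightarrow> real) \<in> D22_nonzero" "radially_symmetric (bump :: real ^ 'n \<Rightarrow> real)"
    proof -
      show "(bump :: real ^ 'n \<Rightarrow> real) \<in> D22_nonzero"
        using has_D22_laplacian_test_function[OF test_function_bump] not_AE_bump_eq_0
        unfolding D22_nonzero_def D22_def by blast
      have "bump x = flat_exp 0 (1 - (norm x)\<^sup>2)" for x :: "real ^ 'n"
        by (simp add: bump_def power2_norm_eq_inner)
      then show "radially_symmetric (bump :: real ^ 'n \<Rightarrow> real)"
        unfolding radially_symmetric_def by (intro exI[of _ "\<lambda>r. flat_exp 0 (1 - r\<^sup>2)"]) simp
    qed
    have "c * L powr (2 / q) \<le> S_rad TYPE(real ^ 'n) q \<beta> lam"
      unfolding S_rad_def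
    proof (rule cINF_greatest)
      show "{u \<in> D22_nonzero :: (real ^ 'n \<Rightarrow> real) set. radially_symmetric u} \<noteq> {}"
        using bump by blast
      show "c * L powr (2 / q) \<le> quotient_Q q \<beta> lam u"
        if "u \<in> {u \<in> D22_nonzero. radially_symmetric u}" for u :: "real ^ 'n \<Rightarrow> real"
        using that c(2)[OF neg(1)] by (simp add: L_def)
    qed
    then have less: "S_inf TYPE(real ^ 'n) q \<beta> lam < S_rad TYPE(real ^ 'n) q \<beta> lam"
      using inf gap by linarith
    moreover have "\<not> (is_extremal q \<beta> lam u \<and> radially_symmetric u)" for u :: "real ^ 'n \<Rightarrow> real"
    proof
      assume "is_extremal q \<beta> lam u \<and> radially_symmetric u"
      then have u: "u \<in> {u \<in> D22_nonzero. radially_symmetric u}"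
        and eq: "quotient_Q q \<beta> lam u = S_inf TYPE(real ^ 'n) q \<beta> lam"
        by (auto simp: is_extremal_def)
      have "S_rad TYPE(real ^ 'n) q \<beta> lam \<le> quotient_Q q \<beta> lam u"
        unfolding S_rad_def by (rule cINF_lower[OF bdd u])
      with less eq show False by simp
    qed
    ultimately show ?thesis by blast
  qed
  moreover have "lam0 < 0" by (simp add: lam0_def)
  ultimately show ?thesis by blast
qed

end
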